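(* Let $X$ be a weighted pure $n$-dimensional finite simplicial complex that is a two-sided $\lambda$-local-spectral expander, and define constants $\varepsilon_k$, $0\le k\le n-1$, by $\varepsilon_0=\lambda$ and $\varepsilon_k=2k(1+2k\sqrt{k})\varepsilon_{k-1}+(k+1)\lambda$ for $k>0$. Suppose $\varepsilon_k\le\frac{1}{2(1+2(k+1)\sqrt{k+1})}$ for all $0\le k\le n-2$ and $\varepsilon_{n-1}<\frac{1}{2\sqrt n}$. For every $0\le k\le n-1$ and $0\le j_0\le k$, if $\varphi\in U_k^{j_0}$, then $$\|\varphi-P_{W_k^{j_0}}\varphi\|\le\sqrt{k+2}\,\varepsilon_k\|\varphi\|.$$ Moreover, for every $0\le j\le k$ and every $\phi\in C_0^k(X)$, $$\left\|P_{W_k^j}\phi\right\|^2\le\left\|P_{U_k^j}\phi\right\|^2+\left(\sqrt{k+2}\,\varepsilon_k+\frac{\sqrt{k+1}\,\varepsilon_k}{1-\sqrt{k+1}\,\varepsilon_k}\right)\|\phi\|^2$$ and $$\left\|P_{W_k^j}\phi\right\|^2\ge\left\|P_{U_k^j}\phi\right\|^2-\left(\sqrt{k+2}\,\varepsilon_k+\frac{\sqrt{k+1}\,\varepsilon_k}{1-\sqrt{k+1}\,\varepsilon_k}\right)\|\phi\|^2.$$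
   Context: A finite simplicial complex $X$ is pure $n$-dimensional ($n\ge1$) if every simplex is contained in an $n$-dimensional simplex. $X(k)$ is the set of $k$-dimensional simplices, with $X(-1)=\{\emptyset\}$. A weight function is a map $m:\bigcup_{-1\le k\le n}X(k)\to(0,\infty)$ with $m(\tau)=\sum_{\sigma\in X(k+1),\,\tau\subset\sigma}m(\sigma)$ for all $-1\le k\le n-1$, $\tau\in X(k)$. $C^k(X)$ is the space of all functions $X(k)\to\mathbb{R}$ with inner product $\langle\phi,\psi\rangle=\sum_{\sigma\in X(k)}m(\sigma)\phi(\sigma)\psi(\sigma)$ and norm $\|\cdot\|$. $C_0^k(X)=\{\phi\in C^k(X):\sum_{\sigma\in X(k)}m(\sigma)\phi(\sigma)=0\}$. Signless differential: $d_k:C^k(X)\to C^{k+1}(X)$, $d_k\phi(\sigma)=\sum_{\tau\in X(k),\,\tau\subset\sigma}\phi(\tau)$, with adjoint $d_k^*$. For $0\le k\le n-1$ the upper random walk operator $M_k^+$ on $C^k(X)$ is $M_k^+\phi(\tau)=\sum_{\tau'\in X(k)}M_k^+(\tau,\tau')\phi(\tau')$, where $M_k^+(\tau,\tau)=\frac1{k+2}$, $M_k^+(\tau,\tau')=\frac{m(\tau\cup\tau')}{(k+2)m(\tau)}$ if $\tau\cup\tau'\in X(k+1)$, and $0$ otherwise. It is self-adjoint and preserves $C_0^k(X)$. Subspaces of $C_0^k(X)$: $V_0^0=C_0^0(X)$; for $1\le k\le n-1$, $V_k^j=d_{k-1}\cdots d_j(C_0^j(X))$ for $0\le j\le k-1$,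 and $V_k^k=\ker(d_{k-1}^* )$, which is the orthogonal complement of $V_k^{k-1}$ in $C_0^k(X)$. Set $U_k^0=V_k^0$, $U_k^j=V_k^j\cap(V_k^{j-1})^\perp$ for $1\le j\le k-1$, and $U_k^k=V_k^k$. Then $C_0^k(X)=U_k^0\oplus\dots\oplus U_k^k$ orthogonally. $W_k^j$ is the subspace of $C_0^k(X)$ spanned by the eigenvectors $\varphi\in C_0^k(X)$ of $M_k^+$ with eigenvalue in $\left[\frac{k+1-j}{k+2}-\frac{\sqrt{k+1}}{k+2}\varepsilon_k,\ \frac{k+1-j}{k+2}+\frac{\sqrt{k+1}}{k+2}\varepsilon_k\right]$. $P_U$ denotes orthogonal projection onto $U$. For $\tau\in X(i)$, $-1\le i\le n-2$, the link $X_\tau$ is the complex of all simplices $\eta$ disjoint from $\tau$ with $\tau\cup\eta\in X$, with weight $m_\tau(\eta)=m(\tau\cup\eta)$. The non-lazy walk operator on functions $f$ on the vertices of $X_\tau$ is $f\mapsto\left(v\mapsto\sum_{w:\{v,w\}\in X_\tau(1)}\frac{m_\tau(\{v,w\})}{m_\tau(\{v\})}f(w)\right)$; it is self-adjoint with largest eigenvalue $1$; $\mu_\tau$ is its second largest eigenvalue (counted with multiplicity) and $\nu_\tau$ its smallest. $X$ is a two-sided $\lambda$-local-spectral expander if $-\lambda\le\nu_\tau$ and $\mu_\tau\le\lambda$ for every $\tau\in X(i)$, $-1\le i\le n-2$. *)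

theory Defs
  imports "HOL-Analysis.Analysis" "HOL-Library.Function_Algebras"
begin

section \<open>The real vector space of functions\<close>

definition fun_scale :: "real \<Rightarrow> ('b \<Rightarrow> real) \<Rightarrow> ('b \<Rightarrow> real)" where
  "fun_scale c f = (\<lambda>x. c * f x)"

global_interpretation fun_vs: vector_space "fun_scale :: real \<Rightarrow> ('b \<Rightarrow> real) \<Rightarrow> ('b \<Rightarrow> real)"
  by unfold_locales (auto simp: fun_scale_def algebra_simps)

section \<open>Weighted simplicial complexes\<close>

text \<open>The empty simplex belongs to the complex; a \<open>k\<close>-dimensional simplex has \<open>k + 1\<close> vertices,
  and the dimension index is an integer since it starts at \<open>-1\<close>.\<close>

definition finite_simplicial_complex :: "'a set set \<Rightarrow> bool" where
  "finite_simplicial_complex X \<longleftrightarrow>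
     finite X \<and> {} \<in> X \<and> (\<forall>\<sigma>\<in>X. finite \<sigma>) \<and> (\<forall>\<sigma>\<in>X. \<forall>\<tau>. \<tau> \<subseteq> \<sigma> \<longrightarrow> \<tau> \<in> X)"

definition faces :: "'a set set \<Rightarrow> int \<Rightarrow> 'a set set" where
  "faces X k = {\<sigma> \<in> X. int (card \<sigma>) = k + 1}"

definition pure_complex :: "'a set set \<Rightarrow> nat \<Rightarrow> bool" where
  "pure_complex X n \<longleftrightarrow>
     finite_simplicial_complex X \<and> n \<ge> 1 \<and> (\<forall>\<tau>\<in>X. \<exists>\<sigma>\<in>faces X (int n). \<tau> \<subseteq> \<sigma>)"

definition weight_function :: "'a set set \<Rightarrow> nat \<Rightarrow> ('a set \<Rightarrow> real) \<Rightarrow> bool" where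
  "weight_function X n m \<longleftrightarrow>
     (\<forall>\<sigma>\<in>X. m \<sigma> > 0) \<and>
     (\<forall>k::int. -1 \<le> k \<and> k \<le> int n - 1 \<longrightarrow>
        (\<forall>\<tau>\<in>faces X k. m \<tau> = (\<Sum>\<sigma> | \<sigma> \<in> faces X (k + 1) \<and> \<tau> \<subset> \<sigma>. m \<sigma>)))"

section \<open>Cochains\<close>

text \<open>A function on \<open>faces X k\<close> is encoded as a function on all sets that vanishes elsewhere.\<close>

definition cochains :: "'a set set \<Rightarrow> nat \<Rightarrow> ('a set \<Rightarrow> real) set" where
  "cochains X k = {\<phi>. \<forall>\<sigma>. \<sigma> \<notin> faces X (int k) \<longrightarrow> \<phi> \<sigma> = 0}"

definition cinner ::
  "'a set set \<Rightarrow> ('a set \<Rightarrow> real) \<Rightarrow> nat \<Rightarrow> ('a set \<Rightarrow> real) \<Rightarrow> ('a set \<Rightarrow> real) \<Rightarrow> real" where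
  "cinner X m k \<phi> \<psi> = (\<Sum>\<sigma>\<in>faces X (int k). m \<sigma> * \<phi> \<sigma> * \<psi> \<sigma>)"

definition cnorm :: "'a set set \<Rightarrow> ('a set \<Rightarrow> real) \<Rightarrow> nat \<Rightarrow> ('a set \<Rightarrow> real) \<Rightarrow> real" where
  "cnorm X m k \<phi> = sqrt (cinner X m k \<phi> \<phi>)"

definition cochains0 :: "'a set set \<Rightarrow> ('a set \<Rightarrow> real) \<Rightarrow> nat \<Rightarrow> ('a set \<Rightarrow> real) set" where
  "cochains0 X m k = {\<phi> \<in> cochains X k. (\<Sum>\<sigma>\<in>faces X (int k). m \<sigma> * \<phi> \<sigma>) = 0}"

definition is_proj ::
  "'a set set \<Rightarrow> ('a set \<Rightarrow> real) \<Rightarrow> nat \<Rightarrow> ('a set \<Rightarrow> real) set \<Rightarrow>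
   ('a set \<Rightarrow> real) \<Rightarrow> ('a set \<Rightarrow> real) \<Rightarrow> bool" where
  "is_proj X m k U \<phi> u \<longleftrightarrow> u \<in> U \<and> (\<forall>w\<in>U. cinner X m k (\<phi> - u) w = 0)"

text \<open>Orthogonal projection of a \<open>k\<close>-cochain onto a linear subspace \<open>U\<close> of \<open>cochains X k\<close>.\<close>

definition proj ::
  "'a set set \<Rightarrow> ('a set \<Rightarrow> real) \<Rightarrow> nat \<Rightarrow> ('a set \<Rightarrow> real) set \<Rightarrow>
   ('a set \<Rightarrow> real) \<Rightarrow> ('a set \<Rightarrow> real)" where
  "proj X m k U \<phi> = (THE u. is_proj X m k U \<phi> u)"

section \<open>Signless differential and upper random walk\<close>

definition sdiff :: "'a set set \<Rightarrow> nat \<Rightarrow> ('a set \<Rightarrow> real) \<Rightarrow> ('a set \<Rightarrow> real)" where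
  "sdiff X k \<phi> = (\<lambda>\<sigma>. if \<sigma> \<in> faces X (int k + 1)
     then (\<Sum>\<tau> | \<tau> \<in> faces X (int k) \<and> \<tau> \<subset> \<sigma>. \<phi> \<tau>) else 0)"

text \<open>The adjoint of \<open>sdiff X k\<close>, a map from \<open>cochains X (k + 1)\<close> to \<open>cochains X k\<close>.\<close>

definition sdiff_adj ::
  "'a set set \<Rightarrow> ('a set \<Rightarrow> real) \<Rightarrow> nat \<Rightarrow> ('a set \<Rightarrow> real) \<Rightarrow> ('a set \<Rightarrow> real)" where
  "sdiff_adj X m k \<psi> = (THE \<rho>. \<rho> \<in> cochains X k \<and>
     (\<forall>\<phi>\<in>cochains X k. cinner X m (k + 1) (sdiff X k \<phi>) \<psi> = cinner X m k \<phi> \<rho>))"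

definition upper_walk_kernel ::
  "'a set set \<Rightarrow> ('a set \<Rightarrow> real) \<Rightarrow> nat \<Rightarrow> 'a set \<Rightarrow> 'a set \<Rightarrow> real" where
  "upper_walk_kernel X m k \<tau> \<tau>' =
     (if \<tau> = \<tau>' then 1 / (real k + 2)
      else if \<tau> \<union> \<tau>' \<in> faces X (int k + 1) then m (\<tau> \<union> \<tau>') / ((real k + 2) * m \<tau>)
      else 0)"

definition upper_walk ::
  "'a set set \<Rightarrow> ('a set \<Rightarrow> real) \<Rightarrow> nat \<Rightarrow> ('a set \<Rightarrow> real) \<Rightarrow> ('a set \<Rightarrow> real)" where
  "upper_walk X m k \<phi> = (\<lambda>\<tau>. if \<tau> \<in> faces X (int k)
     then (\<Sum>\<tau>'\<in>faces X (int k). upper_walk_kernel X m k \<tau> \<tau>' * \<phi> \<tau>') else 0)"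

section \<open>The subspaces $V_k^j$, $U_k^j$, $W_k^j$\<close>

text \<open>\<open>sdiff_iter X j i\<close> is the composition $d_{j+i-1} \cdots d_j$ of \<open>i\<close> differentials.\<close>

primrec sdiff_iter :: "'a set set \<Rightarrow> nat \<Rightarrow> nat \<Rightarrow> ('a set \<Rightarrow> real) \<Rightarrow> ('a set \<Rightarrow> real)" where
  "sdiff_iter X j 0 = id"
| "sdiff_iter X j (Suc i) = sdiff X (j + i) \<circ> sdiff_iter X j i"

text \<open>For \<open>j > k\<close> the values of \<open>subV\<close>, \<open>subU\<close> and \<open>subW\<close> are irrelevant.\<close>

definition subV :: "'a set set \<Rightarrow> ('a set \<Rightarrow> real) \<Rightarrow> nat \<Rightarrow> nat \<Rightarrow> ('a set \<Rightarrow> real) set" where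
  "subV X m k j =
     (if k = 0 then cochains0 X m 0
      else if j < k then sdiff_iter X j (k - j) ` cochains0 X m j
      else {\<phi> \<in> cochains X k. sdiff_adj X m (k - 1) \<phi> = 0})"

definition subU :: "'a set set \<Rightarrow> ('a set \<Rightarrow> real) \<Rightarrow> nat \<Rightarrow> nat \<Rightarrow> ('a set \<Rightarrow> real) set" where
  "subU X m k j =
     (if 1 \<le> j \<and> j < k then {\<phi> \<in> subV X m k j. \<forall>\<psi>\<in>subV X m k (j - 1). cinner X m k \<phi> \<psi> = 0}
      else subV X m k j)"

primrec eps :: "real \<Rightarrow> nat \<Rightarrow> real" where
  "eps lam 0 = lam"
| "eps lam (Suc k) =
     2 * real (Suc k) * (1 + 2 * real (Suc k) * sqrt (real (Suc k))) * eps lam k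
     + (real (Suc k) + 1) * lam"

definition subW :: "'a set set \<Rightarrow> ('a set \<Rightarrow> real) \<Rightarrow> real \<Rightarrow> nat \<Rightarrow> nat \<Rightarrow> ('a set \<Rightarrow> real) set" where
  "subW X m lam k j = fun_vs.span {\<phi> \<in> cochains0 X m k. \<phi> \<noteq> 0 \<and>
     (\<exists>\<mu>. upper_walk X m k \<phi> = fun_scale \<mu> \<phi> \<and>
        (real k + 1 - real j) / (real k + 2) - sqrt (real k + 1) / (real k + 2) * eps lam k \<le> \<mu> \<and>
        \<mu> \<le> (real k + 1 - real j) / (real k + 2) + sqrt (real k + 1) / (real k + 2) * eps lam k)}"

section \<open>Links and local spectral expansion\<close>

definition link :: "'a set set \<Rightarrow> 'a set \<Rightarrow> 'a set set" where
  "link X \<tau> = {\<eta>. \<eta> \<inter> \<tau> = {} \<and> \<tau> \<union> \<eta> \<in> X}"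

definition link_weight :: "('a set \<Rightarrow> real) \<Rightarrow> 'a set \<Rightarrow> 'a set \<Rightarrow> real" where
  "link_weight m \<tau> \<eta> = m (\<tau> \<union> \<eta>)"

definition complex_vertices :: "'a set set \<Rightarrow> 'a set" where
  "complex_vertices Y = {v. {v} \<in> faces Y 0}"

definition nonlazy_walk ::
  "'a set set \<Rightarrow> ('a set \<Rightarrow> real) \<Rightarrow> ('a \<Rightarrow> real) \<Rightarrow> ('a \<Rightarrow> real)" where
  "nonlazy_walk Y w f = (\<lambda>v. if v \<in> complex_vertices Y
     then (\<Sum>u | {v, u} \<in> faces Y 1. w {v, u} / w {v} * f u) else 0)"

definition walk_eigenspace ::
  "'a set set \<Rightarrow> ('a set \<Rightarrow> real) \<Rightarrow> real \<Rightarrow> ('a \<Rightarrow> real) set" where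
  "walk_eigenspace Y w \<mu> =
     {f. (\<forall>v. v \<notin> complex_vertices Y \<longrightarrow> f v = 0) \<and> nonlazy_walk Y w f = fun_scale \<mu> f}"

text \<open>The decreasing list of eigenvalues, each repeated according to its multiplicity. As the walk
  is self-adjoint, the multiplicity is the dimension of the eigenspace.\<close>

definition walk_spectrum :: "'a set set \<Rightarrow> ('a set \<Rightarrow> real) \<Rightarrow> real list" where
  "walk_spectrum Y w =
     (THE xs. sorted_wrt (\<ge>) xs \<and> (\<forall>\<mu>. count_list xs \<mu> = fun_vs.dim (walk_eigenspace Y w \<mu>)))"

definition second_eigenvalue :: "'a set set \<Rightarrow> ('a set \<Rightarrow> real) \<Rightarrow> real" where
  "second_eigenvalue Y w = walk_spectrum Y w ! 1"

definition smallest_eigenvalue :: "'a set set \<Rightarrow> ('a set \<Rightarrow> real) \<Rightarrow> real" where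
  "smallest_eigenvalue Y w = last (walk_spectrum Y w)"

definition two_sided_local_spectral_expander ::
  "'a set set \<Rightarrow> nat \<Rightarrow> ('a set \<Rightarrow> real) \<Rightarrow> real \<Rightarrow> bool" where
  "two_sided_local_spectral_expander X n m lam \<longleftrightarrow>
     (\<forall>i::int. -1 \<le> i \<and> i \<le> int n - 2 \<longrightarrow> (\<forall>\<tau>\<in>faces X i.
        - lam \<le> smallest_eigenvalue (link X \<tau>) (link_weight m \<tau>) \<and>
        second_eigenvalue (link X \<tau>) (link_weight m \<tau>) \<le> lam))"

end

theory Submission
  imports Defs
begin

text \<open>Write $A_k = d_k^* d_k = (k+2) M_k^+$ and $c_j = k + 1 - j$. The walks on the links measure how far
$A_k$ is from $1 + d_{k-1} d_{k-1}^*$. Expanding $\langle A_k \phi, \phi\rangle$ over pairs of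
facets of a $(k+1)$-simplex and collecting the pairs by their common $(k-1)$-face $\tau$ gives
$\|\phi\|^2$ plus the sum over $\tau$ of the quadratic forms of the link walks at the restrictions
of $\phi$ to the links, and $\|d_{k-1}^*\phi\|^2$ is the part of this sum that comes from the
constants on the links. On the complement of the constants a link walk is bounded by
$\lambda$, so that $\|A_k - 1 - d_{k-1} d_{k-1}^*\| \le (k+1)\lambda$ (on $C_0^0$ for $k = 0$).

By induction on $k$ this makes $A_k$ nearly the scalar $c_j$ on $U_k^j$, with error $\varepsilon_k$
(lemma \<open>laplacian_on_subU\<close>). On $U_k^k = \ker d_{k-1}^*$ it is immediate. For $j < k$ an element of
$U_k^j$ is $d_{k-1}\psi$ with $\psi \in V_{k-1}^j$, and
$A_k d_{k-1}\psi \approx d_{k-1}(\psi + A_{k-1}\psi)$. Being orthogonal to $V_k^{j-1}$ only says that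
$A_{k-1}\psi \perp V_{k-1}^{j-1}$; since $A_{k-1}$ is nearly diagonal and bounded below, this still
forces $\psi$ to be close to its component in $U_{k-1}^j$ (lemma \<open>near_top_component\<close>).

The rest is perturbation theory for one symmetric operator (locale \<open>approx_spectral\<close>). By
Cauchy-Schwarz over the $k+1$ pieces, $A_k$ differs on $C_0^k$ from the operator $\sum_j c_j P_{U_k^j}$ by at most
$\delta = \sqrt{k+1}\,\varepsilon_k < 1/2$ in norm, so each eigenvalue of $A_k$ on $C_0^k$ lies
within $\delta$ of some $c_j$; these strips are disjoint and are the ones that define $W_k^j$. On
the complement of $W_k^j$ the eigenvalues stay $1 - \delta$ away from $c_j$, hence
$(1-\delta)\|\phi - P_{W_k^j}\phi\| \le \|(A_k - c_j)\phi\|$. With the bound $\varepsilon_k$ for the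
right-hand side one would only get $2\varepsilon_k$, which for $k \le 1$ exceeds
$\sqrt{k+2}\,\varepsilon_k$. The constant $\varepsilon_k$ is generous enough for the induction to give
$\varepsilon_k/2$ when $k \ge 1$, and for $k = 0$ the space $W_0^0$ is all of $C_0^0$. The comparison of the two
projections then follows by splitting $\phi$ along the $U_k^i$: the component in $U_k^i$ with
$i \ne j$ is close to $W_k^i$, which is orthogonal to $W_k^j$.

All eigenvectors come from one variational lemma (\<open>max_eigenvector\<close>): on an invariant subspace the
quadratic form of a symmetric operator is extremal at an eigenvector. It is applied to the link walks, to reach
the second and the last entry of their spectra, and to $A_k$ and $(A_k - c_j)^2$ on the complement
of $W_k^j$.\<close>

section \<open>Weighted inner products and orthogonal projections\<close>

definition ip :: "'b set \<Rightarrow> ('b \<Rightarrow> real) \<Rightarrow> ('b \<Rightarrow> real) \<Rightarrow> ('b \<Rightarrow> real) \<Rightarrow> real" where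
  "ip S w f g = (\<Sum>x\<in>S. w x * f x * g x)"

definition nm :: "'b set \<Rightarrow> ('b \<Rightarrow> real) \<Rightarrow> ('b \<Rightarrow> real) \<Rightarrow> real" where
  "nm S w f = sqrt (ip S w f f)"

text \<open>A function on \<open>S\<close> is extended by zero, which is also how cochains are encoded. Both cochains and
functions on the vertices of a link are instances of this space, with different weights.\<close>

definition supported :: "'b set \<Rightarrow> ('b \<Rightarrow> real) set" where
  "supported S = {f. \<forall>x. x \<notin> S \<longrightarrow> f x = 0}"

definition orth_proj :: "'b set \<Rightarrow> ('b \<Rightarrow> real) \<Rightarrow> ('b \<Rightarrow> real) set \<Rightarrow> ('b \<Rightarrow> real) \<Rightarrow> ('b \<Rightarrow> real) \<Rightarrow> bool" where
  "orth_proj S w U f u \<longleftrightarrow> u \<in> U \<and> (\<forall>v\<in>U. ip S w (f - u) v = 0)"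

lemma ip_add_left: "ip S w (f + g) h = ip S w f h + ip S w g h"
  by (simp add: ip_def sum.distrib algebra_simps)

lemma ip_diff_left: "ip S w (f - g) h = ip S w f h - ip S w g h"
  by (simp add: ip_def sum_subtractf algebra_simps)

lemma ip_scale_left: "ip S w (fun_scale c f) g = c * ip S w f g"
  by (simp add: ip_def fun_scale_def sum_distrib_left algebra_simps)

lemma ip_minus_left: "ip S w (- f) g = - ip S w f g"
  by (simp add: ip_def sum_negf)

lemma ip_commute: "ip S w f g = ip S w g f"
  by (simp add: ip_def algebra_simps)

lemma ip_add_right: "ip S w h (f + g) = ip S w h f + ip S w h g"
  by (metis ip_add_left ip_commute)

lemma ip_diff_right: "ip S w h (f - g) = ip S w h f - ip S w h g"
  by (metis ip_diff_left ip_commute)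

lemma ip_scale_right: "ip S w g (fun_scale c f) = c * ip S w g f"
  by (metis ip_scale_left ip_commute)

lemma ip_minus_right: "ip S w g (- f) = - ip S w g f"
  by (metis ip_minus_left ip_commute)

lemma ip_zero_left: "ip S w 0 f = 0"
  by (simp add: ip_def)

lemma ip_zero_right: "ip S w f 0 = 0"
  by (simp add: ip_def)

lemmas ip_simps = ip_add_left ip_diff_left ip_scale_left ip_minus_left ip_zero_left
  ip_add_right ip_diff_right ip_scale_right ip_minus_right ip_zero_right

lemma ip_sum_left: "ip S w (\<Sum>i\<in>J. f i) g = (\<Sum>i\<in>J. ip S w (f i) g)"
  by (induction J rule: infinite_finite_induct)
    (simp_all only: sum.infinite sum.empty sum.insert ip_simps simp_thms)

lemma ip_sum_right: "ip S w g (\<Sum>i\<in>J. f i) = (\<Sum>i\<in>J. ip S w g (f i))"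
  by (induction J rule: infinite_finite_induct)
    (simp_all only: sum.infinite sum.empty sum.insert ip_simps simp_thms)

lemma subspace_supported: "fun_vs.subspace (supported S)"
  by (auto simp: fun_vs.subspace_def supported_def fun_scale_def)

lemma ip_perp_span:
  assumes "\<And>b. b \<in> B \<Longrightarrow> ip S w f b = 0" "v \<in> fun_vs.span B"
  shows "ip S w f v = 0"
proof -
  have "fun_vs.subspace {v. ip S w f v = 0}"
    by (auto simp: fun_vs.subspace_def ip_simps)
  then have "fun_vs.span B \<subseteq> {v. ip S w f v = 0}"
    using assms(1) by (intro fun_vs.span_minimal) auto
  then show ?thesis using assms(2) by auto
qed

locale wspace =
  fixes S :: "'b set" and w :: "'b \<Rightarrow> real"
  assumes finite_S: "finite S" and w_pos: "\<And>x. x \<in> S \<Longrightarrow> w x > 0"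
begin

abbreviation "inn \<equiv> ip S w"
abbreviation "nrm \<equiv> nm S w"
abbreviation "Fun \<equiv> supported S"

lemma inn_ge_0: "inn f f \<ge> 0"
  unfolding ip_def using w_pos by (intro sum_nonneg) (simp add: less_imp_le mult.assoc)

lemma nrm_ge_0: "nrm f \<ge> 0"
  by (simp add: nm_def inn_ge_0)

lemma nrm_sq: "(nrm f)\<^sup>2 = inn f f"
  by (simp add: nm_def inn_ge_0)

lemma inn_eq_0D:
  assumes "inn f f = 0" "f \<in> Fun"
  shows "f = 0"
proof
  fix x
  have "\<forall>x\<in>S. w x * f x * f x = 0"
    using assms(1) w_pos unfolding ip_def
    by (subst (asm) sum_nonneg_eq_0_iff) (auto simp: finite_S less_imp_le mult.assoc)
  then show "f x = 0 x"
    using assms(2) w_pos by (cases "x \<in> S") (force simp: supported_def)+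
qed

lemma inn_pos: "f \<in> Fun \<Longrightarrow> f \<noteq> 0 \<Longrightarrow> inn f f > 0"
  using inn_ge_0[of f] inn_eq_0D[of f] by fastforce

lemma nrm_eq_L2: "nrm f = L2_set (\<lambda>x. sqrt (w x) * f x) S"
proof -
  have "inn f f = (\<Sum>x\<in>S. (sqrt (w x) * f x)\<^sup>2)"
    unfolding ip_def using w_pos
    by (intro sum.cong) (auto simp: power2_eq_square less_imp_le algebra_simps)
  then show ?thesis by (simp add: nm_def L2_set_def)
qed

lemma cauchy_schwarz: "\<bar>inn f g\<bar> \<le> nrm f * nrm g"
proof -
  have "\<bar>inn f g\<bar> \<le> (\<Sum>x\<in>S. \<bar>w x * f x * g x\<bar>)"
    unfolding ip_def by (rule sum_abs)
  also have "\<dots> = (\<Sum>x\<in>S. \<bar>sqrt (w x) * f x\<bar> * \<bar>sqrt (w x) * g x\<bar>)"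
  proof (rule sum.cong[OF refl])
    fix x assume "x \<in> S"
    then have "w x = sqrt (w x) * sqrt (w x)" "w x > 0" using w_pos by (auto simp: less_imp_le)
    then show "\<bar>w x * f x * g x\<bar> = \<bar>sqrt (w x) * f x\<bar> * \<bar>sqrt (w x) * g x\<bar>"
      by (simp add: abs_mult)
  qed
  also have "\<dots> \<le> nrm f * nrm g"
    unfolding nrm_eq_L2 by (rule L2_set_mult_ineq)
  finally show ?thesis .
qed

lemma nrm_triangle: "nrm (f + g) \<le> nrm f + nrm g"
  using L2_set_triangle_ineq[of "\<lambda>x. sqrt (w x) * f x" "\<lambda>x. sqrt (w x) * g x" S]
  by (simp add: nrm_eq_L2 distrib_left)

lemma nrm_sum: "nrm (\<Sum>i\<in>J. f i) \<le> (\<Sum>i\<in>J. nrm (f i))"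
proof (induction J rule: infinite_finite_induct)
  case (insert x F)
  have "nrm (\<Sum>i\<in>insert x F. f i) = nrm (f x + sum f F)"
    by (simp only: sum.insert[OF insert(1,2)])
  also have "\<dots> \<le> nrm (f x) + (\<Sum>i\<in>F. nrm (f i))"
    using nrm_triangle[of "f x" "sum f F"] insert.IH by linarith
  finally show ?case by (simp only: sum.insert[OF insert(1,2)])
qed (simp_all add: nm_def ip_def)

lemma nrm_eq_0D: "nrm f = 0 \<Longrightarrow> f \<in> Fun \<Longrightarrow> f = 0"
  using inn_eq_0D nrm_sq by (metis zero_power2)

lemma pythagoras: "inn f g = 0 \<Longrightarrow> (nrm (f + g))\<^sup>2 = (nrm f)\<^sup>2 + (nrm g)\<^sup>2"
  by (simp add: nrm_sq ip_simps ip_commute[of S w g f])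

text \<open>The point masses span, so every subspace of \<open>supported S\<close> is finite dimensional.\<close>

lemma supported_finite_span: "Fun \<subseteq> fun_vs.span ((\<lambda>y x. if x = y then 1 else 0) ` S)"
proof
  fix f :: "'b \<Rightarrow> real" assume f: "f \<in> Fun"
  have "(\<Sum>y\<in>S. fun_scale (f y) (\<lambda>x. if x = y then 1 else 0)) x = f x" for x
  proof -
    have "(\<Sum>y\<in>J. fun_scale (f y) (\<lambda>x. if x = y then 1 else 0)) x
       = (\<Sum>y\<in>J. if x = y then f y else 0)" if "finite J" for J
      using that by (induction J) (auto simp: fun_scale_def)
    from this[OF finite_S] show ?thesis
      using f finite_S by (auto simp: supported_def)
  qed
  then have "f = (\<Sum>y\<in>S. fun_scale (f y) (\<lambda>x. if x = y then 1 else 0))" by auto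
  also have "\<dots> \<in> fun_vs.span ((\<lambda>y x. if x = y then 1 else 0) ` S)"
    by (intro fun_vs.span_sum fun_vs.span_scale fun_vs.span_base) auto
  finally show "f \<in> fun_vs.span ((\<lambda>y x. if x = y then 1 else 0) ` S)" .
qed

lemma independent_finite:
  assumes "fun_vs.independent B" "B \<subseteq> Fun"
  shows "finite B"
  using fun_vs.independent_span_bound[OF _ assms(1)] supported_finite_span assms(2) finite_S
  by (meson finite_imageI order_trans)

lemma subspace_finite_basis:
  assumes "fun_vs.subspace U" "U \<subseteq> Fun"
  obtains B where "finite B" "B \<subseteq> U" "fun_vs.span B = U"
proof -
  obtain B where B: "B \<subseteq> U" "fun_vs.independent B" "U \<subseteq> fun_vs.span B"
    using fun_vs.maximal_independent_subset by blast
  have "fun_vs.span B \<subseteq> U" using B(1) assms(1) fun_vs.span_minimal by blast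
  then show ?thesis using that[of B] B independent_finite[of B] assms(2) by blast
qed

text \<open>One Gram-Schmidt step per generator. If the new direction \<open>b'\<close> has norm zero, then the coefficient
is a division by zero and equals 0, which is right because by Cauchy-Schwarz \<open>b'\<close> is then orthogonal
to everything.\<close>

lemma ex_orth_proj_span:
  assumes "finite B"
  shows "\<exists>u. orth_proj S w (fun_vs.span B) f u"
  using assms
proof (induction B arbitrary: f)
  case empty
  then show ?case by (auto simp: orth_proj_def ip_simps)
next
  case (insert b B)
  obtain b0 where b0: "orth_proj S w (fun_vs.span B) b b0" using insert.IH by blast
  obtain u where u: "orth_proj S w (fun_vs.span B) f u" using insert.IH by blast
  define b' where "b' = b - b0"
  have perp: "inn b' v = 0" if "v \<in> fun_vs.span B" for v
    using b0 that by (auto simp: orth_proj_def b'_def)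
  have b'in: "b' \<in> fun_vs.span (insert b B)"
    unfolding b'_def using b0 fun_vs.span_mono[of B "insert b B"]
    by (intro fun_vs.span_diff) (auto simp: orth_proj_def fun_vs.span_base)
  define u' where "u' = u + fun_scale (inn f b' / inn b' b') b'"
  have bb: "inn b' b' = 0 \<Longrightarrow> inn g b' = 0" for g
    using cauchy_schwarz[of g b'] by (simp add: nm_def)
  have "u' \<in> fun_vs.span (insert b B)"
    unfolding u'_def using u b'in fun_vs.span_mono[of B "insert b B"]
    by (intro fun_vs.span_add fun_vs.span_scale) (auto simp: orth_proj_def)
  moreover have "inn (f - u') v = 0" if v: "v \<in> fun_vs.span (insert b B)" for v
  proof (rule ip_perp_span[OF _ v])
    have *: "inn (f - u') x = 0" if x: "x \<in> fun_vs.span B" for x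
      using u perp[OF x] x by (simp add: u'_def ip_simps orth_proj_def)
    have "inn u b' = 0" using perp[of u] u by (simp add: ip_commute orth_proj_def)
    then have "inn (f - u') b' = 0"
      using bb[of f] by (cases "inn b' b' = 0") (auto simp: u'_def ip_simps)
    moreover have "inn (f - u') b0 = 0" using * b0 by (simp add: orth_proj_def)
    ultimately have "inn (f - u') b = 0" by (simp add: b'_def ip_simps)
    then show "inn (f - u') x = 0" if "x \<in> insert b B" for x
      using * that fun_vs.span_base by blast
  qed
  ultimately show ?case by (auto simp: orth_proj_def)
qed

lemma ex_orth_proj:
  assumes "fun_vs.subspace U" "U \<subseteq> Fun"
  obtains u where "orth_proj S w U f u"
  using subspace_finite_basis[OF assms] ex_orth_proj_span by metis

lemma orth_proj_unique:
  assumes "fun_vs.subspace U" "U \<subseteq> Fun" "orth_proj S w U f u" "orth_proj S w U f v"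
  shows "u = v"
proof -
  have "u - v \<in> U" using assms fun_vs.subspace_diff by (auto simp: orth_proj_def)
  then have "inn (f - u) (u - v) = 0" "inn (f - v) (u - v) = 0" using assms by (auto simp: orth_proj_def)
  then have "inn (u - v) (u - v) = 0" by (simp add: ip_simps)
  then have "u - v = 0" using inn_eq_0D \<open>u - v \<in> U\<close> assms(2) by blast
  then show ?thesis by simp
qed

text \<open>A subspace is cut out by equations \<open>inn g f = 0\<close>, each of which is closed in the product
topology; this is how finite dimensional subspaces are seen to be closed below.\<close>

lemma perp_perp:
  assumes "fun_vs.subspace U" "U \<subseteq> Fun"
  shows "U = {f \<in> Fun. \<forall>g. (\<forall>u\<in>U. inn g u = 0) \<longrightarrow> inn g f = 0}" (is "U = ?R")
proof
  show "U \<subseteq> ?R" using assms by auto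
  show "?R \<subseteq> U"
  proof
    fix f assume f: "f \<in> ?R"
    obtain u where u: "orth_proj S w U f u" using ex_orth_proj[OF assms] .
    have "inn (f - u) f = 0" "inn (f - u) u = 0" using f u by (auto simp: orth_proj_def)
    then have "inn (f - u) (f - u) = 0" by (simp add: ip_simps)
    moreover have "f - u \<in> Fun"
      using f u assms(2) fun_vs.subspace_diff[OF subspace_supported] by (auto simp: orth_proj_def)
    ultimately have "f - u = 0" using inn_eq_0D by blast
    then show "f \<in> U" using u by (simp add: orth_proj_def)
  qed
qed

end

section \<open>Extremal eigenvectors of symmetric operators\<close>

text \<open>The operator is linear everywhere but is only required to be symmetric on \<open>U\<close>, so that
restriction to an invariant subspace changes \<open>U\<close> and nothing else.\<close>

definition symmetric_on ::
  "'b set \<Rightarrow> ('b \<Rightarrow> real) \<Rightarrow> ('b \<Rightarrow> real) set \<Rightarrow> (('b \<Rightarrow> real) \<Rightarrow> ('b \<Rightarrow> real)) \<Rightarrow> bool" where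
  "symmetric_on S w U A \<longleftrightarrow>
     module_hom fun_scale fun_scale A \<and> fun_vs.subspace U \<and> U \<subseteq> supported S \<and>
     (\<forall>f\<in>U. A f \<in> U) \<and> (\<forall>f\<in>U. \<forall>g\<in>U. ip S w (A f) g = ip S w f (A g))"

lemma symmetric_onD:
  assumes "symmetric_on S w U A"
  shows "A (f + g) = A f + A g" "A (f - g) = A f - A g" "A (fun_scale c f) = fun_scale c (A f)"
    "A 0 = 0" "fun_vs.subspace U" "f \<in> U \<Longrightarrow> f \<in> supported S" "f \<in> U \<Longrightarrow> A f \<in> U"
    "f \<in> U \<Longrightarrow> g \<in> U \<Longrightarrow> ip S w (A f) g = ip S w f (A g)"
  using assms module_hom.add[of fun_scale fun_scale A] module_hom.diff[of fun_scale fun_scale A]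
    module_hom.scale[of fun_scale fun_scale A] module_hom.zero[of fun_scale fun_scale A]
  by (auto simp: symmetric_on_def)

lemma symmetric_on_subspace:
  assumes "symmetric_on S w U A" "fun_vs.subspace U'" "U' \<subseteq> U" "\<And>f. f \<in> U' \<Longrightarrow> A f \<in> U'"
  shows "symmetric_on S w U' A"
  using assms unfolding symmetric_on_def by blast

text \<open>First-order condition at a minimum: take \<open>t = - b / d\<close> with \<open>d\<close> larger than \<open>c\<close>.\<close>

lemma linear_term_zero:
  fixes b c :: real
  assumes "\<And>t. 2 * t * b + t\<^sup>2 * c \<ge> 0"
  shows "b = 0"
proof (rule ccontr)
  assume "b \<noteq> 0"
  (* The summand 1 keeps d positive when c = 0. *)
  define d where "d = \<bar>c\<bar> + 1"
  have "d > 0" "c < d" by (auto simp: d_def)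
  have "2 * (- b / d) * b + (- b / d)\<^sup>2 * c = (b\<^sup>2 / d) * (c / d - 2)"
    using \<open>d > 0\<close> by (simp add: field_simps power2_eq_square)
  moreover have "(b\<^sup>2 / d) * (c / d - 2) < 0"
  proof (rule mult_pos_neg)
    show "b\<^sup>2 / d > 0" using \<open>b \<noteq> 0\<close> \<open>d > 0\<close> by simp
    have "c / d < 1" using \<open>d > 0\<close> \<open>c < d\<close> by simp
    then show "c / d - 2 < 0" by simp
  qed
  ultimately have "2 * (- b / d) * b + (- b / d)\<^sup>2 * c < 0" by simp
  then show False using assms[of "- b / d"] by linarith
qed

context wspace
begin

lemma continuous_inn: "continuous_on UNIV (\<lambda>f. inn g f)"
  unfolding ip_def
  by (intro continuous_intros continuous_on_product_coordinates)

lemma continuous_inn_self: "continuous_on UNIV (\<lambda>f. inn f f)"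
  unfolding ip_def
  by (intro continuous_intros continuous_on_product_coordinates)

text \<open>On the unit sphere the value at \<open>x\<close> is at most \<open>1 / sqrt (w x)\<close>, so the sphere is a closed part of a
product of compact intervals.\<close>

lemma compact_unit_sphere:
  assumes "fun_vs.subspace U" "U \<subseteq> Fun"
  shows "compact {f \<in> U. inn f f = 1}"
proof -
  define box where "box = PiE UNIV (\<lambda>x. if x \<in> S then {- 1 / sqrt (w x)..1 / sqrt (w x)} else {0::real})"
  have "compactin (product_topology (\<lambda>_. euclidean) UNIV) box"
    unfolding box_def by (subst compactin_PiE) auto
  then have cbox: "compact box" by (simp add: euclidean_product_topology)
  define C where "C = {f. inn f f = 1} \<inter> {f. \<forall>g. (\<forall>u\<in>U. inn g u = 0) \<longrightarrow> inn g f = 0}"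
  have "closed {f. (\<forall>u\<in>U. inn g u = 0) \<longrightarrow> inn g f = 0}" for g
  proof (cases "\<forall>u\<in>U. inn g u = 0")
    case True
    then show ?thesis by (auto intro!: closed_Collect_eq continuous_inn continuous_intros)
  next
    case False
    then have "{f. (\<forall>u\<in>U. inn g u = 0) \<longrightarrow> inn g f = 0} = UNIV" by auto
    then show ?thesis by (simp only: closed_UNIV)
  qed
  then have "closed C"
    unfolding C_def
    by (intro closed_Int closed_Collect_eq closed_Collect_all continuous_inn_self continuous_intros) auto
  then have "compact (box \<inter> C)" using cbox by (rule compact_Int_closed[rotated])
  moreover have "{f \<in> U. inn f f = 1} = box \<inter> C"
  proof
    show "box \<inter> C \<subseteq> {f \<in> U. inn f f = 1}"
    proof
      fix f assume f: "f \<in> box \<inter> C"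
      have "f \<in> Fun"
        unfolding supported_def
      proof (intro CollectI allI impI)
        fix x assume "x \<notin> S"
        have "f x \<in> (if x \<in> S then {- 1 / sqrt (w x)..1 / sqrt (w x)} else {0::real})"
          using f unfolding box_def PiE_def Pi_def by blast
        then show "f x = 0" using \<open>x \<notin> S\<close> by simp
      qed
      then show "f \<in> {f \<in> U. inn f f = 1}"
        using f perp_perp[OF assms] by (auto simp: C_def)
    qed
    show "{f \<in> U. inn f f = 1} \<subseteq> box \<inter> C"
    proof
      fix f assume f: "f \<in> {f \<in> U. inn f f = 1}"
      have "f x \<in> (if x \<in> S then {- 1 / sqrt (w x)..1 / sqrt (w x)} else {0::real})" for x
      proof (cases "x \<in> S")
        case True
        have "w x * f x * f x \<le> (\<Sum>x\<in>S. w x * f x * f x)"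
          using w_pos True by (intro member_le_sum) (auto simp: finite_S mult.assoc less_imp_le)
        then have "w x * (f x)\<^sup>2 \<le> 1" using f by (simp add: ip_def power2_eq_square mult.assoc)
        then have "(f x)\<^sup>2 \<le> 1 / w x" using w_pos[OF True] by (simp add: field_simps)
        then have "\<bar>f x\<bar> \<le> sqrt (1 / w x)" using real_le_rsqrt[of "\<bar>f x\<bar>" "1 / w x"] by simp
        then show ?thesis using True by (auto simp: real_sqrt_divide abs_le_iff)
      next
        case False
        then show ?thesis using f assms by (auto simp: supported_def)
      qed
      then have "f \<in> box" by (simp add: box_def PiE_def Pi_def)
      moreover have "f \<in> C" using f by (auto simp: C_def)
      ultimately show "f \<in> box \<inter> C" by blast
    qed
  qed
  ultimately show ?thesis by simp
qed

text \<open>The matrix form of a linear map; it makes the quadratic form visibly continuous.\<close>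

lemma linear_expansion:
  assumes "module_hom fun_scale fun_scale A" "f \<in> Fun"
  shows "A f x = (\<Sum>y\<in>S. f y * A (\<lambda>x. if x = y then 1 else 0) x)"
proof -
  define e where "e y = (\<lambda>x::'b. if x = y then 1 else (0::real))" for y
  have 1: "(\<Sum>y\<in>J. g y) x = (\<Sum>y\<in>J. g y x)" for g :: "'b \<Rightarrow> 'c \<Rightarrow> real" and J x
  proof (induction J rule: infinite_finite_induct)
    case (insert y F)
    show ?case by (simp only: sum.insert[OF insert(1,2)] plus_fun_apply insert.IH)
  qed auto
  have "f = (\<Sum>y\<in>S. fun_scale (f y) (e y))"
  proof
    fix x
    have "(\<Sum>y\<in>S. fun_scale (f y) (e y)) x = (\<Sum>y\<in>S. if x = y then f y else 0)"
      unfolding 1 by (intro sum.cong) (auto simp: fun_scale_def e_def)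
    then show "f x = (\<Sum>y\<in>S. fun_scale (f y) (e y)) x"
      using assms(2) finite_S by (auto simp: supported_def)
  qed
  then have "A f = A (\<Sum>y\<in>S. fun_scale (f y) (e y))" by simp
  also have "\<dots> = (\<Sum>y\<in>S. A (fun_scale (f y) (e y)))"
    by (rule module_hom.sum[OF assms(1)])
  also have "\<dots> = (\<Sum>y\<in>S. fun_scale (f y) (A (e y)))"
    by (simp add: module_hom.scale[OF assms(1)])
  finally show ?thesis by (simp add: 1 fun_scale_def e_def)
qed

text \<open>The Rayleigh quotient attains its maximum on the unit sphere, and at a maximum the derivative in
the direction \<open>A f - \<mu> f\<close> vanishes, which is the square of the norm of that direction.\<close>

lemma max_eigenvector:
  assumes A: "symmetric_on S w U A" and "U \<noteq> {0}"
  obtains f \<mu> where "f \<in> U" "f \<noteq> 0" "A f = fun_scale \<mu> f" "\<And>g. g \<in> U \<Longrightarrow> inn (A g) g \<le> \<mu> * inn g g"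
proof -
  note D = symmetric_onD[OF A]
  have sub: "fun_vs.subspace U" and UF: "U \<subseteq> Fun" using D by auto
  define K where "K = {f \<in> U. inn f f = 1}"
  have normalize: "fun_scale (1 / nrm f) f \<in> K" if "f \<in> U" "f \<noteq> 0" for f
  proof -
    have "inn f f > 0" using inn_pos that UF by blast
    then show ?thesis
      using that fun_vs.subspace_scale[OF sub] by (simp add: K_def ip_simps nm_def)
  qed
  have "0 \<in> U" using sub by (rule fun_vs.subspace_0)
  then obtain f0 where "f0 \<in> U" "f0 \<noteq> 0" using assms(2) by blast
  then have ne: "K \<noteq> {}" using normalize by blast
  define e where "e y = (\<lambda>x::'b. if x = y then 1 else (0::real))" for y
  have "continuous_on K (\<lambda>f. \<Sum>x\<in>S. w x * (\<Sum>y\<in>S. f y * A (e y) x) * f x)"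
    by (rule continuous_on_subset[of UNIV])
      (intro continuous_intros continuous_on_product_coordinates, simp)
  moreover have "(\<Sum>x\<in>S. w x * (\<Sum>y\<in>S. f y * A (e y) x) * f x) = inn (A f) f" if "f \<in> K" for f
  proof -
    have "f \<in> Fun" using that UF by (auto simp: K_def)
    then show ?thesis
      using linear_expansion[of A f] A by (simp add: ip_def e_def symmetric_on_def)
  qed
  ultimately have "continuous_on K (\<lambda>f. inn (A f) f)" by (simp cong: continuous_on_cong)
  moreover have "compact K" unfolding K_def by (rule compact_unit_sphere[OF sub UF])
  ultimately obtain f where f: "f \<in> K" and fmax: "\<And>g. g \<in> K \<Longrightarrow> inn (A g) g \<le> inn (A f) f"
    using continuous_attains_sup[of K "\<lambda>f. inn (A f) f"] ne by blast
  define \<mu> where "\<mu> = inn (A f) f"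
  have fU: "f \<in> U" and f1: "inn f f = 1" using f by (auto simp: K_def)
  have bound: "inn (A g) g \<le> \<mu> * inn g g" if g: "g \<in> U" for g
  proof (cases "g = 0")
    case True
    then show ?thesis by (simp add: ip_simps)
  next
    case False
    have p: "inn g g > 0" using inn_pos g UF False by blast
    have "1 / nrm g * (1 / nrm g * inn (A g) g) \<le> \<mu>"
      using fmax[OF normalize[OF g False]] by (simp add: D(3) ip_simps \<mu>_def)
    moreover have "1 / nrm g * (1 / nrm g * inn (A g) g) = inn (A g) g / inn g g"
      by (simp add: power2_eq_square flip: nrm_sq)
    ultimately have "inn (A g) g / inn g g \<le> \<mu>" by linarith
    then show ?thesis by (simp only: pos_divide_le_eq[OF p])
  qed
  (* The residual of the eigenvalue equation serves as the test direction. *)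
  define h where "h = A f - fun_scale \<mu> f"
  have h: "h \<in> U" unfolding h_def
    using fU D(7) fun_vs.subspace_diff[OF sub] fun_vs.subspace_scale[OF sub] by blast
  have "2 * t * (\<mu> * inn f h - inn (A f) h) + t\<^sup>2 * (\<mu> * inn h h - inn (A h) h) \<ge> 0" for t
  proof -
    have "f + fun_scale t h \<in> U"
      using fU h fun_vs.subspace_add[OF sub] fun_vs.subspace_scale[OF sub] by blast
    from bound[OF this]
    have "inn (A f) f + t * inn (A h) f + t * (inn (A f) h + t * inn (A h) h)
        \<le> \<mu> * (inn f f + t * inn h f + t * (inn f h + t * inn h h))"
      by (simp add: ip_simps D(1,3) algebra_simps)
    moreover have "inn (A h) f = inn (A f) h" using D(8)[OF h fU] by (simp add: ip_commute)
    moreover have "inn h f = inn f h" by (rule ip_commute)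
    ultimately show ?thesis using f1 by (simp add: \<mu>_def algebra_simps power2_eq_square)
  qed
  from linear_term_zero[OF this] have "\<mu> * inn f h - inn (A f) h = 0" .
  then have "inn h h = 0"
    unfolding h_def by (simp add: ip_simps algebra_simps)
  then have "h = 0" using h UF inn_eq_0D by blast
  then have "A f = fun_scale \<mu> f" by (simp add: h_def)
  moreover have "f \<noteq> 0" using f1 by (auto simp: ip_simps)
  ultimately show ?thesis using that fU bound by blast
qed

lemma symmetric_on_uminus:
  assumes "symmetric_on S w U A"
  shows "symmetric_on S w U (\<lambda>f. - A f)"
proof -
  note D = symmetric_onD[OF assms]
  have "module_hom fun_scale fun_scale (\<lambda>f. - A f)"
    by unfold_locales (simp_all add: D(1,3))
  then show ?thesis
    using D fun_vs.subspace_neg[OF D(5)] unfolding symmetric_on_def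
    by (auto simp: ip_simps)
qed

lemma min_eigenvector:
  assumes A: "symmetric_on S w U A" and "U \<noteq> {0}"
  obtains f \<mu> where "f \<in> U" "f \<noteq> 0" "A f = fun_scale \<mu> f" "\<And>g. g \<in> U \<Longrightarrow> inn (A g) g \<ge> \<mu> * inn g g"
proof -
  obtain f \<mu> where f: "f \<in> U" "f \<noteq> 0" "- A f = fun_scale \<mu> f"
    and b: "\<And>g. g \<in> U \<Longrightarrow> inn (- A g) g \<le> \<mu> * inn g g"
    using max_eigenvector[OF symmetric_on_uminus[OF A] assms(2)] by metis
  have "A f = fun_scale (- \<mu>) f" using f(3) by (metis fun_vs.scale_minus_left minus_equation_iff)
  moreover have "inn (A g) g \<ge> - \<mu> * inn g g" if "g \<in> U" for g
    using b[OF that] by (simp add: ip_simps)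
  ultimately show ?thesis using that f by blast
qed

text \<open>Polarization applied to \<open>f\<close> and the multiple of \<open>A f\<close> that has the same norm as \<open>f\<close>.\<close>

lemma nrm_le_of_quadratic_form:
  assumes A: "symmetric_on S w U A" and q: "\<And>f. f \<in> U \<Longrightarrow> \<bar>inn (A f) f\<bar> \<le> c * inn f f"
    and f: "f \<in> U"
  shows "nrm (A f) \<le> c * nrm f"
proof (cases "nrm (A f) = 0 \<or> nrm f = 0")
  case True
  have "f = 0 \<Longrightarrow> nrm (A f) = 0" by (simp add: symmetric_onD(4)[OF A] nm_def ip_simps)
  moreover have "nrm f = 0 \<Longrightarrow> f = 0" using nrm_eq_0D symmetric_onD(6)[OF A f] by blast
  moreover have "c * nrm f \<ge> 0" if "nrm f \<noteq> 0"
  proof -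
    have "inn f f > 0" using that inn_ge_0[of f] by (auto simp: nm_def less_le)
    moreover have "c * inn f f \<ge> 0" using q[OF f] by linarith
    ultimately show ?thesis using nrm_ge_0 by (simp add: zero_le_mult_iff)
  qed
  ultimately show ?thesis using True by (metis mult_zero_right order_refl)
next
  case False
  note D = symmetric_onD[OF A]
  define a b where "a = nrm f" and "b = nrm (A f)"
  have ab: "a > 0" "b > 0" using False nrm_ge_0[of f] nrm_ge_0[of "A f"] by (auto simp: a_def b_def)
  (* With this scaling y has the norm of f, so both sides of the polarization have the same size. *)
  define y where "y = fun_scale (a / b) (A f)"
  have y: "y \<in> U" unfolding y_def using f D(7) fun_vs.subspace_scale[OF D(5)] by blast
  have "f + y \<in> U" "f - y \<in> U"
    using f y fun_vs.subspace_add[OF D(5)] fun_vs.subspace_diff[OF D(5)] by blast+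
  from this[THEN q]
  have e1: "inn (A (f + y)) (f + y) - inn (A (f - y)) (f - y) \<le> c * (inn (f + y) (f + y) + inn (f - y) (f - y))"
    by (simp add: distrib_left abs_le_iff)
  have e2: "inn (A (f + y)) (f + y) - inn (A (f - y)) (f - y) = 4 * inn (A f) y"
    using D(8)[OF y f] by (simp add: D(1,2) ip_simps ip_commute[of S w y])
  have e3: "inn (f + y) (f + y) + inn (f - y) (f - y) = 2 * (inn f f + inn y y)"
    by (simp add: ip_simps)
  have e4: "inn y y = a\<^sup>2"
    using ab by (simp add: y_def ip_simps flip: nrm_sq[of "A f"] b_def) (simp add: power2_eq_square)
  have e5: "inn f f = a\<^sup>2" by (simp add: a_def nrm_sq)
  have e6: "inn (A f) y = a * b"
    using ab by (simp add: y_def ip_simps flip: nrm_sq[of "A f"] b_def) (simp add: power2_eq_square)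
  have "4 * (a * b) \<le> c * (2 * (a\<^sup>2 + a\<^sup>2))" using e1 unfolding e2 e3 e4 e5 e6 .
  then have "a * b \<le> a * (c * a)" by (simp add: power2_eq_square algebra_simps)
  then have "b \<le> c * a" using ab by simp
  then show ?thesis by (simp add: a_def b_def)
qed

end

section \<open>Eigenvalues with multiplicity and the spectral gap\<close>

lemma sorted_desc_second:
  fixes xs :: "real list"
  assumes "sorted_wrt (\<ge>) xs" "a \<in> set xs" "b \<in> set xs" "b < a"
  shows "b \<le> xs ! 1"
proof -
  obtain i where i: "i < length xs" "xs ! i = a" using assms(2) by (meson in_set_conv_nth)
  obtain j where j: "j < length xs" "xs ! j = b" using assms(3) by (meson in_set_conv_nth)
  have "i < j"
  proof (rule ccontr)
    assume "\<not> i < j"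
    then have "j < i \<or> i = j" by linarith
    then show False using sorted_wrt_nth_less[OF assms(1), of j i] i j assms(4) by auto
  qed
  then have "j = 1 \<or> 1 < j" by linarith
  then show ?thesis using sorted_wrt_nth_less[OF assms(1), of 1 j] j by auto
qed

lemma sorted_desc_second_repeated:
  fixes xs :: "real list"
  assumes "sorted_wrt (\<ge>) xs" "count_list xs a \<ge> 2"
  shows "a \<le> xs ! 1"
proof -
  obtain x ys where x: "xs = x # ys" using assms(2) by (cases xs) auto
  have "count_list ys a \<ge> 1" using assms(2) x by (auto split: if_splits)
  then have "a \<in> set ys" by (metis count_notin not_one_le_zero)
  then obtain y zs where y: "ys = y # zs" by (cases ys) auto
  then show ?thesis using \<open>a \<in> set ys\<close> x assms(1) by auto
qed

lemma sorted_desc_last: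
  fixes xs :: "real list"
  assumes "sorted_wrt (\<ge>) xs" "a \<in> set xs"
  shows "last xs \<le> a"
  using assms by (induction xs) auto

context wspace
begin

lemma orthogonal_independent:
  assumes "B \<subseteq> Fun" "0 \<notin> B" "\<And>a b. a \<in> B \<Longrightarrow> b \<in> B \<Longrightarrow> a \<noteq> b \<Longrightarrow> inn a b = 0"
  shows "fun_vs.independent B"
proof
  assume "fun_vs.dependent B"
  then obtain a where a: "a \<in> B" "a \<in> fun_vs.span (B - {a})"
    unfolding fun_vs.dependent_def by blast
  have "inn a a = 0" by (rule ip_perp_span[OF _ a(2)]) (use assms(3) a(1) in auto)
  then show False using a(1) assms(1,2) inn_eq_0D by blast
qed

lemma card_le_dim:
  assumes "fun_vs.independent B" "B \<subseteq> U" "U \<subseteq> Fun"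
  shows "card B \<le> fun_vs.dim U"
proof -
  obtain C where C: "B \<subseteq> C" "C \<subseteq> U" "fun_vs.independent C" "U \<subseteq> fun_vs.span C"
    using fun_vs.maximal_independent_subset_extend[OF assms(2,1)] .
  have "finite C" using independent_finite[OF C(3)] C(2) assms(3) by blast
  then have "card B \<le> card C" using C(1) by (intro card_mono)
  also have "card C = fun_vs.dim U" using C fun_vs.basis_card_eq_dim by blast
  finally show ?thesis .
qed

abbreviation eigenspace :: "(('b \<Rightarrow> real) \<Rightarrow> ('b \<Rightarrow> real)) \<Rightarrow> real \<Rightarrow> ('b \<Rightarrow> real) set" where
  "eigenspace A \<mu> \<equiv> {f \<in> Fun. A f = fun_scale \<mu> f}"

text \<open>Eigenvectors for distinct eigenvalues are orthogonal, hence independent, and an independent set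
is finite.\<close>

lemma finite_eigenvalues:
  assumes A: "symmetric_on S w Fun A"
  shows "finite {\<mu>. \<exists>f\<in>eigenspace A \<mu>. f \<noteq> 0}" (is "finite ?L")
proof -
  define v where "v \<mu> = (SOME f. f \<in> eigenspace A \<mu> \<and> f \<noteq> 0)" for \<mu>
  have v: "v \<mu> \<in> eigenspace A \<mu> \<and> v \<mu> \<noteq> 0" if L: "\<mu> \<in> ?L" for \<mu>
  proof -
    obtain f where "f \<in> eigenspace A \<mu> \<and> f \<noteq> 0" using L by auto
    then show ?thesis unfolding v_def by (rule someI[of "\<lambda>f. f \<in> eigenspace A \<mu> \<and> f \<noteq> 0"])
  qed
  have orth: "inn (v \<mu>) (v \<nu>) = 0" if "\<mu> \<in> ?L" "\<nu> \<in> ?L" "\<mu> \<noteq> \<nu>" for \<mu> \<nu>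
  proof -
    have "inn (A (v \<mu>)) (v \<nu>) = inn (v \<mu>) (A (v \<nu>))"
      by (rule symmetric_onD(8)[OF A]) (use v[OF that(1)] v[OF that(2)] in simp_all)
    then have "\<mu> * inn (v \<mu>) (v \<nu>) = \<nu> * inn (v \<mu>) (v \<nu>)"
      by (simp add: ip_simps v[OF that(1), THEN conjunct1, simplified] v[OF that(2), THEN conjunct1, simplified])
    then show ?thesis using that(3) by simp
  qed
  have vF: "v ` ?L \<subseteq> Fun"
  proof
    fix f assume "f \<in> v ` ?L"
    then obtain \<mu> where "\<mu> \<in> ?L" "f = v \<mu>" by (rule imageE)
    then show "f \<in> Fun" using v[of \<mu>] by simp
  qed
  have "fun_vs.independent (v ` ?L)"
  proof (rule orthogonal_independent[OF vF])
    show "0 \<notin> v ` ?L"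
    proof
      assume "0 \<in> v ` ?L"
      then obtain \<mu> where "\<mu> \<in> ?L" "0 = v \<mu>" by (rule imageE)
      then show False using v[of \<mu>] by simp
    qed
    show "inn a b = 0" if ab: "a \<in> v ` ?L" "b \<in> v ` ?L" "a \<noteq> b" for a b
    proof -
      obtain \<mu> where 1: "a = v \<mu>" "\<mu> \<in> ?L" using ab(1) by (rule imageE)
      obtain \<nu> where 2: "b = v \<nu>" "\<nu> \<in> ?L" using ab(2) by (rule imageE)
      show ?thesis using orth[OF 1(2) 2(2)] ab(3) 1(1) 2(1) by auto
    qed
  qed
  then have "finite (v ` ?L)" using independent_finite vF by blast
  moreover have "inj_on v ?L"
  proof (rule inj_onI)
    fix \<mu> \<nu> assume *: "\<mu> \<in> ?L" "\<nu> \<in> ?L" "v \<mu> = v \<nu>"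
    show "\<mu> = \<nu>"
    proof (rule ccontr)
      assume "\<mu> \<noteq> \<nu>"
      then have "inn (v \<mu>) (v \<mu>) = 0" using orth[OF *(1,2)] *(3) by simp
      then show False using v[OF *(1)] inn_eq_0D[of "v \<mu>"] by simp
    qed
  qed
  ultimately show ?thesis by (rule finite_imageD)
qed

text \<open>Only finitely many eigenspaces are nonzero, so the multiplicities form a multiset, and a multiset
has exactly one decreasing enumeration. This makes the definite description behind
\<open>walk_spectrum\<close> meaningful.\<close>

lemma ex1_spectrum_list:
  assumes A: "symmetric_on S w Fun A"
  shows "\<exists>!xs. sorted_wrt (\<ge>) xs \<and> (\<forall>\<mu>. count_list xs \<mu> = fun_vs.dim (eigenspace A \<mu>))"
proof -
  define L where "L = {\<mu>. \<exists>f\<in>eigenspace A \<mu>. f \<noteq> 0}"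
  define M where "M = (\<Sum>\<mu>\<in>L. replicate_mset (fun_vs.dim (eigenspace A \<mu>)) \<mu>)"
  have finL: "finite L" unfolding L_def by (rule finite_eigenvalues[OF A])
  have M: "count M \<mu> = fun_vs.dim (eigenspace A \<mu>)" for \<mu>
  proof -
    have "count M \<mu> = (\<Sum>\<nu>\<in>L. if \<nu> = \<mu> then fun_vs.dim (eigenspace A \<nu>) else 0)"
      unfolding M_def by (auto simp: count_sum intro!: sum.cong)
    also have "\<dots> = (if \<mu> \<in> L then fun_vs.dim (eigenspace A \<mu>) else 0)"
      using finL by simp
    also have "\<dots> = fun_vs.dim (eigenspace A \<mu>)"
    proof (cases "\<mu> \<in> L")
      case False
      then have "eigenspace A \<mu> \<subseteq> {0}" unfolding L_def by blast
      then have "fun_vs.dim (eigenspace A \<mu>) = 0"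
        using fun_vs.basis_card_eq_dim[of "{}" "eigenspace A \<mu>"] fun_vs.independent_empty by auto
      then show ?thesis by simp
    qed simp
    finally show ?thesis .
  qed
  define xs where "xs = rev (sorted_list_of_multiset M)"
  have "sorted_wrt (\<ge>) xs" by (simp add: xs_def sorted_wrt_rev)
  moreover have cnt: "count (mset ys) = count_list ys" for ys :: "real list"
    by (rule ext) (simp add: count_mset)
  moreover have "mset xs = M" by (simp add: xs_def)
  ultimately have xs: "sorted_wrt (\<ge>) xs \<and> (\<forall>\<mu>. count_list xs \<mu> = fun_vs.dim (eigenspace A \<mu>))"
    using M by metis
  show ?thesis
  proof (rule ex1I[of _ xs], rule xs)
    fix ys assume ys: "sorted_wrt (\<ge>) ys \<and> (\<forall>\<mu>. count_list ys \<mu> = fun_vs.dim (eigenspace A \<mu>))"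
    then have "mset (rev ys) = mset (rev xs)"
      using xs cnt by (simp add: multiset_eq_iff)
    moreover have "sorted (rev ys)" "sorted (rev xs)" using xs ys by (auto simp: sorted_wrt_rev)
    ultimately have "rev ys = rev xs" by (metis properties_for_sort)
    then show "ys = xs" by simp
  qed
qed

text \<open>On the complement of the invariant vector \<open>one\<close> the form is extremal at eigenvectors. The
eigenvalue at the minimum is listed, so it is at least the last entry. The one at the maximum, at most 1, is
listed after a 1: if it equals 1, then the multiplicity of 1 is at least two.\<close>

lemma spectral_gap_bounds:
  assumes A: "symmetric_on S w Fun A" and one: "one \<in> Fun" "A one = one" "one \<noteq> 0"
    and contr: "\<And>f. f \<in> Fun \<Longrightarrow> inn (A f) f \<le> inn f f"
    and xs: "sorted_wrt (\<ge>) xs" "\<And>\<mu>. count_list xs \<mu> = fun_vs.dim (eigenspace A \<mu>)"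
    and f: "f \<in> Fun" "inn f one = 0"
  shows "inn (A f) f \<le> xs ! 1 * inn f f" "last xs * inn f f \<le> inn (A f) f"
proof -
  define U where "U = {f \<in> Fun. inn f one = 0}"
  note D = symmetric_onD[OF A]
  have "fun_vs.subspace U"
    using subspace_supported unfolding U_def fun_vs.subspace_def by (auto simp: ip_simps)
  moreover have "A g \<in> U" if "g \<in> U" for g
    using that D(7)[of g] D(8)[of g one] one by (auto simp: U_def)
  ultimately have AU: "symmetric_on S w U A"
    by (intro symmetric_on_subspace[OF A]) (auto simp: U_def)
  have in_xs: "\<mu> \<in> set xs" if "g \<in> eigenspace A \<mu>" "g \<noteq> 0" for g \<mu>
  proof -
    have "fun_vs.independent {g}" using that(2) by simp
    then have "1 \<le> fun_vs.dim (eigenspace A \<mu>)"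
      using card_le_dim[of "{g}" "eigenspace A \<mu>"] that(1) by auto
    then show ?thesis using xs(2)[of \<mu>] by (metis count_notin not_one_le_zero)
  qed
  have one1: "one \<in> eigenspace A 1" using one by simp
  have "inn (A f) f \<le> xs ! 1 * inn f f \<and> last xs * inn f f \<le> inn (A f) f"
  proof (cases "U = {0}")
    case True
    then have "f = 0" using f by (auto simp: U_def)
    then show ?thesis by (simp add: ip_simps)
  next
    case False
    obtain g \<mu> where g: "g \<in> U" "g \<noteq> 0" "A g = fun_scale \<mu> g" "\<And>h. h \<in> U \<Longrightarrow> inn (A h) h \<le> \<mu> * inn h h"
      using max_eigenvector[OF AU False] by metis
    have gF: "g \<in> Fun" and g1: "inn g one = 0" using g(1) by (auto simp: U_def)
    have pos: "inn g g > 0" using inn_pos gF g(2) by blast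
    have "\<mu> * inn g g \<le> 1 * inn g g" using contr[OF gF] g(3) by (simp add: ip_simps)
    then have "\<mu> \<le> 1" using pos by (metis mult_le_cancel_right_pos)
    have "\<mu> \<le> xs ! 1"
    proof (cases "\<mu> = 1")
      case True
      have "g \<noteq> one" using g1 pos by auto
      then have "fun_vs.independent {g, one}"
        by (intro orthogonal_independent) (use gF g1 g(2) one in \<open>auto simp: ip_commute\<close>)
      then have "card {g, one} \<le> fun_vs.dim (eigenspace A 1)"
        by (rule card_le_dim) (use g(3) gF one1 True in auto)
      then have "count_list xs 1 \<ge> 2" using xs(2)[of 1] \<open>g \<noteq> one\<close> by simp
      then show ?thesis using sorted_desc_second_repeated[OF xs(1)] True by simp
    next
      case False
      then show ?thesis
        using sorted_desc_second[OF xs(1) in_xs[OF one1 one(3)] in_xs[of g \<mu>]] g gF \<open>\<mu> \<le> 1\<close> by auto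
    qed
    obtain h \<nu> where h: "h \<in> U" "h \<noteq> 0" "A h = fun_scale \<nu> h" "\<And>g. g \<in> U \<Longrightarrow> inn (A g) g \<ge> \<nu> * inn g g"
      using min_eigenvector[OF AU False] by metis
    have "last xs \<le> \<nu>"
      by (rule sorted_desc_last[OF xs(1) in_xs[of h]]) (use h in \<open>auto simp: U_def\<close>)
    have fU: "f \<in> U" using f by (simp add: U_def)
    have "\<mu> * inn f f \<le> xs ! 1 * inn f f" "last xs * inn f f \<le> \<nu> * inn f f"
      using \<open>\<mu> \<le> xs ! 1\<close> \<open>last xs \<le> \<nu>\<close> inn_ge_0 by (auto intro: mult_right_mono)
    then show ?thesis using g(4)[OF fU] h(4)[OF fU] by linarith
  qed
  then show "inn (A f) f \<le> xs ! 1 * inn f f" "last xs * inn f f \<le> inn (A f) f" by auto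
qed

end

section \<open>Operators that nearly act by scalars on orthogonal pieces\<close>

text \<open>\<open>T\<close> is the orthogonal sum of the pieces \<open>U 0, ..., U k\<close>, and on \<open>U i\<close> the operator is within \<open>\<epsilon>\<close> of the
scalar \<open>k + 1 - i\<close>. For a complex these are $C_0^k(X)$, the $U_k^i$ and $d_k^* d_k$.\<close>

locale approx_spectral = wspace S w for S :: "'b set" and w +
  fixes T :: "('b \<Rightarrow> real) set" and A :: "('b \<Rightarrow> real) \<Rightarrow> ('b \<Rightarrow> real)"
    and U :: "nat \<Rightarrow> ('b \<Rightarrow> real) set" and k :: nat and \<epsilon> :: real
  assumes sym: "symmetric_on S w T A"
    and U_subspace: "\<And>i. i \<le> k \<Longrightarrow> fun_vs.subspace (U i)"
    and U_subset: "\<And>i. i \<le> k \<Longrightarrow> U i \<subseteq> T"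
    and U_orth: "\<And>i j x y. i \<le> k \<Longrightarrow> j \<le> k \<Longrightarrow> i \<noteq> j \<Longrightarrow> x \<in> U i \<Longrightarrow> y \<in> U j \<Longrightarrow> ip S w x y = 0"
    and U_sum: "\<And>x. x \<in> T \<Longrightarrow> \<exists>u. (\<forall>i\<le>k. u i \<in> U i) \<and> x = (\<Sum>i\<le>k. u i)"
    and eps_ge_0: "\<epsilon> \<ge> 0"
    and approx: "\<And>i x. i \<le> k \<Longrightarrow> x \<in> U i \<Longrightarrow>
      nm S w (A x - fun_scale (real k + 1 - real i) x) \<le> \<epsilon> * nm S w x"
begin

definition c :: "nat \<Rightarrow> real" where "c i = real k + 1 - real i"
text \<open>The distance between \<open>A\<close> and the diagonal operator with the scalars \<open>c i\<close>: the errors of the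
\<open>k + 1\<close> orthogonal pieces add up with the factor \<open>sqrt (k + 1)\<close>.\<close>

definition \<delta> :: real where "\<delta> = sqrt (real k + 1) * \<epsilon>"

lemma T: "fun_vs.subspace T" "x \<in> T \<Longrightarrow> x \<in> Fun" "x \<in> T \<Longrightarrow> A x \<in> T" "T \<subseteq> Fun"
  using symmetric_onD[OF sym] by auto

lemma delta_ge_0: "\<delta> \<ge> 0"
  by (simp add: \<delta>_def eps_ge_0)

lemma c_dist: "i \<noteq> j \<Longrightarrow> \<bar>c i - c j\<bar> \<ge> 1"
  by (auto simp: c_def)

lemma inn_components:
  assumes "\<forall>i\<le>k. u i \<in> U i"
  shows "inn (\<Sum>i\<le>k. fun_scale (a i) (u i)) (\<Sum>i\<le>k. fun_scale (b i) (u i))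
    = (\<Sum>i\<le>k. a i * b i * (nrm (u i))\<^sup>2)"
proof -
  have "inn (fun_scale (a i) (u i)) (\<Sum>i\<le>k. fun_scale (b i) (u i)) = a i * b i * (nrm (u i))\<^sup>2"
    if i: "i \<le> k" for i
  proof -
    have "inn (fun_scale (a i) (u i)) (\<Sum>i\<le>k. fun_scale (b i) (u i))
        = (\<Sum>j\<le>k. if j = i then a i * b i * (nrm (u i))\<^sup>2 else 0)"
      unfolding ip_sum_right
      using U_orth[OF i] assms i by (intro sum.cong) (auto simp: ip_simps nrm_sq)
    also have "\<dots> = a i * b i * (nrm (u i))\<^sup>2" using i by simp
    finally show ?thesis .
  qed
  then show ?thesis by (simp add: ip_sum_left)
qed

lemma nrm_components:
  assumes "\<forall>i\<le>k. u i \<in> U i"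
  shows "(nrm (\<Sum>i\<le>k. fun_scale (a i) (u i)))\<^sup>2 = (\<Sum>i\<le>k. (a i)\<^sup>2 * (nrm (u i))\<^sup>2)"
  unfolding nrm_sq[of "sum _ _"] using inn_components[OF assms, of a a] by (simp add: power2_eq_square)

lemma nrm_component_sum:
  assumes "\<forall>i\<le>k. u i \<in> U i"
  shows "(nrm (\<Sum>i\<le>k. u i))\<^sup>2 = (\<Sum>i\<le>k. (nrm (u i))\<^sup>2)"
  using nrm_components[OF assms, of "\<lambda>_. 1"] by simp

lemma sum_le_sqrt_card:
  fixes f :: "nat \<Rightarrow> real"
  assumes "finite J"
  shows "(\<Sum>i\<in>J. f i) \<le> sqrt (real (card J)) * sqrt (\<Sum>i\<in>J. (f i)\<^sup>2)"
proof -
  have "(\<Sum>i\<in>J. f i) \<le> (\<Sum>i\<in>J. \<bar>1\<bar> * \<bar>f i\<bar>)" by (intro sum_mono) simp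
  also have "\<dots> \<le> L2_set (\<lambda>_. 1) J * L2_set f J" by (rule L2_set_mult_ineq)
  finally show ?thesis by (simp add: L2_set_def)
qed

lemma approx_sum:
  assumes u: "\<forall>i\<le>k. u i \<in> U i" and x: "x = (\<Sum>i\<le>k. u i)"
  shows "nrm (A x - (\<Sum>i\<le>k. fun_scale (c i) (u i))) \<le> \<delta> * nrm x"
proof -
  have "A x = (\<Sum>i\<le>k. A (u i))"
    unfolding x using module_hom.sum[of fun_scale fun_scale A u "{..k}"] sym
    by (simp add: symmetric_on_def)
  then have "nrm (A x - (\<Sum>i\<le>k. fun_scale (c i) (u i))) = nrm (\<Sum>i\<le>k. A (u i) - fun_scale (c i) (u i))"
    by (simp only: sum_subtractf)
  also have "\<dots> \<le> (\<Sum>i\<le>k. nrm (A (u i) - fun_scale (c i) (u i)))" by (rule nrm_sum)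
  also have "\<dots> \<le> (\<Sum>i\<le>k. \<epsilon> * nrm (u i))"
    unfolding c_def using u by (intro sum_mono approx) auto
  also have "\<dots> = \<epsilon> * (\<Sum>i\<le>k. nrm (u i))" by (simp add: sum_distrib_left)
  also have "\<dots> \<le> \<epsilon> * (sqrt (real (card {..k})) * sqrt (\<Sum>i\<le>k. (nrm (u i))\<^sup>2))"
    by (intro mult_left_mono sum_le_sqrt_card eps_ge_0) simp
  also have "(\<Sum>i\<le>k. (nrm (u i))\<^sup>2) = (nrm x)\<^sup>2" unfolding x by (simp only: nrm_component_sum[OF u])
  also have "\<epsilon> * (sqrt (real (card {..k})) * sqrt ((nrm x)\<^sup>2)) = \<delta> * nrm x"
    using nrm_ge_0[of x] by (simp add: \<delta>_def add.commute)
  finally show ?thesis .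
qed

lemma quadratic_form_bounds:
  assumes u: "\<forall>i\<le>k. u i \<in> U i" and x: "x = (\<Sum>i\<le>k. u i)"
    and range: "\<And>i. i \<le> k \<Longrightarrow> u i \<noteq> 0 \<Longrightarrow> lo \<le> c i \<and> c i \<le> hi"
  shows "(lo - \<delta>) * (nrm x)\<^sup>2 \<le> inn (A x) x" "inn (A x) x \<le> (hi + \<delta>) * (nrm x)\<^sup>2"
proof -
  define D where "D = (\<Sum>i\<le>k. fun_scale (c i) (u i))"
  have "inn D x = (\<Sum>i\<le>k. c i * (nrm (u i))\<^sup>2)"
    using inn_components[OF u, of c "\<lambda>_. 1"] by (simp add: D_def x)
  moreover have "(nrm x)\<^sup>2 = (\<Sum>i\<le>k. (nrm (u i))\<^sup>2)" unfolding x by (rule nrm_component_sum[OF u])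
  moreover have "lo * (nrm (u i))\<^sup>2 \<le> c i * (nrm (u i))\<^sup>2 \<and> c i * (nrm (u i))\<^sup>2 \<le> hi * (nrm (u i))\<^sup>2"
    if "i \<le> k" for i
  proof (cases "u i = 0")
    case True
    then show ?thesis by (simp add: nm_def ip_simps)
  next
    case False
    then show ?thesis using range[OF that] by (simp add: mult_right_mono)
  qed
  ultimately have 1: "lo * (nrm x)\<^sup>2 \<le> inn D x" "inn D x \<le> hi * (nrm x)\<^sup>2"
    by (auto simp: sum_distrib_left intro!: sum_mono)
  have "\<bar>inn (A x - D) x\<bar> \<le> nrm (A x - D) * nrm x" by (rule cauchy_schwarz)
  also have "\<dots> \<le> \<delta> * nrm x * nrm x"
    using approx_sum[OF u x] nrm_ge_0 unfolding D_def by (intro mult_right_mono) auto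
  finally have 2: "\<bar>inn (A x - D) x\<bar> \<le> \<delta> * (nrm x)\<^sup>2" by (simp add: power2_eq_square mult.assoc)
  have 3: "inn (A x - D) x = inn (A x) x - inn D x" by (simp add: ip_simps)
  show "(lo - \<delta>) * (nrm x)\<^sup>2 \<le> inn (A x) x" "inn (A x) x \<le> (hi + \<delta>) * (nrm x)\<^sup>2"
    using 1 2 unfolding 3 by (simp_all add: algebra_simps abs_le_iff)
qed

text \<open>If \<open>\<mu>\<close> is farther than \<open>\<delta>\<close> from every \<open>c i\<close>, then the diagonal operator minus \<open>\<mu>\<close> expands \<open>x\<close> by more
than \<open>\<delta>\<close>, whereas it differs by at most \<open>\<delta>\<close> from \<open>A - \<mu>\<close>, which kills \<open>x\<close>.\<close>

lemma eigenvalue_near: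
  assumes x: "x \<in> T" "x \<noteq> 0" "A x = fun_scale \<mu> x"
  obtains i where "i \<le> k" "\<bar>\<mu> - c i\<bar> \<le> \<delta>"
proof (rule ccontr)
  assume no: "\<not> thesis"
  obtain u where u: "\<forall>i\<le>k. u i \<in> U i" and xu: "x = (\<Sum>i\<le>k. u i)" using U_sum[OF x(1)] by blast
  have far: "\<forall>i\<le>k. \<bar>\<mu> - c i\<bar> > \<delta>" using no that by force
  have "A x = (\<Sum>i\<le>k. fun_scale \<mu> (u i))"
    unfolding x(3) by (simp only: xu fun_vs.scale_sum_right)
  then have "A x - (\<Sum>i\<le>k. fun_scale (c i) (u i)) = (\<Sum>i\<le>k. fun_scale (\<mu> - c i) (u i))"
    by (simp only: sum_subtractf fun_vs.scale_left_diff_distrib)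
  then have "(nrm (\<Sum>i\<le>k. fun_scale (\<mu> - c i) (u i)))\<^sup>2 \<le> (\<delta> * nrm x)\<^sup>2"
    using approx_sum[OF u xu] nrm_ge_0 by (intro power_mono) simp_all
  then have le: "(\<Sum>i\<le>k. (\<mu> - c i)\<^sup>2 * (nrm (u i))\<^sup>2) \<le> (\<Sum>i\<le>k. \<delta>\<^sup>2 * (nrm (u i))\<^sup>2)"
    unfolding nrm_components[OF u] power_mult_distrib
    unfolding xu nrm_component_sum[OF u] by (simp add: sum_distrib_left)
  have sq: "\<delta>\<^sup>2 < (\<mu> - c i)\<^sup>2" if "i \<le> k" for i
    using far that delta_ge_0 by (metis abs_of_nonneg power2_abs power_strict_mono zero_less_numeral)
  have "\<exists>i\<le>k. u i \<noteq> 0"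
  proof (rule ccontr)
    assume "\<not> ?thesis"
    then have "x = 0" unfolding xu by (intro sum.neutral) auto
    then show False using x(2) by blast
  qed
  then obtain i where i: "i \<le> k" "u i \<noteq> 0" by blast
  then have "nrm (u i) \<noteq> 0" using nrm_eq_0D u U_subset T(2) by blast
  then have "(\<Sum>i\<le>k. \<delta>\<^sup>2 * (nrm (u i))\<^sup>2) < (\<Sum>i\<le>k. (\<mu> - c i)\<^sup>2 * (nrm (u i))\<^sup>2)"
    by (intro sum_strict_mono_ex1 ballI bexI[of _ i] mult_right_mono mult_strict_right_mono less_imp_le[OF sq])
      (use sq i(1) in auto)
  then show False using le by linarith
qed

definition W :: "nat \<Rightarrow> ('b \<Rightarrow> real) set" where
  "W i = fun_vs.span {f \<in> T. f \<noteq> 0 \<and> (\<exists>\<mu>. A f = fun_scale \<mu> f \<and> \<bar>\<mu> - c i\<bar> \<le> \<delta>)}"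

lemma W_subspace: "fun_vs.subspace (W i)"
  unfolding W_def by (rule fun_vs.subspace_span)

lemma W_subset: "W i \<subseteq> T"
  unfolding W_def by (rule fun_vs.span_minimal[OF _ T(1)]) blast

lemma W_invariant: "f \<in> W i \<Longrightarrow> A f \<in> W i"
proof -
  let ?E = "{f \<in> T. f \<noteq> 0 \<and> (\<exists>\<mu>. A f = fun_scale \<mu> f \<and> \<bar>\<mu> - c i\<bar> \<le> \<delta>)}"
  note D = symmetric_onD[OF sym]
  have "fun_vs.subspace {f. A f \<in> W i}"
    unfolding fun_vs.subspace_def
    using W_subspace[of i] fun_vs.subspace_0 fun_vs.subspace_add fun_vs.subspace_scale
    by (auto simp: D(1,3,4))
  moreover have "?E \<subseteq> {f. A f \<in> W i}"
  proof
    fix f assume f: "f \<in> ?E"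
    then obtain \<mu> where "A f = fun_scale \<mu> f" by auto
    moreover have "f \<in> W i" unfolding W_def using f by (rule fun_vs.span_base)
    ultimately show "f \<in> {f. A f \<in> W i}" using fun_vs.subspace_scale[OF W_subspace] by simp
  qed
  ultimately have "W i \<subseteq> {f. A f \<in> W i}" unfolding W_def by (intro fun_vs.span_minimal)
  then show "f \<in> W i \<Longrightarrow> A f \<in> W i" by blast
qed

lemma eigenvectors_orth:
  assumes "x \<in> T" "y \<in> T" "A x = fun_scale \<mu> x" "A y = fun_scale \<nu> y" "\<mu> \<noteq> \<nu>"
  shows "inn x y = 0"
proof -
  have "inn (A x) y = inn x (A y)" using symmetric_onD(8)[OF sym assms(1,2)] .
  then have "\<mu> * inn x y = \<nu> * inn x y" by (simp add: assms ip_simps)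
  then show ?thesis using assms(5) by simp
qed

lemma W_orth:
  assumes "i \<noteq> j" "\<delta> < 1 / 2" "x \<in> W i" "y \<in> W j"
  shows "inn x y = 0"
proof -
  let ?E = "\<lambda>i. {f \<in> T. f \<noteq> 0 \<and> (\<exists>\<mu>. A f = fun_scale \<mu> f \<and> \<bar>\<mu> - c i\<bar> \<le> \<delta>)}"
  have "inn e f = 0" if e: "e \<in> ?E i" and f: "f \<in> ?E j" for e f
  proof -
    obtain \<mu> where m: "A e = fun_scale \<mu> e" "\<bar>\<mu> - c i\<bar> \<le> \<delta>" using e by auto
    obtain \<nu> where n: "A f = fun_scale \<nu> f" "\<bar>\<nu> - c j\<bar> \<le> \<delta>" using f by auto
    have "\<mu> \<noteq> \<nu>" using m n c_dist[OF assms(1)] assms(2) by linarith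
    then show ?thesis using eigenvectors_orth[OF _ _ m(1) n(1)] e f by blast
  qed
  then have "inn e y = 0" if "e \<in> ?E i" for e
    using ip_perp_span[of "?E j" S w e y] assms(4) that unfolding W_def by blast
  then have "inn y x = 0"
    using ip_perp_span[of "?E i" S w y x] assms(3) unfolding W_def by (simp add: ip_commute)
  then show ?thesis by (simp add: ip_commute)
qed

text \<open>The complement of \<open>W i\<close> in \<open>T\<close>; it contains the eigenvectors that belong to the other strips.\<close>

definition Z :: "nat \<Rightarrow> ('b \<Rightarrow> real) set" where
  "Z i = {f \<in> T. \<forall>g\<in>W i. inn f g = 0}"

lemma Z_symmetric: "symmetric_on S w (Z i) A"
proof (rule symmetric_on_subspace[OF sym])
  show "fun_vs.subspace (Z i)"
    using T(1) unfolding Z_def fun_vs.subspace_def by (auto simp: ip_simps)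
  show "Z i \<subseteq> T" by (auto simp: Z_def)
  show "A f \<in> Z i" if "f \<in> Z i" for f
  proof -
    have "inn (A f) g = 0" if g: "g \<in> W i" for g
      using symmetric_onD(8)[OF sym, of f g] W_invariant[OF g] \<open>f \<in> Z i\<close> W_subset g
      by (auto simp: Z_def)
    then show ?thesis using that T(3) by (auto simp: Z_def)
  qed
qed

lemma Z_eigenvalue_far:
  assumes "i \<le> k" "g \<in> Z i" "g \<noteq> 0" "A g = fun_scale \<mu> g"
  shows "k > 0" "\<bar>\<mu> - c i\<bar> \<ge> 1 - \<delta>"
proof -
  have gT: "g \<in> T" using assms(2) by (simp add: Z_def)
  obtain j where j: "j \<le> k" "\<bar>\<mu> - c j\<bar> \<le> \<delta>" using eigenvalue_near[OF gT assms(3,4)] .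
  have "j \<noteq> i"
  proof
    assume "j = i"
    then have "g \<in> W i" unfolding W_def using j gT assms(3,4) by (intro fun_vs.span_base) auto
    then have "inn g g = 0" using assms(2) by (auto simp: Z_def)
    then show False using inn_pos[OF T(2)[OF gT] assms(3)] by simp
  qed
  then show "k > 0" "\<bar>\<mu> - c i\<bar> \<ge> 1 - \<delta>" using j assms(1) c_dist[of j i] by auto
qed

lemma orth_proj_W_rest:
  assumes "x \<in> T" "orth_proj S w (W i) x p"
  shows "x - p \<in> Z i"
  using assms W_subset fun_vs.subspace_diff[OF T(1)] by (auto simp: Z_def orth_proj_def)

text \<open>With a single strip every eigenvector lies in \<open>W 0\<close>, so a nonzero complement would contain an
eigenvector orthogonal to itself.\<close>

lemma Z_trivial:
  assumes "k = 0" "x \<in> Z 0"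
  shows "x = 0"
proof (rule ccontr)
  assume "x \<noteq> 0"
  then have "Z 0 \<noteq> {0}" using assms(2) by blast
  from max_eigenvector[OF Z_symmetric this] obtain g \<mu>
    where "g \<in> Z 0" "g \<noteq> 0" "A g = fun_scale \<mu> g" by metis
  then show False using Z_eigenvalue_far(1)[of 0 g \<mu>] assms(1) by simp
qed

text \<open>Since \<open>W i\<close> and \<open>Z i\<close> are invariant, it suffices to bound \<open>C = A - c i\<close> from below on \<open>Z i\<close>. The form of
\<open>C\<^sup>2\<close> is minimal at some \<open>g\<close> with \<open>C\<^sup>2 g = s\<^sup>2 g\<close>. As \<open>C\<^sup>2 - s\<^sup>2 = (C - s) (C + s)\<close>, either \<open>g\<close> is an
eigenvector of \<open>C\<close> for \<open>- s\<close> or \<open>(C + s) g\<close> is one for \<open>s\<close>; both lie in \<open>Z i\<close>, where eigenvalues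
of \<open>A\<close> are far from \<open>c i\<close>.\<close>

lemma W_gap:
  assumes i: "i \<le> k" and d: "\<delta> < 1" and x: "x \<in> T" and p: "orth_proj S w (W i) x p"
  shows "(1 - \<delta>) * nrm (x - p) \<le> nrm (A x - fun_scale (c i) x)"
proof -
  define C where "C f = A f - fun_scale (c i) f" for f
  note D = symmetric_onD[OF Z_symmetric[of i]]
  have C_sub: "C f \<in> V" if "fun_vs.subspace V" "f \<in> V" "A f \<in> V" for V f
    unfolding C_def using that fun_vs.subspace_diff fun_vs.subspace_scale by blast
  have C_lin: "C (f + g) = C f + C g" "C (fun_scale a f) = fun_scale a (C f)" for f g a
    by (simp_all add: C_def D(1,3) fun_vs.scale_right_distrib fun_vs.scale_right_diff_distrib
        fun_vs.scale_left_commute)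
  have CZ: "C f \<in> Z i" if "f \<in> Z i" for f
    by (rule C_sub[OF D(5) that D(7)[OF that]])
  have C_sym: "inn (C f) g = inn f (C g)" if "f \<in> T" "g \<in> T" for f g
    using symmetric_onD(8)[OF sym that] by (simp add: C_def ip_simps)
  have ZT: "f \<in> T" if "f \<in> Z i" for f using that by (simp add: Z_def)
  have symCC: "symmetric_on S w (Z i) (\<lambda>f. C (C f))"
    unfolding symmetric_on_def
  proof (intro conjI ballI)
    show "module_hom fun_scale fun_scale (\<lambda>f. C (C f))"
      by unfold_locales (simp_all add: C_lin)
    show "fun_vs.subspace (Z i)" by (rule D(5))
    show "Z i \<subseteq> Fun" using ZT T(2) by blast
    show "C (C f) \<in> Z i" if "f \<in> Z i" for f using CZ that by blast
    show "inn (C (C f)) g = inn f (C (C g))" if "f \<in> Z i" "g \<in> Z i" for f g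
      using C_sym[of "C f" g] C_sym[of f "C g"] CZ ZT that by simp
  qed
  define r where "r = x - p"
  have rZ: "r \<in> Z i" unfolding r_def by (rule orth_proj_W_rest[OF x p])
  have r_bound: "(1 - \<delta>) * nrm r \<le> nrm (C r)"
  proof (cases "r = 0")
    case True
    then show ?thesis by (simp add: nm_def ip_simps C_def D(4))
  next
    case False
    then have "Z i \<noteq> {0}" using rZ by blast
    from min_eigenvector[OF symCC this] obtain g t where g: "g \<in> Z i" "g \<noteq> 0" "C (C g) = fun_scale t g"
      and t: "\<And>h. h \<in> Z i \<Longrightarrow> inn (C (C h)) h \<ge> t * inn h h" by metis
    have CC: "inn (C (C h)) h = (nrm (C h))\<^sup>2" if "h \<in> Z i" for h
      using C_sym[of "C h" h] CZ ZT that by (simp add: nrm_sq)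
    have "inn g g > 0" using inn_pos g T(2) ZT by blast
    moreover have "t * inn g g = (nrm (C g))\<^sup>2" using CC[OF g(1)] by (simp add: g(3) ip_simps)
    ultimately have "t \<ge> 0" by (metis zero_le_mult_iff not_less zero_le_power2 less_le)
    define s where "s = sqrt t"
    have s: "s \<ge> 0" "t = s * s" using \<open>t \<ge> 0\<close> by (simp_all add: s_def)
    define h where "h = C g + fun_scale s g"
    have AC: "A f = fun_scale (c i + b) f" if "C f = fun_scale b f" for b f
    proof -
      have "A f = C f + fun_scale (c i) f" by (simp add: C_def)
      then show ?thesis by (simp add: that fun_vs.scale_left_distrib add.commute)
    qed
    have "s \<ge> 1 - \<delta>"
    proof (cases "h = 0")
      case True
      then have "C g = fun_scale (- s) g" by (simp add: h_def eq_neg_iff_add_eq_0)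
      from Z_eigenvalue_far(2)[OF i g(1,2) AC[OF this]] s(1) show ?thesis by simp
    next
      case False
      have "C h = fun_scale s h"
        by (simp add: h_def C_lin g(3) s(2) fun_vs.scale_right_distrib add.commute)
      moreover have "h \<in> Z i" unfolding h_def
        using CZ[OF g(1)] g(1) fun_vs.subspace_add[OF D(5)] fun_vs.subspace_scale[OF D(5)] by blast
      ultimately show ?thesis using Z_eigenvalue_far(2)[OF i _ False AC] s(1) by fastforce
    qed
    then have "(1 - \<delta>) * nrm r \<le> s * nrm r" using nrm_ge_0 by (rule mult_right_mono)
    also have "\<dots> \<le> nrm (C r)"
    proof (rule power2_le_imp_le)
      show "(s * nrm r)\<^sup>2 \<le> (nrm (C r))\<^sup>2"
        using t[OF rZ] CC[OF rZ] s(2) by (simp add: power_mult_distrib nrm_sq power2_eq_square[of s])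
    qed (rule nrm_ge_0)
    finally show ?thesis .
  qed
  have pW: "p \<in> W i" using p by (simp add: orth_proj_def)
  have "C p \<in> W i" using C_sub[OF W_subspace pW W_invariant[OF pW]] .
  then have "inn (C r) (C p) = 0" using CZ[OF rZ] by (auto simp: Z_def)
  moreover have "C x = C r + C p" using C_lin(1)[of r p] by (simp add: r_def)
  ultimately have "(nrm (C x))\<^sup>2 = (nrm (C r))\<^sup>2 + (nrm (C p))\<^sup>2" using pythagoras by simp
  then have "(nrm (C r))\<^sup>2 \<le> (nrm (C x))\<^sup>2" by simp
  then have "nrm (C r) \<le> nrm (C x)" using nrm_ge_0 by (rule power2_le_imp_le)
  then show ?thesis using r_bound unfolding r_def C_def by linarith
qed

lemma ex_orth_proj_W: obtains p where "orth_proj S w (W i) x p"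
  using ex_orth_proj[OF W_subspace] W_subset T(4) by (meson order_trans)

text \<open>With \<open>f = q + r\<close> and \<open>q\<close> the projection to \<open>U j\<close>, the difference of the squares is the inner product of \<open>f\<close> with
\<open>P r - (q - P q)\<close>, where \<open>P\<close> projects to \<open>W j\<close>. The second part is small by assumption. For the first,
\<open>\<parallel>P r\<parallel>\<^sup>2\<close> is the inner product of \<open>r\<close> with \<open>P r\<close>, and each of the \<open>k\<close> components \<open>u i\<close> of \<open>r\<close> may be replaced there by
its distance vector to \<open>W i\<close>, because \<open>W i\<close> is orthogonal to \<open>W j\<close>.\<close>

lemma projection_comparison:
  assumes d: "\<delta> < 1 / 2" and j: "j \<le> k" and f: "f \<in> T"
    and close: "\<And>i x p. i \<le> k \<Longrightarrow> x \<in> U i \<Longrightarrow> orth_proj S w (W i) x p \<Longrightarrow> nrm (x - p) \<le> a * nrm x"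
    and a: "a \<ge> 0"
    and p: "orth_proj S w (W j) f p" and q: "orth_proj S w (U j) f q"
  shows "\<bar>(nrm p)\<^sup>2 - (nrm q)\<^sup>2\<bar> \<le> (a + sqrt (real k) * a) * (nrm f)\<^sup>2"
proof -
  obtain u where u: "\<forall>i\<le>k. u i \<in> U i" and fu: "f = (\<Sum>i\<le>k. u i)" using U_sum[OF f] by blast
  (* By orthogonality of the pieces, u j is the projection q, and r is the rest of f. *)
  define r where "r = (\<Sum>i\<in>{..k} - {j}. u i)"
  have split: "f = u j + r" unfolding fu r_def using j by (intro sum.remove) auto
  have "inn r v = 0" if "v \<in> U j" for v
    unfolding r_def ip_sum_left using U_orth[OF _ j] u that by (intro sum.neutral) auto
  then have "orth_proj S w (U j) f (u j)" using u j by (simp add: orth_proj_def split)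
  then have qu: "q = u j"
    using orth_proj_unique[OF U_subspace[OF j] _ q] U_subset[OF j] T(4) by (meson order_trans)
  obtain pq where pq: "orth_proj S w (W j) q pq" by (rule ex_orth_proj_W)
  obtain pr where pr: "orth_proj S w (W j) r pr" by (rule ex_orth_proj_W)
  have "orth_proj S w (W j) f (pq + pr)"
    using pq pr fun_vs.subspace_add[OF W_subspace] unfolding orth_proj_def split qu
    by (auto simp: ip_simps)
  then have ppp: "p = pq + pr"
    using orth_proj_unique[OF W_subspace _ p] W_subset T(4) by (meson order_trans)
  have "inn (f - p) p = 0" "inn (f - q) q = 0" using p q by (auto simp: orth_proj_def)
  then have "(nrm p)\<^sup>2 - (nrm q)\<^sup>2 = inn p f - inn q f"
    unfolding nrm_sq by (simp add: ip_simps ip_commute[of S w f])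
  also have "\<dots> = inn pr f - inn (q - pq) f" unfolding ppp by (simp add: ip_simps)
  finally have main: "(nrm p)\<^sup>2 - (nrm q)\<^sup>2 = inn pr f - inn (q - pq) f" .
  have comp: "(\<Sum>i\<in>J. (nrm (u i))\<^sup>2) \<le> (nrm f)\<^sup>2" if "J \<subseteq> {..k}" for J
    unfolding fu nrm_component_sum[OF u] by (rule sum_mono2) (use that in auto)
  have "nrm q \<le> nrm f"
  proof (rule power2_le_imp_le)
    show "(nrm q)\<^sup>2 \<le> (nrm f)\<^sup>2" using comp[of "{j}"] j by (simp add: qu)
  qed (rule nrm_ge_0)
  have "q \<in> U j" using q by (simp add: orth_proj_def)
  then have "nrm (q - pq) \<le> a * nrm q" using close[OF j _ pq] by blast
  also have "\<dots> \<le> a * nrm f" using \<open>nrm q \<le> nrm f\<close> a by (rule mult_left_mono)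
  finally have "nrm (q - pq) \<le> a * nrm f" .
  then have 1: "\<bar>inn (q - pq) f\<bar> \<le> a * nrm f * nrm f"
    by (rule order_trans[OF cauchy_schwarz mult_right_mono[OF _ nrm_ge_0]])
  have "nrm pr * nrm pr \<le> sqrt (real k) * a * nrm f * nrm pr"
  proof -
    have prW: "pr \<in> W j" using pr by (simp add: orth_proj_def)
    have bound: "inn (u i) pr \<le> a * nrm (u i) * nrm pr" if i: "i \<in> {..k} - {j}" for i
    proof -
      obtain pi where pi: "orth_proj S w (W i) (u i) pi" by (rule ex_orth_proj_W)
      have "inn pi pr = 0" using W_orth[of i j pi pr] d i prW pi by (simp add: orth_proj_def)
      then have "inn (u i) pr = inn (u i - pi) pr" by (simp add: ip_simps)
      also have "\<dots> \<le> nrm (u i - pi) * nrm pr" using cauchy_schwarz[of "u i - pi" pr] by linarith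
      also have "\<dots> \<le> a * nrm (u i) * nrm pr"
        using close[OF _ _ pi] u i nrm_ge_0 by (intro mult_right_mono) auto
      finally show ?thesis .
    qed
    have "inn (r - pr) pr = 0" using pr prW by (simp add: orth_proj_def)
    then have "(nrm pr)\<^sup>2 = inn r pr" by (simp add: nrm_sq ip_simps)
    then have "nrm pr * nrm pr = inn r pr" by (simp add: power2_eq_square)
    also have "\<dots> \<le> (\<Sum>i\<in>{..k} - {j}. a * nrm (u i) * nrm pr)"
      unfolding r_def ip_sum_left by (intro sum_mono bound)
    also have "\<dots> = a * nrm pr * (\<Sum>i\<in>{..k} - {j}. nrm (u i))"
      by (simp add: sum_distrib_left mult_ac)
    also have "\<dots> \<le> a * nrm pr * (sqrt (real (card ({..k} - {j}))) * sqrt (\<Sum>i\<in>{..k} - {j}. (nrm (u i))\<^sup>2))"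
      using a nrm_ge_0 by (intro mult_left_mono sum_le_sqrt_card) auto
    also have "\<dots> \<le> a * nrm pr * (sqrt (real k) * nrm f)"
    proof (intro mult_left_mono mult_mono)
      show "sqrt (\<Sum>i\<in>{..k} - {j}. (nrm (u i))\<^sup>2) \<le> nrm f"
        using comp[of "{..k} - {j}"] nrm_ge_0 by (intro real_le_lsqrt) auto
    qed (use a nrm_ge_0 j in \<open>auto intro: sum_nonneg\<close>)
    finally show ?thesis by (simp add: mult_ac)
  qed
  then have "nrm pr \<le> sqrt (real k) * a * nrm f"
    using a nrm_ge_0[of f] nrm_ge_0[of pr] by (cases "nrm pr = 0") auto
  then have 2: "\<bar>inn pr f\<bar> \<le> sqrt (real k) * a * nrm f * nrm f"
    by (rule order_trans[OF cauchy_schwarz mult_right_mono[OF _ nrm_ge_0]])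
  show ?thesis unfolding main using 1 2 by (simp add: power2_eq_square algebra_simps)
qed

text \<open>Write \<open>x = y + z\<close> with \<open>y\<close> in \<open>U j\<close> and \<open>z\<close> in the lower pieces. Testing \<open>A x\<close> against \<open>z\<close> gives that the form of \<open>A\<close>
at \<open>z\<close> is at most \<open>\<epsilon> \<parallel>y\<parallel> \<parallel>z\<parallel>\<close>, while the scalars of the lower pieces are at least 2, so that
\<open>z\<close> is of size \<open>\<epsilon> \<parallel>y\<parallel>\<close>. This is what makes an element of \<open>U j + ... + U 0\<close> that is orthogonal to the lower pieces
in the form of \<open>A\<close>, rather than in the inner product, behave like an element of \<open>U j\<close>.\<close>

lemma near_top_component:
  assumes j: "j \<le> k" and u: "\<And>i. i \<le> j \<Longrightarrow> u i \<in> U i" and x: "x = (\<Sum>i\<le>j. u i)"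
    and perp: "\<And>i y. i < j \<Longrightarrow> y \<in> U i \<Longrightarrow> inn (A x) y = 0" and d: "\<delta> \<le> 1"
  shows "nrm (A x - fun_scale (c j) x) \<le> \<epsilon> * (real k + 1 + \<delta>) * nrm x"
    and "(1 - \<delta>) * (nrm x)\<^sup>2 \<le> inn (A x) x"
proof -
  note D = symmetric_onD[OF sym]
  have U0: "0 \<in> U i" if "i \<le> k" for i using fun_vs.subspace_0[OF U_subspace[OF that]] .
  have ext: "(\<Sum>i\<in>{..<l}. u i) = (\<Sum>i\<le>k. if i < l then u i else 0)" if "l \<le> k + 1" for l
    using that by (intro sum.mono_neutral_cong_left) auto
  define y where "y = u j"
  define z where "z = (\<Sum>i<j. u i)"
  have xyz: "x = y + z"
    unfolding x y_def z_def by (simp only: lessThan_Suc_atMost[symmetric] sum.lessThan_Suc add.commute)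
  have uk: "\<forall>i\<le>k. (if i < l then u i else 0) \<in> U i" if "l \<le> j + 1" for l
    using u U0 that by auto
  have x': "x = (\<Sum>i\<le>k. if i < j + 1 then u i else 0)"
    using ext[of "j + 1"] j by (simp add: x lessThan_Suc_atMost)
  have z': "z = (\<Sum>i\<le>k. if i < j then u i else 0)"
    using ext[of j] j by (simp add: z_def)
  show "(1 - \<delta>) * (nrm x)\<^sup>2 \<le> inn (A x) x"
    by (rule quadratic_form_bounds(1)[OF uk x', of 1 "real k + 1"], simp) (use j in \<open>auto simp: c_def split: if_splits\<close>)
  have yT: "y \<in> T" and zT: "z \<in> T"
  proof -
    have "u i \<in> T" if "i \<le> j" for i using u[OF that] U_subset[of i] that j by auto
    then show "y \<in> T" "z \<in> T" unfolding y_def z_def by (auto intro!: fun_vs.subspace_sum[OF T(1)])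
  qed
  have orth: "inn y z = 0"
    unfolding y_def z_def ip_sum_right
  proof (intro sum.neutral ballI)
    fix i assume "i \<in> {..<j}"
    then show "inn (u j) (u i) = 0" using U_orth[OF j, of i "u j" "u i"] u[of j] u[of i] j by simp
  qed
  have nx: "(nrm x)\<^sup>2 = (nrm y)\<^sup>2 + (nrm z)\<^sup>2" unfolding xyz by (rule pythagoras[OF orth])
  then have "(nrm y)\<^sup>2 \<le> (nrm x)\<^sup>2" using zero_le_power2[of "nrm z"] by linarith
  then have yx: "nrm y \<le> nrm x" by (rule power2_le_imp_le[OF _ nrm_ge_0])
  have Ay: "nrm (A y - fun_scale (c j) y) \<le> \<epsilon> * nrm y"
    unfolding c_def y_def using approx[OF j] u by blast
  (* This is where the orthogonality to the lower pieces in the form of A enters. *)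
  have "inn (A x) z = 0" unfolding z_def ip_sum_right using perp u by (intro sum.neutral) auto
  then have "inn (A z) z = - inn (A y) z" by (simp add: xyz D(1) ip_simps)
  also have "inn (A y) z = inn (A y - fun_scale (c j) y) z" by (simp add: ip_simps orth)
  also have "- \<dots> \<le> nrm (A y - fun_scale (c j) y) * nrm z"
    using cauchy_schwarz[of "A y - fun_scale (c j) y" z] by linarith
  also have "\<dots> \<le> \<epsilon> * nrm y * nrm z" using Ay nrm_ge_0 by (intro mult_right_mono)
  finally have up: "inn (A z) z \<le> \<epsilon> * nrm y * nrm z" .
  have "(2 - \<delta>) * (nrm z)\<^sup>2 \<le> inn (A z) z"
    by (rule quadratic_form_bounds(1)[OF uk z', of 2 "real k + 1"], simp) (use j in \<open>auto simp: c_def split: if_splits\<close>)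
  moreover have "1 * (nrm z)\<^sup>2 \<le> (2 - \<delta>) * (nrm z)\<^sup>2" using d by (intro mult_right_mono) auto
  ultimately have "nrm z * nrm z \<le> \<epsilon> * nrm y * nrm z" using up by (simp add: power2_eq_square)
  then have zy: "nrm z \<le> \<epsilon> * nrm y"
    using eps_ge_0 nrm_ge_0[of y] nrm_ge_0[of z] by (cases "nrm z = 0") auto
  define Dz where "Dz = (\<Sum>i\<le>k. fun_scale (c i) (if i < j then u i else 0))"
  have 1: "nrm (A z - Dz) \<le> \<delta> * nrm z" unfolding Dz_def by (rule approx_sum[OF uk z']) auto
  have nz: "(nrm z)\<^sup>2 = (\<Sum>i\<le>k. (nrm (if i < j then u i else 0))\<^sup>2)"
    unfolding z' by (rule nrm_component_sum[OF uk]) simp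
  have Dz: "Dz - fun_scale (c j) z = (\<Sum>i\<le>k. fun_scale (c i - c j) (if i < j then u i else 0))"
    unfolding Dz_def z' fun_vs.scale_sum_right
    by (simp only: sum_subtractf fun_vs.scale_left_diff_distrib)
  have "(nrm (Dz - fun_scale (c j) z))\<^sup>2 = (\<Sum>i\<le>k. (c i - c j)\<^sup>2 * (nrm (if i < j then u i else 0))\<^sup>2)"
    unfolding Dz by (rule nrm_components[OF uk]) simp
  also have "\<dots> \<le> (\<Sum>i\<le>k. (real k)\<^sup>2 * (nrm (if i < j then u i else 0))\<^sup>2)"
  proof (rule sum_mono)
    fix i
    show "(c i - c j)\<^sup>2 * (nrm (if i < j then u i else 0))\<^sup>2 \<le> (real k)\<^sup>2 * (nrm (if i < j then u i else 0))\<^sup>2"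
    proof (cases "i < j")
      case True
      then show ?thesis using j by (intro mult_right_mono power_mono) (auto simp: c_def)
    qed (simp add: nm_def ip_simps)
  qed
  also have "\<dots> = (real k * nrm z)\<^sup>2"
    by (simp only: nz power_mult_distrib sum_distrib_left)
  finally have "(nrm (Dz - fun_scale (c j) z))\<^sup>2 \<le> (real k * nrm z)\<^sup>2" .
  then have 2: "nrm (Dz - fun_scale (c j) z) \<le> real k * nrm z"
    by (rule power2_le_imp_le) (simp add: nrm_ge_0)
  have "A x - fun_scale (c j) x
      = (A y - fun_scale (c j) y) + ((A z - Dz) + (Dz - fun_scale (c j) z))"
    by (simp add: xyz D(1) fun_vs.scale_right_distrib)
  then have "nrm (A x - fun_scale (c j) x)
      \<le> nrm (A y - fun_scale (c j) y) + (nrm (A z - Dz) + nrm (Dz - fun_scale (c j) z))"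
    using nrm_triangle[of "A y - fun_scale (c j) y" "(A z - Dz) + (Dz - fun_scale (c j) z)"]
      nrm_triangle[of "A z - Dz" "Dz - fun_scale (c j) z"] by (simp only:)
  also have "\<dots> \<le> \<epsilon> * nrm y + (real k + \<delta>) * nrm z" using Ay 1 2 by (simp add: algebra_simps)
  also have "\<dots> \<le> \<epsilon> * nrm y + (real k + \<delta>) * (\<epsilon> * nrm y)"
    using zy delta_ge_0 by (intro add_left_mono mult_left_mono) auto
  also have "\<dots> = \<epsilon> * (real k + 1 + \<delta>) * nrm y" by (simp add: algebra_simps)
  also have "\<dots> \<le> \<epsilon> * (real k + 1 + \<delta>) * nrm x"
    using yx eps_ge_0 delta_ge_0 by (intro mult_left_mono) auto
  finally show "nrm (A x - fun_scale (c j) x) \<le> \<epsilon> * (real k + 1 + \<delta>) * nrm x" .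
qed

lemma quadratic_form_le:
  assumes "x \<in> T"
  shows "inn (A x) x \<le> (real k + 1 + \<delta>) * (nrm x)\<^sup>2"
proof -
  obtain u where u: "\<forall>i\<le>k. u i \<in> U i" and xu: "x = (\<Sum>i\<le>k. u i)" using U_sum[OF assms] by blast
  show ?thesis
    by (rule quadratic_form_bounds(2)[OF u xu, of 1 "real k + 1"]) (auto simp: c_def)
qed

end

section \<open>Weighted complexes and the walks on their links\<close>

locale weighted_complex =
  fixes X :: "'a set set" and n :: nat and m :: "'a set \<Rightarrow> real"
  assumes pure: "pure_complex X n" and weight: "weight_function X n m"
begin

text \<open>The faces with \<open>p\<close> vertices. Counting vertices instead of dimension puts the empty face, whose
link is the whole complex, on the same footing as the other faces.\<close>

definition fc :: "nat \<Rightarrow> 'a set set" where "fc p = {\<sigma> \<in> X. card \<sigma> = p}"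

text \<open>The vertices of the link of \<open>\<rho>\<close>; they index the cofaces of \<open>\<rho>\<close> with one more vertex.\<close>

definition nb :: "'a set \<Rightarrow> 'a set" where
  "nb \<rho> = {u. u \<notin> \<rho> \<and> insert u \<rho> \<in> X}"

lemma finite_X: "finite X" and finite_simplex: "\<sigma> \<in> X \<Longrightarrow> finite \<sigma>"
  and face_closed: "\<sigma> \<in> X \<Longrightarrow> \<tau> \<subseteq> \<sigma> \<Longrightarrow> \<tau> \<in> X" and m_pos: "\<sigma> \<in> X \<Longrightarrow> m \<sigma> > 0"
  and n_pos: "n \<ge> 1" and empty_X: "{} \<in> X"
  using pure weight by (auto simp: pure_complex_def finite_simplicial_complex_def weight_function_def)

lemma faces_eq: "faces X (int k) = fc (Suc k)" "faces X (int k + 1) = fc (Suc (Suc k))"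
  "faces X (int p - 1) = fc p"
  by (auto simp: faces_def fc_def)

lemma finite_fc: "finite (fc p)"
  using finite_X by (simp add: fc_def)

sublocale fc: wspace "fc p" m for p
  by unfold_locales (auto simp: finite_fc, auto simp: fc_def m_pos)

lemma finite_nb: "finite (nb \<rho>)"
proof -
  have "nb \<rho> \<subseteq> \<Union>X" by (auto simp: nb_def)
  then show ?thesis using finite_X finite_simplex by (meson finite_Union finite_subset)
qed

lemma finite_faces_below: "\<sigma> \<in> fc p \<Longrightarrow> finite \<sigma>"
  using finite_simplex by (simp add: fc_def)

lemma weight_sum:
  assumes "\<rho> \<in> X" "card \<rho> \<le> n"
  shows "m \<rho> = (\<Sum>u\<in>nb \<rho>. m (insert u \<rho>))"
proof -
  have fin: "finite \<rho>" using assms finite_simplex by blast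
  have "\<rho> \<in> faces X (int (card \<rho>) - 1)" using assms(1) by (simp add: faces_def)
  moreover have "- 1 \<le> int (card \<rho>) - 1 \<and> int (card \<rho>) - 1 \<le> int n - 1" using assms(2) by simp
  ultimately have "m \<rho> = (\<Sum>\<sigma> | \<sigma> \<in> faces X (int (card \<rho>) - 1 + 1) \<and> \<rho> \<subset> \<sigma>. m \<sigma>)"
    using weight unfolding weight_function_def by blast
  also have "{\<sigma>. \<sigma> \<in> faces X (int (card \<rho>) - 1 + 1) \<and> \<rho> \<subset> \<sigma>} = (\<lambda>u. insert u \<rho>) ` nb \<rho>" (is "?A = ?B")
  proof
    show "?B \<subseteq> ?A" using fin by (auto simp: nb_def faces_def)
    show "?A \<subseteq> ?B"
    proof
      fix \<sigma> assume s: "\<sigma> \<in> ?A"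
      then have c: "card \<sigma> = card \<rho> + 1" and sub: "\<rho> \<subset> \<sigma>" and X: "\<sigma> \<in> X"
        by (auto simp: faces_def)
      have "card (\<sigma> - \<rho>) = 1" using c sub fin by (simp add: card_Diff_subset)
      then obtain u where "\<sigma> - \<rho> = {u}" by (rule card_1_singletonE)
      then have "\<sigma> = insert u \<rho>" "u \<notin> \<rho>" using sub by auto
      then show "\<sigma> \<in> ?B" using X by (auto simp: nb_def)
    qed
  qed
  also have "sum m ?B = (\<Sum>u\<in>nb \<rho>. m (insert u \<rho>))"
    by (subst sum.reindex) (auto simp: nb_def intro!: inj_onI)
  finally show ?thesis .
qed

lemma sum_facets:
  assumes "\<sigma> \<in> fc (Suc p)"
  shows "(\<Sum>\<tau> | \<tau> \<in> fc p \<and> \<tau> \<subset> \<sigma>. g \<tau>) = (\<Sum>x\<in>\<sigma>. g (\<sigma> - {x}))"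
proof -
  have fin: "finite \<sigma>" and X: "\<sigma> \<in> X" and c: "card \<sigma> = Suc p" using assms finite_simplex by (auto simp: fc_def)
  have "{\<tau>. \<tau> \<in> fc p \<and> \<tau> \<subset> \<sigma>} = (\<lambda>x. \<sigma> - {x}) ` \<sigma>" (is "?A = ?B")
  proof
    show "?B \<subseteq> ?A" using fin c face_closed[OF X] by (auto simp: fc_def)
    show "?A \<subseteq> ?B"
    proof
      fix \<tau> assume "\<tau> \<in> ?A"
      then have sub: "\<tau> \<subset> \<sigma>" and ct: "card \<tau> = p" by (auto simp: fc_def)
      have "card (\<sigma> - \<tau>) = 1" using ct sub c finite_subset[OF psubset_imp_subset[OF sub] fin]
        by (simp add: card_Diff_subset psubset_imp_subset)
      then obtain u where "\<sigma> - \<tau> = {u}" by (rule card_1_singletonE)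
      then show "\<tau> \<in> ?B" using sub by auto
    qed
  qed
  moreover have "inj_on (\<lambda>x. \<sigma> - {x}) \<sigma>"
    by (rule inj_onI) blast
  ultimately show ?thesis by (simp add: sum.reindex)
qed

text \<open>Both sides run over the pairs of a face and one of its vertices.\<close>

lemma sum_flags:
  "(\<Sum>\<sigma>\<in>fc (Suc p). \<Sum>x\<in>\<sigma>. g \<sigma> x) = (\<Sum>\<tau>\<in>fc p. \<Sum>u\<in>nb \<tau>. g (insert u \<tau>) u)"
proof -
  have "(\<Sum>(\<sigma>, x)\<in>(SIGMA \<sigma>:fc (Suc p). \<sigma>). g \<sigma> x) = (\<Sum>(\<tau>, u)\<in>(SIGMA \<tau>:fc p. nb \<tau>). g (insert u \<tau>) u)"
  proof (rule sum.reindex_bij_witness[of _ "\<lambda>(\<tau>, u). (insert u \<tau>, u)" "\<lambda>(\<sigma>, x). (\<sigma> - {x}, x)"], goal_cases)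
    case (2 a)
    then show ?case using face_closed by (auto simp: fc_def nb_def insert_absorb card_Diff_singleton)
  next
    case (4 b)
    then show ?case using finite_simplex by (auto simp: fc_def nb_def)
  qed (auto simp: nb_def insert_absorb)
  then show ?thesis by (simp add: sum.Sigma finite_fc finite_nb finite_faces_below)
qed

lemma link_vertices: "complex_vertices (link X \<tau>) = nb \<tau>"
  by (auto simp: complex_vertices_def faces_def link_def nb_def)

lemma link_edges:
  assumes "v \<in> nb \<tau>"
  shows "{u. {v, u} \<in> faces (link X \<tau>) 1} = nb (insert v \<tau>)"
proof -
  have "card {v, u} = 2 \<longleftrightarrow> v \<noteq> u" for u by (auto simp: card_insert_if)
  then show ?thesis
    using assms by (auto simp: faces_def link_def nb_def insert_commute)
qed

lemma nb_sym:
  assumes "v \<in> nb \<tau>" "u \<in> nb (insert v \<tau>)"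
  shows "u \<in> nb \<tau>" "v \<in> nb (insert u \<tau>)"
  using assms face_closed[of "insert u (insert v \<tau>)" "insert u \<tau>"]
  by (auto simp: nb_def insert_commute)

text \<open>The pairs \<open>(v, u)\<close> are the oriented edges of the link of \<open>\<tau>\<close>.\<close>

lemma sum_link_edges_swap:
  "(\<Sum>v\<in>nb \<tau>. \<Sum>u\<in>nb (insert v \<tau>). h v u) = (\<Sum>v\<in>nb \<tau>. \<Sum>u\<in>nb (insert v \<tau>). h u v)"
proof -
  have "(\<Sum>(v, u)\<in>(SIGMA v:nb \<tau>. nb (insert v \<tau>)). h v u)
      = (\<Sum>(v, u)\<in>(SIGMA v:nb \<tau>. nb (insert v \<tau>)). h u v)"
    by (rule sum.reindex_bij_witness[of _ "\<lambda>(v, u). (u, v)" "\<lambda>(v, u). (u, v)"])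
      (auto dest: nb_sym)
  then show ?thesis by (simp add: sum.Sigma finite_nb)
qed

end

text \<open>The bound on \<open>card \<tau>\<close> means that the link has dimension at least one, so that it carries a walk.\<close>

locale complex_link = weighted_complex +
  fixes \<tau> :: "'a set"
  assumes tau: "\<tau> \<in> X" "card \<tau> \<le> n - 1"
begin

definition lw :: "'a \<Rightarrow> real" where "lw v = m (insert v \<tau>)"

abbreviation "walk \<equiv> nonlazy_walk (link X \<tau>) (link_weight m \<tau>)"

sublocale wspace "nb \<tau>" lw
  by unfold_locales (auto simp: finite_nb, auto simp: lw_def nb_def m_pos)

lemma link_vertex_weight:
  assumes "v \<in> nb \<tau>"
  shows "lw v = (\<Sum>u\<in>nb (insert v \<tau>). m (insert u (insert v \<tau>)))"
proof -
  have "card (insert v \<tau>) \<le> n"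
    using tau n_pos card_insert_le_m1[of n \<tau> v] by simp
  then show ?thesis unfolding lw_def using assms by (intro weight_sum) (auto simp: nb_def)
qed

lemma walk_apply:
  "walk f v = (if v \<in> nb \<tau> then (\<Sum>u\<in>nb (insert v \<tau>). m (insert u (insert v \<tau>)) / lw v * f u) else 0)"
proof -
  have "link_weight m \<tau> {v, u} = m (insert u (insert v \<tau>))" for u
    unfolding link_weight_def by (rule arg_cong[of _ _ m]) auto
  moreover have "link_weight m \<tau> {v} = lw v" by (simp add: link_weight_def lw_def)
  ultimately show ?thesis
    unfolding nonlazy_walk_def link_vertices by (simp add: link_edges)
qed

lemma inn_walk:
  "inn (walk f) g = (\<Sum>v\<in>nb \<tau>. \<Sum>u\<in>nb (insert v \<tau>). m (insert u (insert v \<tau>)) * (f u * g v))"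
proof -
  have "lw v * walk f v * g v = (\<Sum>u\<in>nb (insert v \<tau>). m (insert u (insert v \<tau>)) * (f u * g v))"
    if "v \<in> nb \<tau>" for v
    using that w_pos[OF that] by (simp add: walk_apply sum_distrib_left sum_distrib_right mult.assoc)
  then show ?thesis by (simp add: ip_def)
qed

lemma walk_symmetric: "symmetric_on (nb \<tau>) lw Fun walk"
  unfolding symmetric_on_def
proof (intro conjI ballI)
  show "module_hom fun_scale fun_scale walk"
    by unfold_locales
      (auto simp: fun_eq_iff walk_apply fun_scale_def sum.distrib sum_distrib_left distrib_left
        mult.left_commute)
  show "fun_vs.subspace Fun" by (rule subspace_supported)
  show "walk f \<in> Fun" for f by (simp add: supported_def walk_apply)
  show "inn (walk f) g = inn f (walk g)" for f g
    unfolding ip_commute[of _ _ f] inn_walk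
    by (subst sum_link_edges_swap) (simp add: insert_commute mult.commute)
qed simp

text \<open>Each edge contributes \<open>2 f u f v \<le> (f u)\<^sup>2 + (f v)\<^sup>2\<close>, and the edge weights at a vertex add up to its
weight.\<close>

lemma walk_contraction: "inn (walk f) f \<le> inn f f"
proof -
  let ?p = "\<lambda>v u. m (insert u (insert v \<tau>))"
  have sq: "inn f f = (\<Sum>v\<in>nb \<tau>. \<Sum>u\<in>nb (insert v \<tau>). ?p v u * (f v)\<^sup>2)"
    unfolding ip_def
    by (intro sum.cong refl) (simp add: link_vertex_weight sum_distrib_right power2_eq_square mult.assoc)
  also have "\<dots> = (\<Sum>v\<in>nb \<tau>. \<Sum>u\<in>nb (insert v \<tau>). ?p v u * (f u)\<^sup>2)"
    by (subst sum_link_edges_swap) (simp add: insert_commute)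
  finally have sq': "inn f f = (\<Sum>v\<in>nb \<tau>. \<Sum>u\<in>nb (insert v \<tau>). ?p v u * (f u)\<^sup>2)" .
  have "2 * inn (walk f) f = (\<Sum>v\<in>nb \<tau>. \<Sum>u\<in>nb (insert v \<tau>). ?p v u * (2 * f u * f v))"
    unfolding inn_walk by (simp add: sum_distrib_left algebra_simps)
  also have "\<dots> \<le> (\<Sum>v\<in>nb \<tau>. \<Sum>u\<in>nb (insert v \<tau>). ?p v u * ((f u)\<^sup>2 + (f v)\<^sup>2))"
    by (intro sum_mono mult_left_mono sum_squares_bound)
      (auto simp: nb_def less_imp_le m_pos)
  also have "\<dots> = inn f f + inn f f"
    unfolding distrib_left sum.distrib using sq sq' by simp
  finally show ?thesis by simp
qed

definition one :: "'a \<Rightarrow> real" where "one v = (if v \<in> nb \<tau> then 1 else 0)"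

lemma walk_one: "walk one = one"
proof
  fix v
  show "walk one v = one v"
  proof (cases "v \<in> nb \<tau>")
    case True
    have "walk one v = (\<Sum>u\<in>nb (insert v \<tau>). m (insert u (insert v \<tau>)) / lw v)"
      unfolding walk_apply using True nb_sym[OF True] by (auto simp: one_def intro!: sum.cong)
    also have "\<dots> = 1"
      using link_vertex_weight[OF True] w_pos[OF True] by (simp flip: sum_divide_distrib)
    finally show ?thesis using True by (simp add: one_def)
  qed (simp add: walk_apply one_def)
qed

text \<open>A link of a face of codimension at least two in a pure complex contains an edge, so the spectrum of its
walk has a second entry; through \<open>walk_gap\<close> this forces \<open>lam \<ge> 0\<close>.\<close>

lemma two_vertices: obtains a b where "a \<in> nb \<tau>" "b \<in> nb \<tau>" "a \<noteq> b"
proof -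
  obtain \<sigma> where s: "\<sigma> \<in> faces X (int n)" "\<tau> \<subseteq> \<sigma>" using pure tau(1) by (auto simp: pure_complex_def)
  have fin: "finite \<sigma>" and c: "card \<sigma> = n + 1" and X: "\<sigma> \<in> X"
    using s finite_simplex by (auto simp: faces_def)
  have "card (\<sigma> - \<tau>) \<ge> 2"
    using c tau n_pos fin s by (simp add: card_Diff_subset finite_subset)
  then obtain a b where "a \<in> \<sigma> - \<tau>" "b \<in> \<sigma> - \<tau>" "a \<noteq> b"
    by (meson card_2_iff' obtain_subset_with_card_n subsetD)
  moreover have "v \<in> nb \<tau>" if "v \<in> \<sigma> - \<tau>" for v
    using that face_closed[OF X, of "insert v \<tau>"] s(2) by (auto simp: nb_def)
  ultimately show ?thesis using that by blast
qed

lemma spectrum: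
  "sorted_wrt (\<ge>) (walk_spectrum (link X \<tau>) (link_weight m \<tau>))"
  "count_list (walk_spectrum (link X \<tau>) (link_weight m \<tau>)) \<mu> = fun_vs.dim (eigenspace walk \<mu>)"
proof -
  have "walk_eigenspace (link X \<tau>) (link_weight m \<tau>) \<mu> = eigenspace walk \<mu>" for \<mu>
    by (auto simp: walk_eigenspace_def supported_def link_vertices)
  then have eq: "walk_spectrum (link X \<tau>) (link_weight m \<tau>)
     = (THE xs. sorted_wrt (\<ge>) xs \<and> (\<forall>\<mu>. count_list xs \<mu> = fun_vs.dim (eigenspace walk \<mu>)))"
    by (simp add: walk_spectrum_def)
  show "sorted_wrt (\<ge>) (walk_spectrum (link X \<tau>) (link_weight m \<tau>))"
    "count_list (walk_spectrum (link X \<tau>) (link_weight m \<tau>)) \<mu> = fun_vs.dim (eigenspace walk \<mu>)"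
    using theI'[OF ex1_spectrum_list[OF walk_symmetric], folded eq] by (rule conjunct1, simp)
qed

lemma walk_gap:
  assumes lo: "- lam \<le> smallest_eigenvalue (link X \<tau>) (link_weight m \<tau>)"
    and hi: "second_eigenvalue (link X \<tau>) (link_weight m \<tau>) \<le> lam"
  shows "f \<in> Fun \<Longrightarrow> inn f one = 0 \<Longrightarrow> \<bar>inn (walk f) f\<bar> \<le> lam * inn f f" "lam \<ge> 0"
proof -
  obtain a b where ab: "a \<in> nb \<tau>" "b \<in> nb \<tau>" "a \<noteq> b" by (rule two_vertices)
  have "one \<in> Fun" "one \<noteq> 0" using ab by (auto simp: one_def supported_def fun_eq_iff)
  note gap = spectral_gap_bounds[OF walk_symmetric this(1) walk_one this(2) walk_contraction spectrum]
  show bound: "\<bar>inn (walk f) f\<bar> \<le> lam * inn f f" if f: "f \<in> Fun" "inn f one = 0" for f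
  proof -
    have "second_eigenvalue (link X \<tau>) (link_weight m \<tau>) * inn f f \<le> lam * inn f f"
      "- lam * inn f f \<le> smallest_eigenvalue (link X \<tau>) (link_weight m \<tau>) * inn f f"
      using mult_right_mono[OF lo inn_ge_0] mult_right_mono[OF hi inn_ge_0] by blast+
    then show ?thesis using gap[OF f] by (simp add: second_eigenvalue_def smallest_eigenvalue_def)
  qed
  (* A nonzero function orthogonal to the constants: the absolute value of its form is at most lam times its squared norm. *)
  define f where "f v = (if v = a then 1 / lw a else if v = b then - 1 / lw b else 0)" for v
  have "inn f one = (\<Sum>v\<in>nb \<tau>. (if v = a then 1 else 0) + (if v = b then - 1 else 0))"
    unfolding ip_def using ab w_pos[OF ab(1)] w_pos[OF ab(2)]
    by (intro sum.cong) (auto simp: f_def one_def)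
  also have "\<dots> = 0" using ab by (simp add: sum.distrib finite_nb)
  finally have "inn f one = 0" .
  moreover have f: "f \<in> Fun" using ab by (auto simp: f_def supported_def)
  ultimately have "0 \<le> lam * inn f f" using bound[of f] by linarith
  moreover have "f a \<noteq> 0" using w_pos[OF ab(1)] by (simp add: f_def)
  then have "f \<noteq> 0" by auto
  then have "inn f f > 0" using inn_pos[OF f] by blast
  ultimately show "lam \<ge> 0" by (simp add: zero_le_mult_iff)
qed

lemma inn_one: "inn f one = (\<Sum>v\<in>nb \<tau>. lw v * f v)" "inn one one = m \<tau>"
  using weight_sum[OF tau(1)] tau(2) by (simp_all add: ip_def one_def lw_def)

text \<open>The subtracted term is the squared norm of the component of \<open>f\<close> along the constants, which the walk
fixes; on the remaining component the spectral gap applies.\<close>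

lemma walk_deviation:
  assumes lo: "- lam \<le> smallest_eigenvalue (link X \<tau>) (link_weight m \<tau>)"
    and hi: "second_eigenvalue (link X \<tau>) (link_weight m \<tau>) \<le> lam" and f: "f \<in> Fun"
  shows "\<bar>inn (walk f) f - (inn f one)\<^sup>2 / m \<tau>\<bar> \<le> lam * inn f f"
proof -
  define a where "a = inn f one / m \<tau>"
  define g where "g = f - fun_scale a one"
  note D = symmetric_onD[OF walk_symmetric]
  have mt: "m \<tau> > 0" using m_pos tau by blast
  have oneF: "one \<in> Fun" by (simp add: one_def supported_def)
  have gF: "g \<in> Fun"
    unfolding g_def by (intro fun_vs.subspace_diff[OF D(5)] fun_vs.subspace_scale[OF D(5)] f oneF)
  have g1: "inn g one = 0" using mt by (simp add: g_def ip_simps inn_one(2) a_def)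
  have fg: "f = g + fun_scale a one" by (simp add: g_def)
  have "inn (walk g) one = 0" using D(8)[OF gF oneF] g1 by (simp add: walk_one)
  then have 1: "inn (walk f) f = inn (walk g) g + a\<^sup>2 * m \<tau>"
    using g1 by (simp add: fg D(1,3) walk_one ip_simps inn_one(2) ip_commute[of _ _ one g] power2_eq_square)
  have "inn f f = inn g g + a\<^sup>2 * m \<tau>"
    using g1 by (simp add: fg ip_simps inn_one(2) ip_commute[of _ _ one g] power2_eq_square)
  then have "inn g g \<le> inn f f" using mt by simp
  then have "lam * inn g g \<le> lam * inn f f" using walk_gap(2)[OF lo hi] by (intro mult_left_mono)
  moreover have "\<bar>inn (walk g) g\<bar> \<le> lam * inn g g" by (rule walk_gap(1)[OF lo hi gF g1])
  moreover have "a\<^sup>2 * m \<tau> = (inn f one)\<^sup>2 / m \<tau>" using mt by (simp add: a_def power_divide power2_eq_square)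
  ultimately show ?thesis using 1 by linarith
qed

end

section \<open>The upper walk, the adjoint differential and localization\<close>

context weighted_complex
begin

definition total :: "nat \<Rightarrow> ('a set \<Rightarrow> real) \<Rightarrow> real" where
  "total k \<phi> = (\<Sum>\<sigma>\<in>fc (Suc k). m \<sigma> * \<phi> \<sigma>)"

text \<open>The explicit adjoint of the differential.\<close>

definition codiff :: "nat \<Rightarrow> ('a set \<Rightarrow> real) \<Rightarrow> ('a set \<Rightarrow> real)" where
  "codiff k \<psi> \<tau> = (if \<tau> \<in> fc (Suc k) then (\<Sum>u\<in>nb \<tau>. m (insert u \<tau>) * \<psi> (insert u \<tau>)) / m \<tau> else 0)"

text \<open>$d_k^* d_k$, which is \<open>k + 2\<close> times the upper random walk.\<close>

definition laplacian :: "nat \<Rightarrow> ('a set \<Rightarrow> real) \<Rightarrow> ('a set \<Rightarrow> real)" where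
  "laplacian k \<phi> = codiff k (sdiff X k \<phi>)"

abbreviation "coch k \<equiv> supported (fc (Suc k))"
abbreviation "cip k \<equiv> ip (fc (Suc k)) m"
abbreviation "cnm k \<equiv> nm (fc (Suc k)) m"

lemma cochains_eq: "cochains X k = coch k"
  by (simp add: cochains_def supported_def faces_eq)

lemma cinner_eq: "cinner X m k = cip k"
  by (simp add: cinner_def ip_def faces_eq fun_eq_iff)

lemma cnorm_eq: "cnorm X m k = cnm k"
  by (simp add: cnorm_def nm_def cinner_eq fun_eq_iff)

lemma cochains0_eq: "cochains0 X m k = {\<phi> \<in> coch k. total k \<phi> = 0}"
  by (simp add: cochains0_def cochains_eq total_def faces_eq)

lemma sdiff_apply: "sdiff X k \<phi> \<sigma> = (if \<sigma> \<in> fc (Suc (Suc k)) then \<Sum>x\<in>\<sigma>. \<phi> (\<sigma> - {x}) else 0)"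
  by (simp add: sdiff_def faces_eq sum_facets)

lemma sdiff_linear: "module_hom fun_scale fun_scale (sdiff X k)"
  by unfold_locales (auto simp: fun_eq_iff sdiff_apply fun_scale_def sum.distrib sum_distrib_left)

lemma codiff_linear: "module_hom fun_scale fun_scale (codiff k)"
  by unfold_locales
    (auto simp: fun_eq_iff codiff_def fun_scale_def sum.distrib sum_distrib_left distrib_left
      add_divide_distrib mult.left_commute)

lemmas sdiff_lin = module_hom.add[OF sdiff_linear] module_hom.diff[OF sdiff_linear]
  module_hom.scale[OF sdiff_linear] module_hom.zero[OF sdiff_linear]
lemmas codiff_lin = module_hom.add[OF codiff_linear] module_hom.diff[OF codiff_linear]
  module_hom.scale[OF codiff_linear] module_hom.zero[OF codiff_linear]

lemma sdiff_coch: "sdiff X k \<phi> \<in> coch (Suc k)"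
  by (simp add: supported_def sdiff_apply)

lemma codiff_coch: "codiff k \<psi> \<in> coch k"
  by (simp add: supported_def codiff_def)

lemma m_codiff:
  assumes "\<tau> \<in> fc (Suc k)"
  shows "m \<tau> * codiff k \<psi> \<tau> = (\<Sum>u\<in>nb \<tau>. m (insert u \<tau>) * \<psi> (insert u \<tau>))"
proof -
  have "m \<tau> > 0" using assms m_pos by (simp add: fc_def)
  then show ?thesis using assms by (simp add: codiff_def)
qed

lemma sdiff_adjoint: "cip (Suc k) (sdiff X k \<phi>) \<psi> = cip k \<phi> (codiff k \<psi>)"
proof -
  have "cip (Suc k) (sdiff X k \<phi>) \<psi> = (\<Sum>\<sigma>\<in>fc (Suc (Suc k)). \<Sum>x\<in>\<sigma>. m \<sigma> * \<phi> (\<sigma> - {x}) * \<psi> \<sigma>)"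
    by (simp add: ip_def sdiff_apply sum_distrib_left sum_distrib_right)
  also have "\<dots> = (\<Sum>\<tau>\<in>fc (Suc k). \<Sum>u\<in>nb \<tau>. m (insert u \<tau>) * \<phi> \<tau> * \<psi> (insert u \<tau>))"
    unfolding sum_flags by (intro sum.cong refl) (simp add: nb_def)
  also have "\<dots> = cip k \<phi> (codiff k \<psi>)"
    unfolding ip_def
  proof (rule sum.cong[OF refl])
    fix \<tau> assume "\<tau> \<in> fc (Suc k)"
    then have "\<phi> \<tau> * (m \<tau> * codiff k \<psi> \<tau>) = \<phi> \<tau> * (\<Sum>u\<in>nb \<tau>. m (insert u \<tau>) * \<psi> (insert u \<tau>))"
      by (simp only: m_codiff)
    then show "(\<Sum>u\<in>nb \<tau>. m (insert u \<tau>) * \<phi> \<tau> * \<psi> (insert u \<tau>)) = m \<tau> * \<phi> \<tau> * codiff k \<psi> \<tau>"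
      by (simp add: sum_distrib_left mult_ac)
  qed
  finally show ?thesis .
qed

lemma sdiff_adj_eq: "sdiff_adj X m k \<psi> = codiff k \<psi>"
  unfolding sdiff_adj_def cinner_eq cochains_eq
proof (rule the_equality)
  show "codiff k \<psi> \<in> coch k \<and> (\<forall>\<phi>\<in>coch k. cip (k + 1) (sdiff X k \<phi>) \<psi> = cip k \<phi> (codiff k \<psi>))"
    using codiff_coch sdiff_adjoint by simp
  fix \<rho> assume r: "\<rho> \<in> coch k \<and> (\<forall>\<phi>\<in>coch k. cip (k + 1) (sdiff X k \<phi>) \<psi> = cip k \<phi> \<rho>)"
  have d: "\<rho> - codiff k \<psi> \<in> coch k"
    using r codiff_coch fun_vs.subspace_diff[OF subspace_supported] by blast
  then have "cip k (\<rho> - codiff k \<psi>) (codiff k \<psi>) = cip k (\<rho> - codiff k \<psi>) \<rho>"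
    using r sdiff_adjoint[of k "\<rho> - codiff k \<psi>" \<psi>] by simp
  then have "cip k (\<rho> - codiff k \<psi>) (\<rho> - codiff k \<psi>) = 0"
    by (simp add: ip_diff_right)
  then have "\<rho> - codiff k \<psi> = 0" using fc.inn_eq_0D d by blast
  then show "\<rho> = codiff k \<psi>" by simp
qed

lemma total_sdiff:
  assumes "k \<le> n - 1"
  shows "total (Suc k) (sdiff X k \<phi>) = total k \<phi>"
proof -
  have "total (Suc k) (sdiff X k \<phi>) = (\<Sum>\<sigma>\<in>fc (Suc (Suc k)). \<Sum>x\<in>\<sigma>. m \<sigma> * \<phi> (\<sigma> - {x}))"
    by (simp add: total_def sdiff_apply sum_distrib_left)
  also have "\<dots> = (\<Sum>\<tau>\<in>fc (Suc k). \<Sum>u\<in>nb \<tau>. m (insert u \<tau>) * \<phi> \<tau>)"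
    unfolding sum_flags by (intro sum.cong refl) (simp add: nb_def)
  also have "\<dots> = total k \<phi>"
    unfolding total_def
  proof (rule sum.cong[OF refl])
    fix \<tau> assume "\<tau> \<in> fc (Suc k)"
    then have "m \<tau> = (\<Sum>u\<in>nb \<tau>. m (insert u \<tau>))"
      using assms n_pos by (intro weight_sum) (auto simp: fc_def)
    then show "(\<Sum>u\<in>nb \<tau>. m (insert u \<tau>) * \<phi> \<tau>) = m \<tau> * \<phi> \<tau>" by (simp add: sum_distrib_right)
  qed
  finally show ?thesis .
qed

lemma sum_flags_const:
  "(\<Sum>\<tau>\<in>fc p. \<Sum>u\<in>nb \<tau>. g (insert u \<tau>)) = real (Suc p) * (\<Sum>\<sigma>\<in>fc (Suc p). g \<sigma>)"
proof -
  have "(\<Sum>\<tau>\<in>fc p. \<Sum>u\<in>nb \<tau>. g (insert u \<tau>)) = (\<Sum>\<sigma>\<in>fc (Suc p). \<Sum>x\<in>\<sigma>. g \<sigma>)"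
    by (rule sum_flags[symmetric])
  also have "\<dots> = (\<Sum>\<sigma>\<in>fc (Suc p). real (Suc p) * g \<sigma>)"
    by (intro sum.cong refl) (simp add: fc_def)
  finally show ?thesis by (simp only: sum_distrib_left)
qed

lemma total_codiff: "total k (codiff k \<psi>) = real (k + 2) * total (Suc k) \<psi>"
proof -
  have "total k (codiff k \<psi>) = (\<Sum>\<tau>\<in>fc (Suc k). \<Sum>u\<in>nb \<tau>. m (insert u \<tau>) * \<psi> (insert u \<tau>))"
    unfolding total_def by (rule sum.cong[OF refl m_codiff])
  then show ?thesis by (simp add: sum_flags_const[of "\<lambda>\<sigma>. m \<sigma> * \<psi> \<sigma>"] total_def)
qed

lemma laplacian_symmetric: "symmetric_on (fc (Suc k)) m (coch k) (laplacian k)"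
  unfolding symmetric_on_def
proof (intro conjI ballI)
  show "module_hom fun_scale fun_scale (laplacian k)"
    by unfold_locales (simp_all add: laplacian_def sdiff_lin codiff_lin)
  show "cip k (laplacian k f) g = cip k f (laplacian k g)" for f g
    unfolding laplacian_def using sdiff_adjoint[of k f "sdiff X k g"] sdiff_adjoint[of k g "sdiff X k f"]
    by (simp add: ip_commute)
qed (auto simp: subspace_supported laplacian_def codiff_coch)

lemma cochains0_subspace: "fun_vs.subspace (cochains0 X m k)"
proof -
  have "total k (f + g) = total k f + total k g" "total k (fun_scale c f) = c * total k f" "total k 0 = 0" for f g c
    by (simp_all add: total_def distrib_left sum.distrib fun_scale_def sum_distrib_left mult.left_commute)
  then show ?thesis
    using subspace_supported[of "fc (Suc k)"] unfolding cochains0_eq fun_vs.subspace_def by auto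
qed

lemma laplacian_symmetric0:
  assumes "k \<le> n - 1"
  shows "symmetric_on (fc (Suc k)) m (cochains0 X m k) (laplacian k)"
  by (rule symmetric_on_subspace[OF laplacian_symmetric cochains0_subspace])
    (auto simp: cochains0_eq laplacian_def codiff_coch total_codiff total_sdiff[OF assms])

lemma laplacian_form: "cip k (laplacian k \<phi>) \<phi> = (cnm (Suc k) (sdiff X k \<phi>))\<^sup>2"
  using sdiff_adjoint[of k \<phi> "sdiff X k \<phi>"] by (simp add: fc.nrm_sq laplacian_def ip_commute)

text \<open>For a neighbour \<open>\<tau>' \<noteq> \<tau>\<close> in the walk the only face that contains both and has one more vertex is \<open>\<tau> \<union> \<tau>'\<close>; for \<open>\<tau>' = \<tau>\<close>
all cofaces contribute, and their weights add up to \<open>m \<tau>\<close>.\<close>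

lemma upper_walk_eq:
  assumes k: "k \<le> n - 1" and phi: "\<phi> \<in> coch k"
  shows "fun_scale (real k + 2) (upper_walk X m k \<phi>) = laplacian k \<phi>"
proof
  fix \<tau>
  show "fun_scale (real k + 2) (upper_walk X m k \<phi>) \<tau> = laplacian k \<phi> \<tau>"
  proof (cases "\<tau> \<in> fc (Suc k)")
    case False
    then show ?thesis by (simp add: fun_scale_def upper_walk_def faces_eq laplacian_def codiff_def)
  next
    case True
    then have tX: "\<tau> \<in> X" and ct: "card \<tau> = Suc k" and ft: "finite \<tau>" and mt: "m \<tau> > 0"
      using finite_simplex m_pos by (auto simp: fc_def)
    have "real k + 2 \<noteq> 0" by linarith
    define K where "K \<tau>' = (if \<tau> = \<tau>' then m \<tau> else if \<tau> \<union> \<tau>' \<in> fc (Suc (Suc k)) then m (\<tau> \<union> \<tau>') else 0)" for \<tau>'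
    have "m \<tau> * ((real k + 2) * (upper_walk_kernel X m k \<tau> \<tau>' * \<phi> \<tau>')) = K \<tau>' * \<phi> \<tau>'" for \<tau>'
      using mt \<open>real k + 2 \<noteq> 0\<close> by (simp add: upper_walk_kernel_def faces_eq K_def)
    then have "(\<Sum>\<tau>'\<in>fc (Suc k). m \<tau> * ((real k + 2) * (upper_walk_kernel X m k \<tau> \<tau>' * \<phi> \<tau>')))
        = (\<Sum>\<tau>'\<in>fc (Suc k). K \<tau>' * \<phi> \<tau>')"
      by (simp only:)
    then have 1: "m \<tau> * fun_scale (real k + 2) (upper_walk X m k \<phi>) \<tau> = (\<Sum>\<tau>'\<in>fc (Suc k). K \<tau>' * \<phi> \<tau>')"
      using True by (simp add: fun_scale_def upper_walk_def faces_eq sum_distrib_left)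
    have "m \<tau> * laplacian k \<phi> \<tau> = (\<Sum>u\<in>nb \<tau>. m (insert u \<tau>) * sdiff X k \<phi> (insert u \<tau>))"
      using True mt by (simp add: laplacian_def codiff_def)
    also have "\<dots> = (\<Sum>u\<in>nb \<tau>. \<Sum>\<tau>'\<in>fc (Suc k). if \<tau>' \<subset> insert u \<tau> then m (insert u \<tau>) * \<phi> \<tau>' else 0)"
    proof (rule sum.cong[OF refl])
      fix u assume "u \<in> nb \<tau>"
      then have "insert u \<tau> \<in> fc (Suc (Suc k))" using ct ft by (simp add: nb_def fc_def)
      then have "m (insert u \<tau>) * sdiff X k \<phi> (insert u \<tau>)
          = (\<Sum>\<tau>' | \<tau>' \<in> fc (Suc k) \<and> \<tau>' \<subset> insert u \<tau>. m (insert u \<tau>) * \<phi> \<tau>')"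
        by (simp add: sdiff_def faces_eq sum_distrib_left)
      also have "\<dots> = (\<Sum>\<tau>'\<in>fc (Suc k). if \<tau>' \<subset> insert u \<tau> then m (insert u \<tau>) * \<phi> \<tau>' else 0)"
        by (simp only: sum.inter_filter[OF finite_fc])
      finally show "m (insert u \<tau>) * sdiff X k \<phi> (insert u \<tau>) = \<dots>" .
    qed
    also have "\<dots> = (\<Sum>\<tau>'\<in>fc (Suc k). \<Sum>u\<in>nb \<tau>. if \<tau>' \<subset> insert u \<tau> then m (insert u \<tau>) * \<phi> \<tau>' else 0)"
      by (rule sum.swap)
    also have "\<dots> = (\<Sum>\<tau>'\<in>fc (Suc k). K \<tau>' * \<phi> \<tau>')"
    proof (rule sum.cong[OF refl])
      fix \<tau>' assume t': "\<tau>' \<in> fc (Suc k)"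
      then have ct': "card \<tau>' = Suc k" and ft': "finite \<tau>'" using finite_simplex by (auto simp: fc_def)
      have "(\<Sum>u\<in>nb \<tau>. if \<tau>' \<subset> insert u \<tau> then m (insert u \<tau>) else 0) = K \<tau>'"
      proof (cases "\<tau>' = \<tau>")
        case True
        have "(\<Sum>u\<in>nb \<tau>. if \<tau> \<subset> insert u \<tau> then m (insert u \<tau>) else 0) = (\<Sum>u\<in>nb \<tau>. m (insert u \<tau>))"
          by (intro sum.cong) (auto simp: nb_def)
        also have "\<dots> = m \<tau>" using weight_sum[OF tX] ct k n_pos by simp
        finally show ?thesis using True by (simp add: K_def)
      next
        case False
        then have "\<not> \<tau>' \<subseteq> \<tau>" using card_subset_eq[OF ft] ct ct' by auto
        then obtain v where v: "v \<in> \<tau>'" "v \<notin> \<tau>" by blast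
        have iff: "\<tau>' \<subset> insert u \<tau> \<longleftrightarrow> u = v \<and> \<tau> \<union> \<tau>' = insert v \<tau>" if "u \<in> nb \<tau>" for u
        proof
          assume s: "\<tau>' \<subset> insert u \<tau>"
          then show "u = v \<and> \<tau> \<union> \<tau>' = insert v \<tau>" using v by auto
        next
          assume s: "u = v \<and> \<tau> \<union> \<tau>' = insert v \<tau>"
          then have "\<tau>' \<subseteq> insert u \<tau>" by blast
          moreover have "card (insert u \<tau>) = Suc (Suc k)" using s v ft ct by simp
          then have "\<tau>' \<noteq> insert u \<tau>" using ct' by auto
          ultimately show "\<tau>' \<subset> insert u \<tau>" by blast
        qed
        have upper: "v \<in> nb \<tau> \<and> \<tau> \<union> \<tau>' = insert v \<tau> \<longleftrightarrow> \<tau> \<union> \<tau>' \<in> fc (Suc (Suc k))"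
        proof
          assume "v \<in> nb \<tau> \<and> \<tau> \<union> \<tau>' = insert v \<tau>"
          then show "\<tau> \<union> \<tau>' \<in> fc (Suc (Suc k))" using ft ct by (auto simp: nb_def fc_def)
        next
          assume u: "\<tau> \<union> \<tau>' \<in> fc (Suc (Suc k))"
          have "insert v \<tau> = \<tau> \<union> \<tau>'"
            by (rule card_subset_eq) (use u v ft ft' ct in \<open>auto simp: fc_def\<close>)
          then show "v \<in> nb \<tau> \<and> \<tau> \<union> \<tau>' = insert v \<tau>" using u v by (auto simp: nb_def fc_def)
        qed
        have "(\<Sum>u\<in>nb \<tau>. if \<tau>' \<subset> insert u \<tau> then m (insert u \<tau>) else 0)
            = (\<Sum>u\<in>nb \<tau>. if u = v then (if \<tau> \<union> \<tau>' = insert v \<tau> then m (insert v \<tau>) else 0) else 0)"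
          using iff by (intro sum.cong refl) auto
        also have "\<dots> = (if v \<in> nb \<tau> \<and> \<tau> \<union> \<tau>' = insert v \<tau> then m (insert v \<tau>) else 0)"
          by (simp add: finite_nb)
        also have "\<dots> = (if \<tau> \<union> \<tau>' \<in> fc (Suc (Suc k)) then m (\<tau> \<union> \<tau>') else 0)"
          by (rule if_cong[OF upper]) (use upper in auto)
        finally show ?thesis using False by (simp add: K_def)
      qed
      moreover have "(\<Sum>u\<in>nb \<tau>. if \<tau>' \<subset> insert u \<tau> then m (insert u \<tau>) * \<phi> \<tau>' else 0)
          = (\<Sum>u\<in>nb \<tau>. if \<tau>' \<subset> insert u \<tau> then m (insert u \<tau>) else 0) * \<phi> \<tau>'"
        unfolding sum_distrib_right by (intro sum.cong refl) auto
      ultimately show "(\<Sum>u\<in>nb \<tau>. if \<tau>' \<subset> insert u \<tau> then m (insert u \<tau>) * \<phi> \<tau>' else 0) = K \<tau>' * \<phi> \<tau>'"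
        by simp
    qed
    finally have "m \<tau> * laplacian k \<phi> \<tau> = m \<tau> * fun_scale (real k + 2) (upper_walk X m k \<phi>) \<tau>" using 1 by simp
    then show ?thesis using mt by simp
  qed
qed

text \<open>The restriction of a cochain to the faces that contain \<open>\<tau>\<close>, read as a function on the vertices of
the link.\<close>

definition localize :: "('a set \<Rightarrow> real) \<Rightarrow> 'a set \<Rightarrow> 'a \<Rightarrow> real" where
  "localize \<phi> \<tau> v = (if v \<in> nb \<tau> then \<phi> (insert v \<tau>) else 0)"

abbreviation "lweight \<tau> \<equiv> (\<lambda>v. m (insert v \<tau>))"

lemma localize_norm:
  "(\<Sum>\<tau>\<in>fc k. ip (nb \<tau>) (lweight \<tau>) (localize \<phi> \<tau>) (localize \<phi> \<tau>)) = real (Suc k) * cip k \<phi> \<phi>"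
proof -
  have "(\<Sum>\<tau>\<in>fc k. ip (nb \<tau>) (lweight \<tau>) (localize \<phi> \<tau>) (localize \<phi> \<tau>))
      = (\<Sum>\<tau>\<in>fc k. \<Sum>u\<in>nb \<tau>. m (insert u \<tau>) * \<phi> (insert u \<tau>) * \<phi> (insert u \<tau>))"
    by (simp add: ip_def localize_def)
  then show ?thesis by (simp only: sum_flags_const[of "\<lambda>\<sigma>. m \<sigma> * \<phi> \<sigma> * \<phi> \<sigma>"] ip_def)
qed

text \<open>Expand the square of \<open>d \<phi> \<sigma> = (\<Sum>x\<in>\<sigma>. \<phi> (\<sigma> - {x}))\<close>. The diagonal terms add up to the squared norm of \<open>\<phi>\<close>. The
term of \<open>x \<noteq> y\<close> couples two faces that differ by an edge of the link of \<open>\<tau> = \<sigma> - {x, y}\<close>.\<close>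

lemma localize_walk:
  assumes k: "k \<le> n - 1"
  shows "cip k (laplacian k \<phi>) \<phi> - cip k \<phi> \<phi> =
    (\<Sum>\<tau>\<in>fc k. ip (nb \<tau>) (lweight \<tau>) (nonlazy_walk (link X \<tau>) (link_weight m \<tau>) (localize \<phi> \<tau>)) (localize \<phi> \<tau>))"
proof -
  have "cip k (laplacian k \<phi>) \<phi> = (\<Sum>\<sigma>\<in>fc (Suc (Suc k)). m \<sigma> * (\<Sum>x\<in>\<sigma>. \<phi> (\<sigma> - {x})) * (\<Sum>y\<in>\<sigma>. \<phi> (\<sigma> - {y})))"
    unfolding laplacian_form fc.nrm_sq by (simp add: ip_def sdiff_apply)
  also have "\<dots> = (\<Sum>\<sigma>\<in>fc (Suc (Suc k)). \<Sum>x\<in>\<sigma>. m \<sigma> * \<phi> (\<sigma> - {x}) * (\<phi> (\<sigma> - {x}) + (\<Sum>y\<in>\<sigma> - {x}. \<phi> (\<sigma> - {y}))))"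
  proof (rule sum.cong[OF refl])
    fix \<sigma> assume "\<sigma> \<in> fc (Suc (Suc k))"
    then have fin: "finite \<sigma>" by (rule finite_faces_below)
    have "m \<sigma> * (\<Sum>x\<in>\<sigma>. \<phi> (\<sigma> - {x})) * s = (\<Sum>x\<in>\<sigma>. m \<sigma> * \<phi> (\<sigma> - {x}) * s)" for s
      by (simp add: sum_distrib_left sum_distrib_right)
    then have "m \<sigma> * (\<Sum>x\<in>\<sigma>. \<phi> (\<sigma> - {x})) * (\<Sum>y\<in>\<sigma>. \<phi> (\<sigma> - {y}))
        = (\<Sum>x\<in>\<sigma>. m \<sigma> * \<phi> (\<sigma> - {x}) * (\<Sum>y\<in>\<sigma>. \<phi> (\<sigma> - {y})))" .
    also have "\<dots> = (\<Sum>x\<in>\<sigma>. m \<sigma> * \<phi> (\<sigma> - {x}) * (\<phi> (\<sigma> - {x}) + (\<Sum>y\<in>\<sigma> - {x}. \<phi> (\<sigma> - {y}))))"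
      by (intro sum.cong refl) (simp add: sum.remove[OF fin])
    finally show "m \<sigma> * (\<Sum>x\<in>\<sigma>. \<phi> (\<sigma> - {x})) * (\<Sum>y\<in>\<sigma>. \<phi> (\<sigma> - {y})) = \<dots>" .
  qed
  also have "\<dots> = (\<Sum>\<rho>\<in>fc (Suc k). \<Sum>u\<in>nb \<rho>. m (insert u \<rho>) * \<phi> \<rho> * (\<phi> \<rho> + (\<Sum>y\<in>\<rho>. \<phi> (insert u \<rho> - {y}))))"
    unfolding sum_flags by (intro sum.cong refl) (simp add: nb_def)
  also have "\<dots> = (\<Sum>\<rho>\<in>fc (Suc k). \<Sum>u\<in>nb \<rho>. m (insert u \<rho>) * \<phi> \<rho> * \<phi> \<rho>)
      + (\<Sum>\<rho>\<in>fc (Suc k). \<Sum>u\<in>nb \<rho>. \<Sum>y\<in>\<rho>. m (insert u \<rho>) * \<phi> \<rho> * \<phi> (insert u \<rho> - {y}))"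
    by (simp only: distrib_left sum.distrib sum_distrib_left)
  also have "(\<Sum>\<rho>\<in>fc (Suc k). \<Sum>u\<in>nb \<rho>. m (insert u \<rho>) * \<phi> \<rho> * \<phi> \<rho>) = cip k \<phi> \<phi>"
    unfolding ip_def
  proof (rule sum.cong[OF refl])
    fix \<tau> assume "\<tau> \<in> fc (Suc k)"
    then have "m \<tau> = (\<Sum>u\<in>nb \<tau>. m (insert u \<tau>))"
      using k n_pos by (intro weight_sum) (auto simp: fc_def)
    then show "(\<Sum>u\<in>nb \<tau>. m (insert u \<tau>) * \<phi> \<tau> * \<phi> \<tau>) = m \<tau> * \<phi> \<tau> * \<phi> \<tau>" by (simp add: sum_distrib_right)
  qed
  also have "(\<Sum>\<rho>\<in>fc (Suc k). \<Sum>u\<in>nb \<rho>. \<Sum>y\<in>\<rho>. m (insert u \<rho>) * \<phi> \<rho> * \<phi> (insert u \<rho> - {y}))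
      = (\<Sum>\<rho>\<in>fc (Suc k). \<Sum>y\<in>\<rho>. \<Sum>u\<in>nb \<rho>. m (insert u \<rho>) * \<phi> \<rho> * \<phi> (insert u \<rho> - {y}))"
    by (intro sum.cong refl sum.swap)
  also have "\<dots> = (\<Sum>\<tau>\<in>fc k. \<Sum>v\<in>nb \<tau>. \<Sum>u\<in>nb (insert v \<tau>).
      m (insert u (insert v \<tau>)) * (localize \<phi> \<tau> u * localize \<phi> \<tau> v))"
    unfolding sum_flags
  proof (intro sum.cong refl)
    fix \<tau> v u assume t: "\<tau> \<in> fc k" and v: "v \<in> nb \<tau>" and u: "u \<in> nb (insert v \<tau>)"
    have "insert u (insert v \<tau>) - {v} = insert u \<tau>" using u v by (auto simp: nb_def)
    then show "m (insert u (insert v \<tau>)) * \<phi> (insert v \<tau>) * \<phi> (insert u (insert v \<tau>) - {v})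
        = m (insert u (insert v \<tau>)) * (localize \<phi> \<tau> u * localize \<phi> \<tau> v)"
      using v nb_sym[OF v u] by (simp add: localize_def)
  qed
  also have "\<dots> = (\<Sum>\<tau>\<in>fc k. ip (nb \<tau>) (lweight \<tau>)
      (nonlazy_walk (link X \<tau>) (link_weight m \<tau>) (localize \<phi> \<tau>)) (localize \<phi> \<tau>))"
  proof (rule sum.cong[OF refl])
    fix \<tau> assume t: "\<tau> \<in> fc k"
    interpret lk: complex_link X n m \<tau>
      by unfold_locales (use t k in \<open>auto simp: fc_def\<close>)
    have "lk.lw = lweight \<tau>" by (simp add: fun_eq_iff lk.lw_def)
    then show "(\<Sum>v\<in>nb \<tau>. \<Sum>u\<in>nb (insert v \<tau>).
        m (insert u (insert v \<tau>)) * (localize \<phi> \<tau> u * localize \<phi> \<tau> v)) = ip (nb \<tau>) (lweight \<tau>)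
      (nonlazy_walk (link X \<tau>) (link_weight m \<tau>) (localize \<phi> \<tau>)) (localize \<phi> \<tau>)"
      using lk.inn_walk[of "localize \<phi> \<tau>" "localize \<phi> \<tau>"] by simp
  qed
  finally show ?thesis by simp
qed

lemma expander_lam_nonneg:
  assumes "two_sided_local_spectral_expander X n m lam"
  shows "lam \<ge> 0"
proof -
  interpret lk: complex_link X n m "{}"
    by unfold_locales (auto simp: empty_X)
  have "{} \<in> faces X (- 1)" using empty_X by (simp add: faces_def)
  moreover have "- 1 \<le> (- 1 :: int) \<and> - 1 \<le> int n - 2" using n_pos by simp
  ultimately show ?thesis
    using assms lk.walk_gap(2) unfolding two_sided_local_spectral_expander_def by blast
qed

text \<open>The sum of the deviations in the links; the squared norms of the localizations add up to \<open>k + 1\<close> times that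
of \<open>\<phi>\<close>, because a face with \<open>k + 1\<close> vertices appears as a vertex in that many links.\<close>

lemma laplacian_deviation:
  assumes X: "two_sided_local_spectral_expander X n m lam" and k: "k \<le> n - 1"
  shows "\<bar>cip k (laplacian k \<phi>) \<phi> - cip k \<phi> \<phi> - (\<Sum>\<tau>\<in>fc k. (\<Sum>v\<in>nb \<tau>. m (insert v \<tau>) * \<phi> (insert v \<tau>))\<^sup>2 / m \<tau>)\<bar>
    \<le> real (Suc k) * lam * cip k \<phi> \<phi>"
proof -
  have "\<bar>ip (nb \<tau>) (lweight \<tau>) (nonlazy_walk (link X \<tau>) (link_weight m \<tau>) (localize \<phi> \<tau>)) (localize \<phi> \<tau>)
      - (\<Sum>v\<in>nb \<tau>. m (insert v \<tau>) * \<phi> (insert v \<tau>))\<^sup>2 / m \<tau>\<bar>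
      \<le> lam * ip (nb \<tau>) (lweight \<tau>) (localize \<phi> \<tau>) (localize \<phi> \<tau>)" if t: "\<tau> \<in> fc k" for \<tau>
  proof -
    interpret lk: complex_link X n m \<tau>
      by unfold_locales (use t k in \<open>auto simp: fc_def\<close>)
    have lw: "lk.lw = lweight \<tau>" by (simp add: fun_eq_iff lk.lw_def)
    have "\<tau> \<in> faces X (int k - 1)" using t by (simp add: faces_eq)
    moreover have "- 1 \<le> int k - 1 \<and> int k - 1 \<le> int n - 2" using k n_pos by simp
    ultimately have "- lam \<le> smallest_eigenvalue (link X \<tau>) (link_weight m \<tau>)"
      "second_eigenvalue (link X \<tau>) (link_weight m \<tau>) \<le> lam"
      using X unfolding two_sided_local_spectral_expander_def by blast+
    moreover have "localize \<phi> \<tau> \<in> supported (nb \<tau>)" by (simp add: localize_def supported_def)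
    moreover have "ip (nb \<tau>) lk.lw (localize \<phi> \<tau>) lk.one = (\<Sum>v\<in>nb \<tau>. m (insert v \<tau>) * \<phi> (insert v \<tau>))"
      unfolding lk.inn_one by (simp add: lk.lw_def localize_def)
    ultimately show ?thesis using lk.walk_deviation[of lam "localize \<phi> \<tau>"] unfolding lw by simp
  qed
  then have "(\<Sum>\<tau>\<in>fc k. \<bar>ip (nb \<tau>) (lweight \<tau>) (nonlazy_walk (link X \<tau>) (link_weight m \<tau>) (localize \<phi> \<tau>)) (localize \<phi> \<tau>)
      - (\<Sum>v\<in>nb \<tau>. m (insert v \<tau>) * \<phi> (insert v \<tau>))\<^sup>2 / m \<tau>\<bar>)
      \<le> (\<Sum>\<tau>\<in>fc k. lam * ip (nb \<tau>) (lweight \<tau>) (localize \<phi> \<tau>) (localize \<phi> \<tau>))"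
    by (rule sum_mono)
  also have "\<dots> = real (Suc k) * lam * cip k \<phi> \<phi>"
    by (simp add: localize_norm mult_ac flip: sum_distrib_left)
  finally show ?thesis
    unfolding localize_walk[OF k] sum_subtractf[symmetric] by (rule order_trans[OF sum_abs])
qed

text \<open>The only link is that of the empty face, and the constant component that is subtracted in
\<open>laplacian_deviation\<close> is the total weight of \<open>\<phi>\<close>, which vanishes on $C_0^0$.\<close>

lemma deviation_norm_0:
  assumes X: "two_sided_local_spectral_expander X n m lam" and phi: "\<phi> \<in> cochains0 X m 0"
  shows "cnm 0 (laplacian 0 \<phi> - \<phi>) \<le> lam * cnm 0 \<phi>"
proof -
  have k: "0 \<le> n - 1" by simp
  note L = laplacian_symmetric0[OF k]
  note D = symmetric_onD[OF L]
  have "symmetric_on (fc (Suc 0)) m (cochains0 X m 0) (\<lambda>f. laplacian 0 f - f)"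
    unfolding symmetric_on_def
  proof (intro conjI ballI)
    show "module_hom fun_scale fun_scale (\<lambda>f. laplacian 0 f - f)"
      by unfold_locales (simp_all add: D(1,3) fun_vs.scale_right_diff_distrib)
    show "cip 0 (laplacian 0 f - f) g = cip 0 f (laplacian 0 g - g)"
      if "f \<in> cochains0 X m 0" "g \<in> cochains0 X m 0" for f g
      using D(8)[OF that] by (simp add: ip_simps)
  qed (use D fun_vs.subspace_diff[OF D(5)] in auto)
  then show ?thesis
  proof (rule fc.nrm_le_of_quadratic_form[OF _ _ phi])
    fix f assume f: "f \<in> cochains0 X m 0"
    have "(\<Sum>\<tau>\<in>fc 0. \<Sum>v\<in>nb \<tau>. m (insert v \<tau>) * f (insert v \<tau>)) = total 0 f"
      by (simp add: sum_flags_const[of "\<lambda>\<sigma>. m \<sigma> * f \<sigma>"] total_def)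
    moreover have "fc 0 = {{}}" using empty_X finite_simplex by (auto simp: fc_def)
    ultimately have "(\<Sum>v\<in>nb {}. m {v} * f {v}) = 0" using f by (simp add: cochains0_eq)
    then show "\<bar>cip 0 (laplacian 0 f - f) f\<bar> \<le> lam * cip 0 f f"
      using laplacian_deviation[OF X k, of f] \<open>fc 0 = {{}}\<close> by (simp add: ip_simps)
  qed
qed

lemma deviation_norm_Suc:
  assumes X: "two_sided_local_spectral_expander X n m lam" and k: "Suc k \<le> n - 1" and phi: "\<phi> \<in> coch (Suc k)"
  shows "cnm (Suc k) (laplacian (Suc k) \<phi> - \<phi> - sdiff X k (codiff k \<phi>)) \<le> real (k + 2) * lam * cnm (Suc k) \<phi>"
proof -
  note D = symmetric_onD[OF laplacian_symmetric[of "Suc k"]]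
  have "symmetric_on (fc (Suc (Suc k))) m (coch (Suc k)) (\<lambda>f. laplacian (Suc k) f - f - sdiff X k (codiff k f))"
    unfolding symmetric_on_def
  proof (intro conjI ballI)
    show "module_hom fun_scale fun_scale (\<lambda>f. laplacian (Suc k) f - f - sdiff X k (codiff k f))"
      by unfold_locales (simp_all add: D(1,3) fun_vs.scale_right_diff_distrib sdiff_lin codiff_lin)
    show "cip (Suc k) (laplacian (Suc k) f - f - sdiff X k (codiff k f)) g
        = cip (Suc k) f (laplacian (Suc k) g - g - sdiff X k (codiff k g))"
      if "f \<in> coch (Suc k)" "g \<in> coch (Suc k)" for f g
      using D(8)[OF that] sdiff_adjoint[of k "codiff k f" g] sdiff_adjoint[of k "codiff k g" f]
      by (simp add: ip_simps ip_commute[of _ _ f] ip_commute[of _ _ "codiff k f"])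
  qed (use D fun_vs.subspace_diff[OF D(5)] sdiff_coch in auto)
  then show ?thesis
  proof (rule fc.nrm_le_of_quadratic_form[OF _ _ phi])
    fix f assume f: "f \<in> coch (Suc k)"
    have "cip (Suc k) (sdiff X k (codiff k f)) f = cip k (codiff k f) (codiff k f)"
      by (rule sdiff_adjoint)
    also have "\<dots> = (\<Sum>\<tau>\<in>fc (Suc k). (\<Sum>v\<in>nb \<tau>. m (insert v \<tau>) * f (insert v \<tau>))\<^sup>2 / m \<tau>)"
      unfolding ip_def
    proof (rule sum.cong[OF refl])
      fix \<tau> assume "\<tau> \<in> fc (Suc k)"
      moreover then have "m \<tau> > 0" using m_pos by (auto simp: fc_def)
      ultimately show "m \<tau> * codiff k f \<tau> * codiff k f \<tau>
          = (\<Sum>v\<in>nb \<tau>. m (insert v \<tau>) * f (insert v \<tau>))\<^sup>2 / m \<tau>"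
        by (simp add: codiff_def power2_eq_square)
    qed
    finally show "\<bar>cip (Suc k) (laplacian (Suc k) f - f - sdiff X k (codiff k f)) f\<bar>
        \<le> real (k + 2) * lam * cip (Suc k) f f"
      using laplacian_deviation[OF X k, of f] by (simp add: ip_simps)
  qed
qed

end

section \<open>The filtration by differentials and the induction on the dimension\<close>

context weighted_complex
begin

text \<open>For \<open>j < k\<close> this is $V_k^j$, while \<open>filt k k\<close> is $C_0^k$ instead of $V_k^k$. In this form the
subspaces are increasing in \<open>j\<close>, and $U_k^j$ is the complement of each one in the next, uniformly up to \<open>j = k\<close>.\<close>

definition filt :: "nat \<Rightarrow> nat \<Rightarrow> ('a set \<Rightarrow> real) set" where
  "filt k j = sdiff_iter X j (k - j) ` cochains0 X m j"

lemma filt_top: "filt k k = cochains0 X m k"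
  by (simp add: filt_def)

lemma filt_Suc: "j \<le> k \<Longrightarrow> filt (Suc k) j = sdiff X k ` filt k j"
  by (simp add: filt_def Suc_diff_le image_comp)

lemma sdiff_cochains0: "k \<le> n - 1 \<Longrightarrow> \<phi> \<in> cochains0 X m k \<Longrightarrow> sdiff X k \<phi> \<in> cochains0 X m (Suc k)"
  by (simp add: cochains0_eq sdiff_coch total_sdiff)

lemma filt_subspace: "j \<le> k \<Longrightarrow> fun_vs.subspace (filt k j)"
proof (induction k)
  case 0
  then show ?case by (simp add: filt_top[of 0] cochains0_subspace)
next
  case (Suc k)
  show ?case
  proof (cases "j = Suc k")
    case True
    then show ?thesis by (simp add: filt_top cochains0_subspace)
  next
    case False
    then have "fun_vs.subspace (filt k j)" using Suc by simp
    then have "fun_vs.subspace (sdiff X k ` filt k j)"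
      by (rule module_hom.subspace_image[OF sdiff_linear])
    then show ?thesis using False Suc.prems by (simp add: filt_Suc)
  qed
qed

lemma filt_subset: "j \<le> k \<Longrightarrow> k \<le> n - 1 \<Longrightarrow> filt k j \<subseteq> cochains0 X m k"
proof (induction k)
  case 0
  then show ?case by (simp add: filt_top[of 0])
next
  case (Suc k)
  then show ?case
    using sdiff_cochains0[of k] by (cases "j = Suc k") (fastforce simp: filt_top filt_Suc)+
qed

lemma filt_mono: "i \<le> j \<Longrightarrow> j \<le> k \<Longrightarrow> k \<le> n - 1 \<Longrightarrow> filt k i \<subseteq> filt k j"
proof (induction k)
  case (Suc k)
  show ?case
  proof (cases "j = Suc k")
    case True
    then show ?thesis using filt_subset[of i "Suc k"] Suc.prems by (simp add: filt_top)
  next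
    case False
    then show ?thesis using Suc by (simp add: filt_Suc image_mono)
  qed
qed simp

text \<open>The case \<open>j = k\<close> says that the kernel of the adjoint is the complement of the image of $C_0^{k-1}$ in $C_0^k$. Testing with
images of $C_0^{k-1}$ is enough since the adjoint itself maps $C_0^k$ into $C_0^{k-1}$.\<close>

lemma subU_eq:
  assumes "j \<le> k" "k \<le> n - 1"
  shows "subU X m k j = {\<phi> \<in> filt k j. j > 0 \<longrightarrow> (\<forall>\<psi>\<in>filt k (j - 1). cip k \<phi> \<psi> = 0)}"
proof (cases "j < k")
  case True
  then have "subV X m k j = filt k j" "subV X m k (j - 1) = filt k (j - 1)"
    by (simp_all add: subV_def filt_def less_imp_diff_less)
  then show ?thesis using True by (auto simp: subU_def cinner_eq)
next
  case False
  then have jk: "j = k" using assms(1) by simp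
  show ?thesis
  proof (cases k)
    case 0
    then show ?thesis using jk by (simp add: subU_def subV_def filt_top[of 0])
  next
    case (Suc l)
    have l: "l \<le> n - 1" using assms(2) Suc by simp
    have "\<phi> \<in> coch (Suc l) \<and> codiff l \<phi> = 0
        \<longleftrightarrow> \<phi> \<in> cochains0 X m (Suc l) \<and> (\<forall>\<psi>\<in>cochains0 X m l. cip (Suc l) \<phi> (sdiff X l \<psi>) = 0)" for \<phi>
    proof
      assume p: "\<phi> \<in> coch (Suc l) \<and> codiff l \<phi> = 0"
      have "real (l + 2) * total (Suc l) \<phi> = total l 0" using total_codiff[of l \<phi>] p by simp
      then have "total (Suc l) \<phi> = 0" by (simp add: total_def)
      then show "\<phi> \<in> cochains0 X m (Suc l) \<and> (\<forall>\<psi>\<in>cochains0 X m l. cip (Suc l) \<phi> (sdiff X l \<psi>) = 0)"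
        using p sdiff_adjoint[of l _ \<phi>] by (simp add: cochains0_eq ip_commute[of _ _ \<phi>] ip_simps)
    next
      assume p: "\<phi> \<in> cochains0 X m (Suc l) \<and> (\<forall>\<psi>\<in>cochains0 X m l. cip (Suc l) \<phi> (sdiff X l \<psi>) = 0)"
      then have "codiff l \<phi> \<in> cochains0 X m l" by (simp add: cochains0_eq codiff_coch total_codiff)
      then have "cip l (codiff l \<phi>) (codiff l \<phi>) = 0"
        using p sdiff_adjoint[of l "codiff l \<phi>" \<phi>] by (simp add: ip_commute[of _ _ \<phi>])
      then have "codiff l \<phi> = 0" using fc.inn_eq_0D codiff_coch by blast
      then show "\<phi> \<in> coch (Suc l) \<and> codiff l \<phi> = 0" using p by (simp add: cochains0_eq)
    qed
    then show ?thesis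
      using jk Suc by (auto simp: subU_def subV_def sdiff_adj_eq cochains_eq filt_top filt_Suc)
  qed
qed

lemma subU_subset: "j \<le> k \<Longrightarrow> k \<le> n - 1 \<Longrightarrow> subU X m k j \<subseteq> filt k j"
  by (auto simp: subU_eq)

lemma subU_subspace:
  assumes "j \<le> k" "k \<le> n - 1"
  shows "fun_vs.subspace (subU X m k j)"
  using filt_subspace[OF assms(1)] unfolding subU_eq[OF assms] fun_vs.subspace_def
  by (auto simp: ip_simps)

lemma subU_orth:
  assumes "i \<le> k" "j \<le> k" "k \<le> n - 1" "i \<noteq> j" "x \<in> subU X m k i" "y \<in> subU X m k j"
  shows "cip k x y = 0"
proof -
  have *: "cip k y x = 0" if "i < j" "j \<le> k" "x \<in> subU X m k i" "y \<in> subU X m k j" for i j x y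
  proof -
    have "filt k i \<subseteq> filt k (j - 1)" using that assms(3) by (intro filt_mono) auto
    then have "x \<in> filt k (j - 1)" using subU_subset[of i k] that assms(3) by auto
    then show ?thesis using that assms(3) by (auto simp: subU_eq)
  qed
  show ?thesis using *[of i j x y] *[of j i y x] assms by (metis ip_commute linorder_neqE_nat)
qed

lemma filt_decomposition:
  assumes "k \<le> n - 1"
  shows "j \<le> k \<Longrightarrow> x \<in> filt k j \<Longrightarrow> \<exists>u. (\<forall>i\<le>j. u i \<in> subU X m k i) \<and> x = (\<Sum>i\<le>j. u i)"
proof (induction j arbitrary: x)
  case 0
  then show ?case using assms by (intro exI[of _ "\<lambda>_. x"]) (simp add: subU_eq)
next
  case (Suc j)
  have sub: "filt k j \<subseteq> coch k"
    using filt_subset[of j k] Suc.prems assms by (auto simp: cochains0_eq)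
  obtain p where p: "orth_proj (fc (Suc k)) m (filt k j) x p"
    using fc.ex_orth_proj[OF filt_subspace sub] Suc.prems by auto
  then have "p \<in> filt k j" by (simp add: orth_proj_def)
  then obtain u where u: "\<forall>i\<le>j. u i \<in> subU X m k i" "p = (\<Sum>i\<le>j. u i)"
    using Suc.IH Suc.prems by auto
  have "p \<in> filt k (Suc j)" using \<open>p \<in> filt k j\<close> filt_mono[of j "Suc j" k] Suc.prems assms by auto
  then have "x - p \<in> filt k (Suc j)"
    using Suc.prems fun_vs.subspace_diff[OF filt_subspace[of "Suc j" k]] by simp
  then have d: "x - p \<in> subU X m k (Suc j)"
    using p Suc.prems assms by (simp add: subU_eq orth_proj_def)
  have "(\<Sum>i\<le>j. (u(Suc j := x - p)) i) = p"
    unfolding u(2) by (intro sum.cong) auto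
  then have "(\<Sum>i\<le>Suc j. (u(Suc j := x - p)) i) = p + (x - p)"
    by (simp only: sum.atMost_Suc fun_upd_same)
  then have "x = (\<Sum>i\<le>Suc j. (u(Suc j := x - p)) i)" by (simp only: add_diff_eq add_diff_cancel_left')
  moreover have "\<forall>i\<le>Suc j. (u(Suc j := x - p)) i \<in> subU X m k i" using u(1) d by (simp add: le_Suc_eq)
  ultimately show ?case by blast
qed

lemma approx_spectral_level:
  assumes k: "k \<le> n - 1" and e: "\<epsilon> \<ge> 0"
    and a: "\<And>i x. i \<le> k \<Longrightarrow> x \<in> subU X m k i \<Longrightarrow>
      cnm k (laplacian k x - fun_scale (real k + 1 - real i) x) \<le> \<epsilon> * cnm k x"
  shows "approx_spectral (fc (Suc k)) m (cochains0 X m k) (laplacian k) (subU X m k) k \<epsilon>"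
proof (unfold_locales)
  show "symmetric_on (fc (Suc k)) m (cochains0 X m k) (laplacian k)" by (rule laplacian_symmetric0[OF k])
  show "subU X m k i \<subseteq> cochains0 X m k" if "i \<le> k" for i
    using subU_subset[OF that k] filt_subset[OF that k] by blast
  show "\<exists>u. (\<forall>i\<le>k. u i \<in> subU X m k i) \<and> x = (\<Sum>i\<le>k. u i)" if "x \<in> cochains0 X m k" for x
    using filt_decomposition[OF k order_refl] that by (simp add: filt_top)
  show "fun_vs.subspace (subU X m k i)" if "i \<le> k" for i by (rule subU_subspace[OF that k])
  show "cip k x y = 0"
    if "i \<le> k" "j \<le> k" "i \<noteq> j" "x \<in> subU X m k i" "y \<in> subU X m k j" for i j x y
    by (rule subU_orth[OF that(1,2) k that(3-)])
qed (fact e, fact a)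

end

text \<open>The numbers of one induction step: \<open>P\<close> and \<open>N\<close> are the norms of \<open>\<psi>\<close> and \<open>d \<psi>\<close>, and \<open>H\<close> and \<open>D\<close> those of
\<open>h = A \<psi> - c \<psi>\<close> and \<open>d h\<close>. The constant works because \<open>(7/6)\<^sup>3 * 6/5 \<le> 4\<close>.\<close>

lemma step_estimate:
  fixes K \<delta> \<epsilon> P N H D :: real
  assumes "K \<ge> 1" "0 \<le> \<delta>" "\<delta> \<le> 1 / 6" "\<epsilon> \<ge> 0" "P \<ge> 0" "N \<ge> 0" "H \<ge> 0" "D \<ge> 0"
    and N: "(1 - \<delta>) * P\<^sup>2 \<le> N\<^sup>2" and H: "H \<le> \<epsilon> * (K + \<delta>) * P" and D: "D\<^sup>2 \<le> (K + \<delta>) * H\<^sup>2"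
  shows "D \<le> 2 * K * sqrt K * \<epsilon> * N"
proof (rule power2_le_imp_le)
  have "D\<^sup>2 \<le> (K + \<delta>) * H\<^sup>2" by (rule D)
  also have "\<dots> \<le> (K + \<delta>) * (\<epsilon> * (K + \<delta>) * P)\<^sup>2"
    using assms by (intro mult_left_mono power_mono) auto
  also have "\<dots> = (K + \<delta>) ^ 3 * \<epsilon>\<^sup>2 * P\<^sup>2" by (simp add: power2_eq_square power3_eq_cube mult_ac)
  also have "\<dots> \<le> (7 / 6 * K) ^ 3 * \<epsilon>\<^sup>2 * P\<^sup>2"
    using assms by (intro mult_right_mono power_mono) auto
  also have "\<dots> \<le> (7 / 6 * K) ^ 3 * \<epsilon>\<^sup>2 * (6 / 5 * N\<^sup>2)"
  proof (intro mult_left_mono)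
    have "5 / 6 * P\<^sup>2 \<le> (1 - \<delta>) * P\<^sup>2" using assms by (intro mult_right_mono) auto
    then show "P\<^sup>2 \<le> 6 / 5 * N\<^sup>2" using N by simp
  qed (use assms in auto)
  also have "\<dots> = 343 / 180 * (K ^ 3 * \<epsilon>\<^sup>2 * N\<^sup>2)" by (simp add: power_mult_distrib power_divide)
  also have "\<dots> \<le> 4 * (K ^ 3 * \<epsilon>\<^sup>2 * N\<^sup>2)" using assms by (intro mult_right_mono) auto
  also have "\<dots> = (2 * K * sqrt K * \<epsilon> * N)\<^sup>2"
    using assms by (simp add: power_mult_distrib power3_eq_cube power2_eq_square)
  finally show "D\<^sup>2 \<le> (2 * K * sqrt K * \<epsilon> * N)\<^sup>2" .
qed (use assms in simp)

lemma eps_ge_lam: "lam \<ge> 0 \<Longrightarrow> eps lam k \<ge> lam"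
proof (induction k)
  case (Suc k)
  define K where "K = real (Suc k)"
  have K: "K \<ge> 1" by (simp add: K_def)
  have "1 * 1 \<le> (2 * K) * (1 + 2 * K * sqrt K)" using K by (intro mult_mono) auto
  then have "1 * eps lam k \<le> (2 * K * (1 + 2 * K * sqrt K)) * eps lam k"
    using Suc by (intro mult_right_mono) auto
  moreover have "(K + 1) * lam \<ge> 0" using Suc.prems K by simp
  moreover have "eps lam (Suc k) = 2 * K * (1 + 2 * K * sqrt K) * eps lam k + (K + 1) * lam"
    by (simp add: K_def)
  ultimately show ?case using Suc.IH[OF Suc.prems] by linarith
qed simp

text \<open>The left-hand side is the error that the induction really produces. That it is at most half of the
next \<open>eps\<close> is what later compensates for the factor 2 lost in dividing by \<open>1 - \<delta>\<close>.\<close>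

lemma eps_Suc_half:
  assumes "lam \<ge> 0"
  shows "2 * real (Suc k) * sqrt (real (Suc k)) * eps lam k + (real (Suc k) + 1) * lam \<le> eps lam (Suc k) / 2"
proof -
  define K where "K = real (Suc k)"
  have K: "K \<ge> 1" by (simp add: K_def)
  have e: "eps lam k \<ge> lam" by (rule eps_ge_lam[OF assms])
  have "K * sqrt K * (2 * K - 2) * eps lam k \<ge> 0" using K e assms by (intro mult_nonneg_nonneg) auto
  moreover have "(K + 1) * lam \<le> (2 * K) * eps lam k" using K e assms by (intro mult_mono) auto
  ultimately have "2 * K * sqrt K * eps lam k + (K + 1) * lam
      \<le> (2 * K * (1 + 2 * K * sqrt K) * eps lam k + (K + 1) * lam) / 2"
    by (simp add: algebra_simps)
  then show ?thesis by (simp add: K_def)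
qed

text \<open>With \<open>s = sqrt K\<close> the claim reduces to \<open>3 s \<le> 1 + 2 s\<^sup>3\<close>, that is, to \<open>(s - 1) (2 s\<^sup>2 + 2 s - 1) \<ge> 0\<close>.\<close>

lemma delta_small:
  assumes "e \<ge> 0" "e \<le> 1 / (2 * (1 + 2 * K * sqrt K))" "K \<ge> 1"
  shows "sqrt K * e \<le> (1 / 6 :: real)"
proof -
  have p: "2 * (1 + 2 * K * sqrt K) > 0" using assms(3) by (intro mult_pos_pos add_pos_nonneg) auto
  define s where "s = sqrt K"
  have s: "s \<ge> 1" "K = s * s" using assms(3) by (auto simp: s_def)
  have "(s - 1) * (2 * s * s + (2 * s - 1)) \<ge> 0" using s(1) by (intro mult_nonneg_nonneg add_nonneg_nonneg) auto
  then have "6 * s \<le> 2 * (1 + 2 * K * s)" unfolding s(2) by (simp add: algebra_simps)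
  then have "6 * s * e \<le> 2 * (1 + 2 * K * s) * e" using assms(1) by (rule mult_right_mono)
  also have "\<dots> \<le> 1" using assms(2) p by (simp add: pos_le_divide_eq s_def mult_ac)
  finally show ?thesis by (simp add: s_def)
qed

context weighted_complex
begin

text \<open>For \<open>x = d \<psi>\<close> in $U_{k+1}^i$ with \<open>i \<le> k\<close>, the error on \<open>x\<close> is \<open>d h\<close> plus the deviation \<open>E\<close>, where \<open>h\<close> is the error of
the operator one level below at \<open>\<psi>\<close>; \<open>\<psi>\<close> is handled by \<open>near_top_component\<close>, since orthogonality of \<open>d \<psi>\<close>
to the images of the lower pieces is orthogonality of \<open>\<psi>\<close> to these pieces in the form of $d^* d$.\<close>

lemma laplacian_on_subU:
  assumes X: "two_sided_local_spectral_expander X n m lam"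
    and small: "\<And>k. Suc k \<le> n - 1 \<Longrightarrow> eps lam k \<le> 1 / (2 * (1 + 2 * real (Suc k) * sqrt (real (Suc k))))"
  shows "k \<le> n - 1 \<Longrightarrow> i \<le> k \<Longrightarrow> x \<in> subU X m k i \<Longrightarrow>
    cnm k (laplacian k x - fun_scale (real k + 1 - real i) x) \<le> (if k = 0 then 1 else 1 / 2) * eps lam k * cnm k x"
proof (induction k arbitrary: i x)
  case 0
  then have "x \<in> cochains0 X m 0" by (simp add: subU_eq filt_top[of 0])
  then have "cnm 0 (laplacian 0 x - x) \<le> lam * cnm 0 x" by (rule deviation_norm_0[OF X])
  moreover have "fun_scale (real 0 + 1 - real i) x = x" using 0 by (simp add: fun_scale_def)
  ultimately show ?case by (simp only: eps.simps simp_thms if_True mult_1)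
next
  case (Suc k)
  have k: "k \<le> n - 1" and lam: "lam \<ge> 0" using Suc.prems expander_lam_nonneg[OF X] by auto
  have e: "eps lam k \<ge> lam" "eps lam k \<ge> 0" using eps_ge_lam[OF lam] lam by (auto intro: order_trans)
  have half: "2 * real (Suc k) * sqrt (real (Suc k)) * eps lam k + (real (Suc k) + 1) * lam \<le> eps lam (Suc k) / 2"
    by (rule eps_Suc_half[OF lam])
  have "x \<in> filt (Suc k) i" using subU_subset[of i "Suc k"] Suc.prems by blast
  then have "x \<in> cochains0 X m (Suc k)" using filt_subset[of i "Suc k"] Suc.prems by blast
  then have xT: "x \<in> coch (Suc k)" by (simp add: cochains0_eq)
  define E where "E = laplacian (Suc k) x - x - sdiff X k (codiff k x)"
  have E: "cnm (Suc k) E \<le> (real (Suc k) + 1) * lam * cnm (Suc k) x"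
    using deviation_norm_Suc[OF X Suc.prems(1) xT] by (simp add: E_def add.commute)
  have "cnm (Suc k) (laplacian (Suc k) x - fun_scale (real (Suc k) + 1 - real i) x)
      \<le> (2 * real (Suc k) * sqrt (real (Suc k)) * eps lam k + (real (Suc k) + 1) * lam) * cnm (Suc k) x"
  proof (cases "i = Suc k")
    case True
    have "codiff k x = 0"
      using Suc.prems True by (simp add: subU_def subV_def sdiff_adj_eq)
    then have "laplacian (Suc k) x - fun_scale (real (Suc k) + 1 - real i) x = E"
      by (simp add: E_def True sdiff_lin)
    moreover have "0 \<le> 2 * real (Suc k) * sqrt (real (Suc k)) * eps lam k * cnm (Suc k) x"
      using e fc.nrm_ge_0 by simp
    ultimately show ?thesis using E unfolding distrib_right by simp
  next
    case False
    then have ik: "i \<le> k" using Suc.prems by simp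
    have IH: "cnm k (laplacian k y - fun_scale (real k + 1 - real j) y) \<le> eps lam k * cnm k y"
      if "j \<le> k" "y \<in> subU X m k j" for j y
    proof -
      have "(if k = 0 then 1 else 1 / 2) * eps lam k * cnm k y \<le> 1 * eps lam k * cnm k y"
        using e fc.nrm_ge_0 by (intro mult_right_mono) auto
      then have "(if k = 0 then 1 else 1 / 2) * eps lam k * cnm k y \<le> eps lam k * cnm k y"
        by (simp only: mult_1)
      with Suc.IH[OF k that] show ?thesis by (rule order_trans)
    qed
    interpret P: approx_spectral "fc (Suc k)" m "cochains0 X m k" "laplacian k" "subU X m k" k "eps lam k"
      by (rule approx_spectral_level[OF k e(2) IH])
    have d: "P.\<delta> \<le> 1 / 6"
      using delta_small[OF e(2) small[OF Suc.prems(1)]] by (simp add: P.\<delta>_def add.commute)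
    obtain \<psi> where psi: "\<psi> \<in> filt k i" and x: "x = sdiff X k \<psi>"
      using Suc.prems subU_subset[of i "Suc k"] ik by (auto simp: filt_Suc)
    obtain u where u: "\<forall>j\<le>i. u j \<in> subU X m k j" and psu: "\<psi> = (\<Sum>j\<le>i. u j)"
      using filt_decomposition[OF k ik psi] by blast
    have perp: "cip k (laplacian k \<psi>) y = 0" if "j < i" "y \<in> subU X m k j" for j y
    proof -
      have "y \<in> filt k (i - 1)"
      proof (rule subsetD[OF filt_mono[OF _ _ k]])
        show "y \<in> filt k j" using subU_subset[of j k] that ik k by auto
      qed (use that(1) ik in linarith)+
      then have "sdiff X k y \<in> filt (Suc k) (i - 1)" using ik by (simp add: filt_Suc)
      then have "cip (Suc k) x (sdiff X k y) = 0"
        using Suc.prems that(1) by (auto simp: subU_eq)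
      then show ?thesis
        using sdiff_adjoint[of k y "sdiff X k \<psi>"] by (simp add: x laplacian_def ip_commute)
    qed
    define h where "h = laplacian k \<psi> - fun_scale (P.c i) \<psi>"
    have near: "cnm k h \<le> eps lam k * (real k + 1 + P.\<delta>) * cnm k \<psi>"
      "(1 - P.\<delta>) * (cnm k \<psi>)\<^sup>2 \<le> cip k (laplacian k \<psi>) \<psi>"
      unfolding h_def using u d by (auto intro!: P.near_top_component[OF ik _ psu] perp)
    have psi0: "\<psi> \<in> cochains0 X m k" using psi filt_subset[OF ik k] by blast
    then have h0: "h \<in> cochains0 X m k"
      unfolding h_def using P.T(3) fun_vs.subspace_diff fun_vs.subspace_scale P.T(1) by blast
    have "cnm (Suc k) (sdiff X k h) \<le> 2 * real (Suc k) * sqrt (real (Suc k)) * eps lam k * cnm (Suc k) x"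
    proof (rule step_estimate[where \<delta> = P.\<delta> and P = "cnm k \<psi>" and H = "cnm k h"])
      show "(1 - P.\<delta>) * (cnm k \<psi>)\<^sup>2 \<le> (cnm (Suc k) x)\<^sup>2"
        using near(2) by (simp only: laplacian_form x)
      show "(cnm (Suc k) (sdiff X k h))\<^sup>2 \<le> (real (Suc k) + P.\<delta>) * (cnm k h)\<^sup>2"
        using P.quadratic_form_le[OF h0] by (simp add: laplacian_form add.commute)
      show "cnm k h \<le> eps lam k * (real (Suc k) + P.\<delta>) * cnm k \<psi>"
        using near(1) by (simp add: add.commute)
    qed (use d P.delta_ge_0 e fc.nrm_ge_0 in auto)
    moreover have "laplacian (Suc k) x - fun_scale (real (Suc k) + 1 - real i) x = sdiff X k h + E"
    proof -
      have "sdiff X k h = sdiff X k (codiff k x) - fun_scale (P.c i) x"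
        by (simp add: h_def sdiff_lin x laplacian_def)
      moreover have "fun_scale (real (Suc k) + 1 - real i) x = x + fun_scale (P.c i) x"
        by (simp add: P.c_def fun_scale_def fun_eq_iff algebra_simps)
      ultimately show ?thesis by (simp add: E_def)
    qed
    ultimately show ?thesis
      using fc.nrm_triangle[of "Suc (Suc k)" "sdiff X k h" E] E unfolding distrib_right by simp
  qed
  also have "\<dots> \<le> eps lam (Suc k) / 2 * cnm (Suc k) x"
    using half fc.nrm_ge_0 by (rule mult_right_mono)
  also have "\<dots> = (if Suc k = 0 then 1 else 1 / 2) * eps lam (Suc k) * cnm (Suc k) x" by simp
  finally show ?case .
qed

end

section \<open>The eigenvalue strips and the subspaces of lower cochains\<close>

context weighted_complex
begin

lemma proj_orth_proj:
  assumes "fun_vs.subspace U" "U \<subseteq> coch k"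
  shows "orth_proj (fc (Suc k)) m U \<phi> (proj X m k U \<phi>)"
proof -
  have eq: "is_proj X m k U \<phi> = orth_proj (fc (Suc k)) m U \<phi>"
    by (simp add: is_proj_def orth_proj_def cinner_eq fun_eq_iff)
  obtain u where u: "orth_proj (fc (Suc k)) m U \<phi> u" using fc.ex_orth_proj[OF assms] .
  show ?thesis
    unfolding proj_def eq
    by (rule theI[of "orth_proj (fc (Suc k)) m U \<phi>" u, OF u]) (rule fc.orth_proj_unique[OF assms _ u])
qed

lemma upper_walk_eigen_iff:
  assumes "k \<le> n - 1" "\<phi> \<in> coch k"
  shows "upper_walk X m k \<phi> = fun_scale \<mu> \<phi> \<longleftrightarrow> laplacian k \<phi> = fun_scale ((real k + 2) * \<mu>) \<phi>"
proof -
  have "real k + 2 \<noteq> 0" by linarith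
  have "upper_walk X m k \<phi> = fun_scale \<mu> \<phi>
      \<longleftrightarrow> fun_scale (real k + 2) (upper_walk X m k \<phi>) = fun_scale (real k + 2) (fun_scale \<mu> \<phi>)"
    using fun_vs.scale_left_imp_eq[OF \<open>real k + 2 \<noteq> 0\<close>] by metis
  then show ?thesis by (simp add: upper_walk_eq[OF assms])
qed

text \<open>The eigenvectors of the upper walk in the given interval are those of \<open>laplacian k\<close> in the strip of radius \<open>P.\<delta>\<close>
around \<open>P.c j\<close>, so \<open>subW\<close> is the space \<open>P.W j\<close> of the perturbation theory. The distance constant is
\<open>a = (eps / 2) / (1 - \<delta>) \<le> eps\<close>, valid for \<open>k = 0\<close> because then \<open>W\<close> is everything.\<close>

lemma main_bounds:
  assumes X: "two_sided_local_spectral_expander X n m lam"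
    and small: "\<And>k. Suc k \<le> n - 1 \<Longrightarrow> eps lam k \<le> 1 / (2 * (1 + 2 * real (Suc k) * sqrt (real (Suc k))))"
    and top: "eps lam (n - 1) < 1 / (2 * sqrt (real n))"
    and k: "k \<le> n - 1"
  shows "\<lbrakk>j \<le> k; \<phi> \<in> subU X m k j\<rbrakk> \<Longrightarrow>
      cnm k (\<phi> - proj X m k (subW X m lam k j) \<phi>) \<le> sqrt (real k + 2) * eps lam k * cnm k \<phi>" (is "_ \<Longrightarrow> _ \<Longrightarrow> ?A")
    and "\<lbrakk>j \<le> k; \<phi> \<in> cochains0 X m k\<rbrakk> \<Longrightarrow>
      \<bar>(cnm k (proj X m k (subW X m lam k j) \<phi>))\<^sup>2 - (cnm k (proj X m k (subU X m k j) \<phi>))\<^sup>2\<bar>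
      \<le> (sqrt (real k + 2) * eps lam k + sqrt (real k + 1) * eps lam k / (1 - sqrt (real k + 1) * eps lam k))
        * (cnm k \<phi>)\<^sup>2" (is "_ \<Longrightarrow> _ \<Longrightarrow> ?B")
proof -
  have lam: "lam \<ge> 0" by (rule expander_lam_nonneg[OF X])
  have e: "eps lam k \<ge> 0" using eps_ge_lam[OF lam, of k] lam by linarith
  have approx: "cnm k (laplacian k x - fun_scale (real k + 1 - real i) x)
      \<le> (if k = 0 then 1 else 1 / 2) * eps lam k * cnm k x" if "i \<le> k" "x \<in> subU X m k i" for i x
    by (rule laplacian_on_subU[OF X small k that])
  interpret P: approx_spectral "fc (Suc k)" m "cochains0 X m k" "laplacian k" "subU X m k" k "eps lam k"
  proof (rule approx_spectral_level[OF k e])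
    fix i x assume *: "i \<le> k" "x \<in> subU X m k i"
    have "(if k = 0 then 1 else 1 / 2) * eps lam k * cnm k x \<le> 1 * eps lam k * cnm k x"
      using e fc.nrm_ge_0 by (intro mult_right_mono) auto
    also have "\<dots> = eps lam k * cnm k x" by (rule arg_cong[OF mult_1])
    finally show "cnm k (laplacian k x - fun_scale (real k + 1 - real i) x) \<le> eps lam k * cnm k x"
      by (rule order_trans[OF approx[OF *]])
  qed
  have d: "P.\<delta> < 1 / 2"
  proof (cases "k = n - 1")
    case True
    then have kn: "real k + 1 = real n" using n_pos by simp
    have "sqrt (real n) > 0" using n_pos by simp
    then have "2 * sqrt (real n) > 0" by (rule mult_pos_pos[rotated]) simp
    then have "eps lam (n - 1) * (2 * sqrt (real n)) < 1" using top by (simp only: pos_less_divide_eq)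
    then have "2 * (sqrt (real n) * eps lam (n - 1)) < 1" by (simp only: mult_ac)
    moreover have "P.\<delta> = sqrt (real n) * eps lam (n - 1)" unfolding P.\<delta>_def kn by (simp only: True)
    ultimately show ?thesis by linarith
  next
    case False
    then have "Suc k \<le> n - 1" using k by simp
    from delta_small[OF e small[OF this]] have "sqrt (real (Suc k)) * eps lam k \<le> 1 / 6" by simp
    then show ?thesis by (simp add: P.\<delta>_def add.commute)
  qed
  have W: "subW X m lam k j = P.W j" for j
  proof -
    have K: "real k + 2 > 0" by linarith
    have "(\<exists>\<mu>. upper_walk X m k \<phi> = fun_scale \<mu> \<phi> \<and>
        (real k + 1 - real j) / (real k + 2) - sqrt (real k + 1) / (real k + 2) * eps lam k \<le> \<mu> \<and>
        \<mu> \<le> (real k + 1 - real j) / (real k + 2) + sqrt (real k + 1) / (real k + 2) * eps lam k)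
      \<longleftrightarrow> (\<exists>\<nu>. laplacian k \<phi> = fun_scale \<nu> \<phi> \<and> \<bar>\<nu> - P.c j\<bar> \<le> P.\<delta>)" (is "(\<exists>\<mu>. ?L \<mu>) \<longleftrightarrow> (\<exists>\<nu>. ?R \<nu>)")
      if phi: "\<phi> \<in> cochains0 X m k" for \<phi>
    proof -
      have LR: "?L \<mu> \<longleftrightarrow> ?R ((real k + 2) * \<mu>)" for \<mu>
      proof -
        have "((real k + 1 - real j) / (real k + 2) - sqrt (real k + 1) / (real k + 2) * eps lam k \<le> \<mu>)
            \<longleftrightarrow> P.c j - P.\<delta> \<le> (real k + 2) * \<mu>"
          using pos_divide_le_eq[OF K, of "P.c j - P.\<delta>" \<mu>]
          by (simp add: P.c_def P.\<delta>_def diff_divide_distrib mult.commute[of \<mu>])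
        moreover have "(\<mu> \<le> (real k + 1 - real j) / (real k + 2) + sqrt (real k + 1) / (real k + 2) * eps lam k)
            \<longleftrightarrow> (real k + 2) * \<mu> \<le> P.c j + P.\<delta>"
          using pos_le_divide_eq[OF K, of \<mu> "P.c j + P.\<delta>"]
          by (simp add: P.c_def P.\<delta>_def add_divide_distrib mult.commute[of \<mu>])
        ultimately show ?thesis
          using upper_walk_eigen_iff[OF k, of \<phi> \<mu>] phi by (auto simp: cochains0_eq)
      qed
      have "?L (\<nu> / (real k + 2)) \<longleftrightarrow> ?R \<nu>" for \<nu>
        using LR[of "\<nu> / (real k + 2)"] K by simp
      then show ?thesis using LR by metis
    qed
    then have "{\<phi> \<in> cochains0 X m k. \<phi> \<noteq> 0 \<and> (\<exists>\<mu>. upper_walk X m k \<phi> = fun_scale \<mu> \<phi> \<and>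
        (real k + 1 - real j) / (real k + 2) - sqrt (real k + 1) / (real k + 2) * eps lam k \<le> \<mu> \<and>
        \<mu> \<le> (real k + 1 - real j) / (real k + 2) + sqrt (real k + 1) / (real k + 2) * eps lam k)}
      = {\<phi> \<in> cochains0 X m k. \<phi> \<noteq> 0 \<and> (\<exists>\<nu>. laplacian k \<phi> = fun_scale \<nu> \<phi> \<and> \<bar>\<nu> - P.c j\<bar> \<le> P.\<delta>)}"
      by (intro Collect_cong conj_cong refl)
    then show ?thesis unfolding subW_def P.W_def by (rule arg_cong)
  qed
  have subs: "V \<subseteq> coch k" if "V \<subseteq> cochains0 X m k" for V using that by (auto simp: cochains0_eq)
  have pW: "orth_proj (fc (Suc k)) m (P.W j) \<phi> (proj X m k (subW X m lam k j) \<phi>)" for j \<phi>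
    unfolding W using P.W_subspace P.W_subset by (intro proj_orth_proj subs)
  define a where "a = eps lam k / 2 / (1 - P.\<delta>)"
  have a: "a \<ge> 0" using e d by (simp add: a_def)
  have close: "cnm k (x - p) \<le> a * cnm k x"
    if i: "i \<le> k" and x: "x \<in> subU X m k i" and p: "orth_proj (fc (Suc k)) m (P.W i) x p" for i x p
  proof (cases "k = 0")
    case True
    have "x - p \<in> P.Z i" using P.orth_proj_W_rest[OF _ p] P.U_subset[OF i] x by blast
    moreover have "i = 0" using i True by simp
    ultimately have "x - p \<in> P.Z 0" by (simp only:)
    then have "x - p = 0" by (rule P.Z_trivial[OF True])
    then have "cnm k (x - p) = 0" by (simp only: nm_def ip_zero_left real_sqrt_zero)
    then show ?thesis using a fc.nrm_ge_0 by simp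
  next
    case False
    have "(1 - P.\<delta>) * cnm k (x - p) \<le> cnm k (laplacian k x - fun_scale (P.c i) x)"
    proof (rule P.W_gap[OF i _ _ p])
      show "P.\<delta> < 1" using d by linarith
      show "x \<in> cochains0 X m k" using P.U_subset[OF i] x by (rule subsetD)
    qed
    also have "\<dots> \<le> (if k = 0 then 1 else 1 / 2) * eps lam k * cnm k x"
      unfolding P.c_def by (rule approx[OF i x])
    also have "\<dots> = eps lam k / 2 * cnm k x" using False by simp
    finally have "cnm k (x - p) * (1 - P.\<delta>) \<le> eps lam k / 2 * cnm k x" by (simp only: mult.commute)
    moreover have "1 - P.\<delta> > 0" using d by simp
    ultimately have "cnm k (x - p) \<le> eps lam k / 2 * cnm k x / (1 - P.\<delta>)" by (simp only: pos_le_divide_eq)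
    then show ?thesis by (simp add: a_def)
  qed
  have a1: "a \<le> sqrt (real k + 2) * eps lam k"
  proof -
    have "eps lam k / 2 / (1 - P.\<delta>) \<le> eps lam k / 2 / (1 / 2)"
      using e d by (intro divide_left_mono) auto
    also have "\<dots> = 1 * eps lam k" by simp
    also have "\<dots> \<le> sqrt (real k + 2) * eps lam k" using e by (intro mult_right_mono) auto
    finally show ?thesis by (simp add: a_def)
  qed
  have a2: "sqrt (real k) * a \<le> sqrt (real k + 1) * eps lam k / (1 - sqrt (real k + 1) * eps lam k)"
  proof -
    have "sqrt (real k) * (eps lam k / 2) \<le> sqrt (real k + 1) * eps lam k"
      using e by (intro mult_mono) auto
    then have "sqrt (real k) * (eps lam k / 2) / (1 - P.\<delta>) \<le> sqrt (real k + 1) * eps lam k / (1 - P.\<delta>)"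
      using d by (intro divide_right_mono) auto
    then show ?thesis by (simp add: a_def P.\<delta>_def)
  qed
  show ?A if "j \<le> k" "\<phi> \<in> subU X m k j"
    by (rule order_trans[OF close[OF that pW] mult_right_mono[OF a1 fc.nrm_ge_0]])
  show ?B if j: "j \<le> k" and f: "\<phi> \<in> cochains0 X m k"
  proof -
    have pU: "orth_proj (fc (Suc k)) m (subU X m k j) \<phi> (proj X m k (subU X m k j) \<phi>)"
      using P.U_subspace[OF j] P.U_subset[OF j] by (intro proj_orth_proj subs)
    have "\<bar>(cnm k (proj X m k (subW X m lam k j) \<phi>))\<^sup>2 - (cnm k (proj X m k (subU X m k j) \<phi>))\<^sup>2\<bar>
      \<le> (a + sqrt (real k) * a) * (cnm k \<phi>)\<^sup>2"
      by (rule P.projection_comparison[OF d j f close a pW pU])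
    also have "\<dots> \<le> (sqrt (real k + 2) * eps lam k
        + sqrt (real k + 1) * eps lam k / (1 - sqrt (real k + 1) * eps lam k)) * (cnm k \<phi>)\<^sup>2"
      using a1 a2 by (intro mult_right_mono add_mono) auto
    finally show ?thesis .
  qed
qed

end

theorem theorem5p10:
  fixes X :: "'a set set" and n :: nat and m :: "'a set \<Rightarrow> real" and lam :: real
  assumes "pure_complex X n"
    and "weight_function X n m"
    and "two_sided_local_spectral_expander X n m lam"
    and "\<forall>k::nat. int k \<le> int n - 2 \<longrightarrow>
           eps lam k \<le> 1 / (2 * (1 + 2 * (real k + 1) * sqrt (real k + 1)))"
    and "eps lam (n - 1) < 1 / (2 * sqrt (real n))"
  shows "\<forall>k\<le>n - 1.
      (\<forall>j0\<le>k. \<forall>\<phi>\<in>subU X m k j0.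
         cnorm X m k (\<phi> - proj X m k (subW X m lam k j0) \<phi>)
           \<le> sqrt (real k + 2) * eps lam k * cnorm X m k \<phi>) \<and>
      (\<forall>j\<le>k. \<forall>\<phi>\<in>cochains0 X m k.
         (cnorm X m k (proj X m k (subW X m lam k j) \<phi>))\<^sup>2
           \<le> (cnorm X m k (proj X m k (subU X m k j) \<phi>))\<^sup>2
             + (sqrt (real k + 2) * eps lam k
                + sqrt (real k + 1) * eps lam k / (1 - sqrt (real k + 1) * eps lam k))
               * (cnorm X m k \<phi>)\<^sup>2 \<and>
         (cnorm X m k (proj X m k (subW X m lam k j) \<phi>))\<^sup>2
           \<ge> (cnorm X m k (proj X m k (subU X m k j) \<phi>))\<^sup>2
             - (sqrt (real k + 2) * eps lam k
                + sqrt (real k + 1) * eps lam k / (1 - sqrt (real k + 1) * eps lam k))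
               * (cnorm X m k \<phi>)\<^sup>2)"
proof -
  interpret C: weighted_complex X n m by unfold_locales (fact assms)+
  have small: "eps lam k \<le> 1 / (2 * (1 + 2 * real (Suc k) * sqrt (real (Suc k))))" if "Suc k \<le> n - 1" for k
  proof -
    have "int k \<le> int n - 2" using that by simp
    then show ?thesis using assms(4) by (simp add: add.commute)
  qed
  have split_bound: "x \<le> y + b \<and> y - b \<le> x" if "\<bar>x - y\<bar> \<le> b" for x y b :: real
    using that by linarith
  note bounds = C.main_bounds[OF assms(3) small assms(5)]
  show ?thesis
    unfolding C.cnorm_eq
  proof (intro allI impI conjI ballI)
    fix k j \<phi> assume k: "k \<le> n - 1" and j: "j \<le> k"
    show "C.cnm k (\<phi> - proj X m k (subW X m lam k j) \<phi>) \<le> sqrt (real k + 2) * eps lam k * C.cnm k \<phi>"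
      if "\<phi> \<in> subU X m k j"
      by (rule bounds(1)[OF _ k j that])
    assume f: "\<phi> \<in> cochains0 X m k"
    have b: "\<bar>(C.cnm k (proj X m k (subW X m lam k j) \<phi>))\<^sup>2 - (C.cnm k (proj X m k (subU X m k j) \<phi>))\<^sup>2\<bar>
      \<le> (sqrt (real k + 2) * eps lam k + sqrt (real k + 1) * eps lam k / (1 - sqrt (real k + 1) * eps lam k))
        * (C.cnm k \<phi>)\<^sup>2"
      by (rule bounds(2)[OF _ k j f])
    show "(C.cnm k (proj X m k (subW X m lam k j) \<phi>))\<^sup>2
        \<le> (C.cnm k (proj X m k (subU X m k j) \<phi>))\<^sup>2
          + (sqrt (real k + 2) * eps lam k
             + sqrt (real k + 1) * eps lam k / (1 - sqrt (real k + 1) * eps lam k)) * (C.cnm k \<phi>)\<^sup>2"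
      "(C.cnm k (proj X m k (subW X m lam k j) \<phi>))\<^sup>2
        \<ge> (C.cnm k (proj X m k (subU X m k j) \<phi>))\<^sup>2
          - (sqrt (real k + 2) * eps lam k
             + sqrt (real k + 1) * eps lam k / (1 - sqrt (real k + 1) * eps lam k)) * (C.cnm k \<phi>)\<^sup>2"
      by (rule split_bound[OF b, THEN conjunct1], rule split_bound[OF b, THEN conjunct2])
  qed
qed

end
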